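(* Let $D$ be a cylindric diagram on $\mathfrak{C}_{x,y}$ and let $\beta\in\mathbb{N}^n$, where $n\geq 1$. Let $\theta$ be the skew diagram obtained from the unfolding $\lambda/\mu$ of $D$ by deleting its first column. Let $c_1,\dots,c_m$ be the possible fillings of the first column with entries in $\{1,\dots,n\}$, with indicator vectors $\nu_1,\dots,\nu_m\in\{0,1\}^n$ of their contents and associated flags $(\mathbf{a}_i,\mathbf{b}_i)$. Then $$[\mathbf{x}^\beta]\,s_D=\sum_{i=1}^m K_{\theta,\,\beta-\nu_i}(\mathbf{a}_i,\mathbf{b}_i).$$ Moreover, the map $k\mapsto[\mathbf{x}^{k\beta}]\,s_{kD}$ (for integers $k\ge1$) is a polynomial in $k$.
   Context: **Cylindric diagrams and Schur functions.** Fix integers $x,y\ge 1$. $\mathfrak{C}_{x,y}$ is the lattice $\mathbb{Z}^2$ modulo translation by $(x,-y)$; boxes of $\mathfrak{C}_{x,y}$ are unit boxes $(i,j)$ (column $i$, row $j$, rows counted upwards) modulo this translation. A boundary loop is the image in $\mathfrak{C}_{x,y}$ of an infinite lattice path with unit steps right and down invariant under translation by $(x,-y)$. A cylindric diagram $D$ is a pair of boundary loops $(B_I,B_O)$ with $B_I$ weakly left/below $B_O$, identified with the finite set of boxes between them. A cylindric semistandard Young tableau (CSSYT) of shape $D$ is a filling of the boxes with positive integers, weakly increasing when moving to the box of $D$ immediately to the right and strictly increasing when moving to the box of $D$ immediately above (adjacency on the cylinder). $s_D=\sum_T\prod_{b\in D}x_{T(b)}$, and $[\mathbf{x}^\beta]s_D$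 is the number of CSSYTs of shape $D$ with exactly $\beta_i$ entries $i$ for $1\le i\le n$ and no other entries. For $k\ge1$, $kD$ is the cylindric diagram on $\mathfrak{C}_{kx,y}$ obtained by subdividing each box of $D$ horizontally into $k$ boxes. **Unfolding.** Designate a column of $D$ as first column, and number columns so that it is column $1$. Let $\tilde D\subset\mathbb{Z}^2$ be the preimage of $D$ (invariant under translation by $(x,-y)$). The unfolding $\lambda/\mu$ is the planar skew diagram consisting of the boxes of $\tilde D$ in columns $1,\dots,x$; $\theta$ consists of those in columns $2,\dots,x$. Rows are labelled by their integer row index $r$. **First column fillings and flags.** A possible filling $c$ of the first column assigns to each box $(1,r)\in\tilde D$ an entry $c(r)\in\{1,\dots,n\}$, strictly increasing in $r$, and satisfying all CSSYT conditions that only involve boxes of the first column (when $x\geq2$ strict increase is the only one; when $x=1$ one also needs $c(r)\le c(r+y)$ whenever both are defined). Its indicator vector $\nu\in\{0,1\}^n$ has $i$-th coordinate $1$ iff $i$ is a value of $c$. Its flags $\mathbf{a},\mathbf{b}$, indexed by the rows $r$, are: $a_r=c(r)$ if $(1,r)\in\tilde D$ and $a_r=1$ otherwise; $b_r=c(r+y)$ if $(1,r+y)\in\tilde D$ and $b_r=n$ otherwise. **Flagged Kostka coefficients.** $K_{\theta,\gamma}(\mathbf{a},\mathbf{b})$ is the number of semistandard fillings of $\theta$ (positive integers, rows weakly increasing to the right, columns strictly increasing upwards) such that entries in row $r$ lie in $\{a_r,\dots,b_r\}$ and there are exactly $\gamma_i$ entries equal to $i$ for $1\le i\le n$ and no others;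 it is $0$ if $\gamma$ has a negative entry. *)

theory Defs
  imports "HOL-Library.FuncSet" "HOL-Computational_Algebra.Polynomial"
begin

text \<open>Points and boxes of the cylinder are orbits of integer pairs under translation by
  \<open>(x, -y)\<close>. The box \<open>(i, j)\<close> (column \<open>i\<close>, row \<open>j\<close>) is the unit square
  \<open>[i-1, i] \<times> [j-1, j]\<close>.\<close>

type_synonym orbit = "(int \<times> int) set"

definition cyl_rel :: "int \<Rightarrow> int \<Rightarrow> ((int \<times> int) \<times> (int \<times> int)) set" where
  "cyl_rel x y = {(p, q). \<exists>t::int. fst q = fst p + t * x \<and> snd q = snd p - t * y}"

definition cyl :: "int \<Rightarrow> int \<Rightarrow> int \<times> int \<Rightarrow> orbit" where
  "cyl x y p = cyl_rel x y `` {p}"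

definition preim :: "int \<Rightarrow> int \<Rightarrow> orbit set \<Rightarrow> (int \<times> int) set" where
  "preim x y S = {p. cyl x y p \<in> S}"

definition lattice_path :: "(int \<Rightarrow> int \<times> int) \<Rightarrow> bool" where
  "lattice_path p \<longleftrightarrow>
     (\<forall>t. p (t + 1) = (fst (p t) + 1, snd (p t)) \<or> p (t + 1) = (fst (p t), snd (p t) - 1))"

definition boundary_loop :: "int \<Rightarrow> int \<Rightarrow> orbit set \<Rightarrow> bool" where
  "boundary_loop x y B \<longleftrightarrow>
     (\<exists>p. lattice_path p \<and> (\<lambda>(u, v). (u + x, v - y)) ` range p = range p \<and> B = cyl x y ` range p)"

definition weakly_sw :: "int \<times> int \<Rightarrow> int \<times> int \<Rightarrow> bool" where
  "weakly_sw p q \<longleftrightarrow> fst p \<le> fst q \<and> snd p \<le> snd q"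

definition loop_le :: "int \<Rightarrow> int \<Rightarrow> orbit set \<Rightarrow> orbit set \<Rightarrow> bool" where
  "loop_le x y B B' \<longleftrightarrow> (\<forall>p \<in> preim x y B. \<exists>q \<in> preim x y B'. weakly_sw p q)"

text \<open>Since loops run right and down, a box lies above a loop iff its lower left corner is
  weakly above and to the right of a vertex of the loop; dually for boxes below a loop.
  A diagram is represented by the set of boxes between its two loops.\<close>

definition boxes_between :: "int \<Rightarrow> int \<Rightarrow> orbit set \<Rightarrow> orbit set \<Rightarrow> orbit set" where
  "boxes_between x y BI BO = cyl x y ` {(i, j).
     (\<exists>p \<in> preim x y BI. weakly_sw p (i - 1, j - 1)) \<and> (\<exists>q \<in> preim x y BO. weakly_sw (i, j) q)}"

definition cylindric_diagram :: "int \<Rightarrow> int \<Rightarrow> orbit set \<Rightarrow> bool" where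
  "cylindric_diagram x y D \<longleftrightarrow>
     (\<exists>BI BO. boundary_loop x y BI \<and> boundary_loop x y BO \<and> loop_le x y BI BO
        \<and> D = boxes_between x y BI BO)"

text \<open>A diagram on the \<open>(k * x, y)\<close> cylinder: the box \<open>(i, j)\<close> is cut into the boxes
  in row \<open>j\<close> and columns \<open>k * (i - 1) + 1, \<dots>, k * i\<close>.\<close>

definition stretch :: "nat \<Rightarrow> int \<Rightarrow> int \<Rightarrow> orbit set \<Rightarrow> orbit set" where
  "stretch k x y D =
     {cyl (int k * x) y (i', j) | i' i j. (i, j) \<in> preim x y D \<and> int k * (i - 1) < i' \<and> i' \<le> int k * i}"

text \<open>An exponent vector of length \<open>n\<close> is a function of which only the values at
  \<open>1, \<dots>, n\<close> matter.\<close>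

definition has_content :: "nat \<Rightarrow> 'b set \<Rightarrow> ('b \<Rightarrow> nat) \<Rightarrow> (nat \<Rightarrow> int) \<Rightarrow> bool" where
  "has_content n S T \<gamma> \<longleftrightarrow>
     (\<forall>b \<in> S. T b \<in> {1..n}) \<and> (\<forall>i \<in> {1..n}. int (card {b \<in> S. T b = i}) = \<gamma> i)"

definition cssyts :: "int \<Rightarrow> int \<Rightarrow> orbit set \<Rightarrow> (orbit \<Rightarrow> nat) set" where
  "cssyts x y D = {T \<in> D \<rightarrow>\<^sub>E {1..}. \<forall>i j. cyl x y (i, j) \<in> D \<longrightarrow>
     (cyl x y (i + 1, j) \<in> D \<longrightarrow> T (cyl x y (i, j)) \<le> T (cyl x y (i + 1, j))) \<and>
     (cyl x y (i, j + 1) \<in> D \<longrightarrow> T (cyl x y (i, j)) < T (cyl x y (i, j + 1)))}"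

definition cyl_schur_coeff :: "int \<Rightarrow> int \<Rightarrow> orbit set \<Rightarrow> nat \<Rightarrow> (nat \<Rightarrow> nat) \<Rightarrow> nat" where
  "cyl_schur_coeff x y D n \<beta> = card {T \<in> cssyts x y D. has_content n D T (\<lambda>i. int (\<beta> i))}"

text \<open>The designated first column is the column with index \<open>1\<close>.\<close>

definition unfolding_of :: "int \<Rightarrow> int \<Rightarrow> orbit set \<Rightarrow> (int \<times> int) set" where
  "unfolding_of x y D = {(i, r) \<in> preim x y D. 1 \<le> i \<and> i \<le> x}"

definition theta :: "int \<Rightarrow> int \<Rightarrow> orbit set \<Rightarrow> (int \<times> int) set" where
  "theta x y D = {(i, r) \<in> unfolding_of x y D. i \<noteq> 1}"

definition first_col :: "int \<Rightarrow> int \<Rightarrow> orbit set \<Rightarrow> int set" where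
  "first_col x y D = {r. (1, r) \<in> preim x y D}"

text \<open>If \<open>x = 1\<close>, the right neighbour of \<open>(1, r)\<close> is \<open>(2, r)\<close>, which is the same box of the
  cylinder as \<open>(1, r + y)\<close>.\<close>

definition first_col_fillings :: "int \<Rightarrow> int \<Rightarrow> orbit set \<Rightarrow> nat \<Rightarrow> (int \<Rightarrow> nat) set" where
  "first_col_fillings x y D n = {c \<in> first_col x y D \<rightarrow>\<^sub>E {1..n}.
     strict_mono_on (first_col x y D) c \<and>
     (x = 1 \<longrightarrow> (\<forall>r. r \<in> first_col x y D \<and> r + y \<in> first_col x y D \<longrightarrow> c r \<le> c (r + y)))}"

definition indicator_vec :: "int \<Rightarrow> int \<Rightarrow> orbit set \<Rightarrow> (int \<Rightarrow> nat) \<Rightarrow> nat \<Rightarrow> int" where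
  "indicator_vec x y D c i = (if i \<in> c ` first_col x y D then 1 else 0)"

definition flag_a :: "int \<Rightarrow> int \<Rightarrow> orbit set \<Rightarrow> (int \<Rightarrow> nat) \<Rightarrow> int \<Rightarrow> nat" where
  "flag_a x y D c r = (if r \<in> first_col x y D then c r else 1)"

definition flag_b :: "int \<Rightarrow> int \<Rightarrow> orbit set \<Rightarrow> nat \<Rightarrow> (int \<Rightarrow> nat) \<Rightarrow> int \<Rightarrow> nat" where
  "flag_b x y D n c r = (if r + y \<in> first_col x y D then c (r + y) else n)"

definition ssyts :: "(int \<times> int) set \<Rightarrow> (int \<times> int \<Rightarrow> nat) set" where
  "ssyts S = {T \<in> S \<rightarrow>\<^sub>E {1..}.
     (\<forall>i i' r. (i, r) \<in> S \<and> (i', r) \<in> S \<and> i < i' \<longrightarrow> T (i, r) \<le> T (i', r)) \<and>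
     (\<forall>i r r'. (i, r) \<in> S \<and> (i, r') \<in> S \<and> r < r' \<longrightarrow> T (i, r) < T (i, r'))}"

text \<open>If \<open>\<gamma>\<close> has a negative entry, no tableau has content \<open>\<gamma>\<close> and the value is \<open>0\<close>.\<close>

definition flagged_kostka ::
  "nat \<Rightarrow> (int \<times> int) set \<Rightarrow> (nat \<Rightarrow> int) \<Rightarrow> (int \<Rightarrow> nat) \<Rightarrow> (int \<Rightarrow> nat) \<Rightarrow> nat" where
  "flagged_kostka n S \<gamma> a b =
     card {T \<in> ssyts S. has_content n S T \<gamma> \<and> (\<forall>(i, r) \<in> S. T (i, r) \<in> {a r..b r})}"

end

theory Submission
  imports Defs "HOL-Library.List_Lexorder" "HOL-Combinatorics.Permutations"
begin

text \<open>
The identity comes from cutting the cylinder along the first column. Given the filling \<open>c\<close> of that column,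
the remaining columns form the planar diagram \<open>\<theta>\<close>, and the conditions between the two parts are lower bounds
for the rows of \<open>\<theta>\<close> (from column \<open>1\<close> on the left) and upper bounds (from column \<open>1\<close> again, \<open>y\<close> rows higher, on
the right). These bounds are the flags; see \<open>cyl_schur_coeff_first_column\<close>.

For the polynomiality, a tableau is described by the columns in which the entries \<open>\<le> l\<close> of each row end, for
\<open>l = 0, \<dots>, n\<close>. This is a chain of quasi-periodic sequences, consecutive ones interlacing, from the left
boundary of the diagram to the right one (\<open>cyl_schur_coeff_eq_card_walks\<close>). Two arguments are combined.

The chains for the \<open>k\<close>-fold stretched diagram are the lattice points of the \<open>k\<close>-th dilate of a fixed rational
polytope. Eliminating one coordinate after the other shows that their number is a quasi-polynomial in \<open>k\<close>
for all \<open>k \<ge> 1\<close> (\<open>card_ray_box_quasi_poly\<close>, \<open>card_strict_walks_quasi_poly\<close>). The polytope need not have integral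
vertices, so the period remains to be excluded.

On the other hand the number is eventually polynomial. After subtracting \<open>j\<close> from row \<open>j\<close> the sequences are
positions of \<open>y\<close> particles on a circle of length \<open>k * x + y\<close>, and interlacing says that no particle reaches the
old position of the particle ahead of it. A sign-reversing exchange of particles removes this condition
at the price of a signed sum over permutations, as in the Jacobi-Trudi formula (\<open>card_strict_walks_jacobi_trudi\<close>). What is
counted then are nonnegative integer matrices whose margins are of the form \<open>k * p + q\<close> and \<open>k * \<beta>\<close>. By Gale's
criterion such a matrix contains one with margins \<open>p\<close> and \<open>\<beta>\<close> when \<open>k\<close> is large, so their numbers form the Hilbert
function of a module over a monoid generated in degree one, which is eventually polynomial
(\<open>eventually_poly_card_margin_matrices\<close>, \<open>eventually_poly_card_strict_walks\<close>). This needs \<open>\<beta> i \<le> x\<close> for all \<open>i\<close>; otherwise some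
step is too large for any interlacing, and all coefficients vanish.

A quasi-polynomial that is eventually equal to a polynomial is equal to it everywhere.
\<close>

section \<open>Quasi-polynomials in one integer variable\<close>

text \<open>Taking differences lowers a positive degree by exactly one and multiplies the leading coefficient by a
nonzero rational, so leading terms can be matched one degree at a time.\<close>

lemma poly_antidifference:
  fixes p :: "rat poly"
  shows "\<exists>q. \<forall>t. poly q (t + 1) - poly q t = poly p t"
proof (induction "degree p" arbitrary: p rule: less_induct)
  case less
  define d where "d = degree p"
  \<comment> \<open>The difference of \<open>t ^ (d + 1)\<close>: degree \<open>d\<close>, leading coefficient \<open>d + 1\<close>.\<close>
  define r :: "rat poly" where "r = [:1, 1:] ^ Suc d - monom 1 (Suc d)"
  have lead: "coeff ([:1, 1:] ^ m :: rat poly) m = 1" for m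
    using coeff_linear_power[of "1::rat" m] by simp
  have sub: "coeff ([:1, 1:] ^ Suc m :: rat poly) m = of_nat (Suc m)" for m
  proof (induction m)
    case (Suc m)
    have "coeff ([:1, 1:] ^ Suc (Suc m) :: rat poly) (Suc m)
        = coeff ([:1, 1:] ^ Suc m) (Suc m) + coeff ([:1, 1:] ^ Suc m) m"
      by (subst power_Suc) (simp del: power_Suc)
    then show ?case using Suc lead[of "Suc m"] by simp
  qed simp
  have deg: "degree ([:1, 1:] ^ m :: rat poly) \<le> m" for m
    using degree_power_le[of "[:1, 1:] :: rat poly" m] by simp
  have r_hi: "coeff r m = 0" if "m > d" for m
  proof (cases "m = Suc d")
    case True then show ?thesis using lead[of "Suc d"] by (simp add: r_def del: power_Suc)
  next
    case False
    then have "m > Suc d" using that by simp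
    then have "coeff ([:1, 1:] ^ Suc d :: rat poly) m = 0"
      using deg[of "Suc d"] by (intro coeff_eq_0) linarith
    then show ?thesis using False by (simp add: r_def del: power_Suc)
  qed
  have r_d: "coeff r d = of_nat (Suc d)"
    using sub[of d] by (simp add: r_def del: power_Suc)
  have r_eval: "poly r t = (t + 1) ^ Suc d - t ^ Suc d" for t
    by (simp add: r_def poly_monom add.commute del: power_Suc)
  define c where "c = lead_coeff p / of_nat (Suc d)"
  have step: "poly (smult c (monom 1 (Suc d))) (t + 1) - poly (smult c (monom 1 (Suc d))) t
      = poly (smult c r) t" for t
    by (simp add: r_eval poly_monom algebra_simps del: power_Suc)
  define p' where "p' = p - smult c r"
  have p'_hi: "coeff p' m = 0" if "m \<ge> d" for m
    using that r_hi[of m] r_d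
    by (cases "m = d") (simp_all add: p'_def c_def d_def coeff_eq_0 del: of_nat_Suc)
  have "\<exists>q. \<forall>t. poly q (t + 1) - poly q t = poly p' t"
  proof (cases "d = 0")
    case True
    then have "p' = 0" using p'_hi by (simp add: poly_eq_iff)
    then show ?thesis by (intro exI[of _ 0]) simp
  next
    case False
    have "degree p' \<le> d - 1" by (rule degree_le) (use p'_hi False in auto)
    then have "degree p' < degree p" using False d_def by linarith
    then show ?thesis by (rule less)
  qed
  then obtain q where q: "\<And>t. poly q (t + 1) - poly q t = poly p' t" by blast
  have "poly (q + smult c (monom 1 (Suc d))) (t + 1) - poly (q + smult c (monom 1 (Suc d))) t
      = poly p t" for t
  proof -
    have "poly (q + smult c (monom 1 (Suc d))) (t + 1) - poly (q + smult c (monom 1 (Suc d))) t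
      = poly p' t + poly (smult c r) t"
      using q[of t] step[of t] by (simp only: poly_add)
    also have "\<dots> = poly p t" by (simp add: p'_def)
    finally show ?thesis .
  qed
  then show ?case by blast
qed

text \<open>The argument ranges over all integers, not only the positive ones: the values at the two ends of a
summation interval are needed wherever these ends lie.\<close>

definition quasi_poly :: "(int \<Rightarrow> rat) \<Rightarrow> bool" where
  "quasi_poly g \<longleftrightarrow> (\<exists>M > 0. \<exists>p :: int \<Rightarrow> rat poly. \<forall>t. g t = poly (p (t mod M)) (of_int t))"

lemma quasi_poly_binary:
  assumes "quasi_poly f" "quasi_poly g"
    and op: "\<And>p q :: rat poly. \<exists>r. \<forall>t. poly r t = h (poly p t) (poly q t)"
  shows "quasi_poly (\<lambda>t. h (f t) (g t))"
proof -
  obtain M p where M: "M > 0" "\<And>t. f t = poly (p (t mod M)) (of_int t)"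
    using assms(1) unfolding quasi_poly_def by blast
  obtain N q where N: "N > 0" "\<And>t. g t = poly (q (t mod N)) (of_int t)"
    using assms(2) unfolding quasi_poly_def by blast
  obtain r where r: "\<And>p q t. poly (r p q) t = h (poly p t) (poly q t)"
    using op by metis
  have "t mod (M * N) mod M = t mod M" "t mod (M * N) mod N = t mod N" for t
    by (simp_all add: mod_mod_cancel)
  then have "\<forall>t. h (f t) (g t) = poly (r (p (t mod (M * N) mod M)) (q (t mod (M * N) mod N))) (of_int t)"
    by (simp add: M N r)
  then show ?thesis using M(1) N(1)
    unfolding quasi_poly_def by (intro exI[of _ "M * N"] conjI exI[of _ "\<lambda>s. r (p (s mod M)) (q (s mod N))"]) auto
qed

lemma quasi_poly_add: "quasi_poly f \<Longrightarrow> quasi_poly g \<Longrightarrow> quasi_poly (\<lambda>t. f t + g t)"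
  by (rule quasi_poly_binary) (auto intro: exI[of _ "_ + _"])

lemma quasi_poly_mult: "quasi_poly f \<Longrightarrow> quasi_poly g \<Longrightarrow> quasi_poly (\<lambda>t. f t * g t)"
  by (rule quasi_poly_binary) (auto intro: exI[of _ "_ * _"])

lemma quasi_poly_poly: "quasi_poly (\<lambda>t. poly p (of_int t))"
  unfolding quasi_poly_def by (intro exI[of _ 1]) auto

lemma quasi_poly_const: "quasi_poly (\<lambda>t. c)"
  using quasi_poly_poly[of "[:c:]"] by simp

lemma quasi_poly_of_int: "quasi_poly of_int"
  using quasi_poly_poly[of "[:0, 1:]"] by simp

lemma quasi_poly_of_bool_mod: "M > 0 \<Longrightarrow> quasi_poly (\<lambda>t. of_bool (t mod M = r))"
  unfolding quasi_poly_def
  by (intro exI[of _ M] conjI exI[of _ "\<lambda>s. if s = r then 1 else 0"]) auto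

lemma quasi_poly_sum:
  "(\<And>i. i \<in> I \<Longrightarrow> quasi_poly (f i)) \<Longrightarrow> quasi_poly (\<lambda>t. \<Sum>i\<in>I. f i t)"
  by (induction I rule: infinite_finite_induct) (auto intro: quasi_poly_add quasi_poly_const)

lemma quasi_poly_expand:
  assumes "quasi_poly g"
  obtains M p where "M > 0"
    "\<And>t. g t = (\<Sum>r\<in>{0..<M}. of_bool (t mod M = r) * poly (p r) (of_int t))"
proof -
  obtain M p where M: "M > 0" "\<And>t. g t = poly (p (t mod M)) (of_int t)"
    using assms unfolding quasi_poly_def by blast
  have "g t = (\<Sum>r\<in>{0..<M}. of_bool (t mod M = r) * poly (p r) (of_int t))" for t
  proof -
    have "(\<Sum>r\<in>{0..<M}. of_bool (t mod M = r) * poly (p r) (of_int t))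
        = (\<Sum>r\<in>{0..<M}. if t mod M = r then poly (p r) (of_int t) else (0::rat))"
      by (intro sum.cong) auto
    then show ?thesis using M by (simp add: sum.delta')
  qed
  with M(1) show ?thesis by (rule that)
qed

text \<open>On one residue class \<open>r\<close> modulo \<open>M\<close> the function is a polynomial in the quotient \<open>(t - r) div M\<close>.
This quotient grows by one exactly when \<open>t\<close> enters the class, so a polynomial antidifference in the
quotient is an antidifference of the part supported on the class.\<close>

lemma quasi_poly_antidifference:
  assumes "quasi_poly g"
  obtains S where "quasi_poly S" "\<And>t. S t - S (t - 1) = g t"
proof -
  obtain M p where M: "M > 0"
    and g: "\<And>t. g t = (\<Sum>r\<in>{0..<M}. of_bool (t mod M = r) * poly (p r) (of_int t))"
    using quasi_poly_expand[OF assms] by blast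
  have "\<exists>q. \<forall>s. poly q (s + 1) - poly q s = poly (pcompose (p r) [:of_int (M + r), of_int M:]) s" for r
    by (rule poly_antidifference)
  then obtain q where q: "\<And>r s. poly (q r) (s + 1) - poly (q r) s
      = poly (pcompose (p r) [:of_int (M + r), of_int M:]) s" by metis
  define S where "S t = (\<Sum>r\<in>{0..<M}. poly (q r) (of_int ((t - r) div M)))" for t
  have qp: "quasi_poly (\<lambda>t. poly (q r) (of_int ((t - r) div M)))" for r
  proof -
    have "poly (q r) (of_int ((t - r) div M)) =
        poly (pcompose (q r) [:- of_int (r + (t mod M - r) mod M) / of_int M, 1 / of_int M:]) (of_int t)" for t
    proof -
      have "(t mod M - r) mod M = (t - r) mod M" by (simp add: mod_diff_left_eq)
      moreover have "t - r = M * ((t - r) div M) + (t - r) mod M" by simp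
      ultimately have "of_int (t - r) = of_int M * of_int ((t - r) div M) + (of_int ((t mod M - r) mod M) :: rat)"
        by (metis of_int_add of_int_mult)
      then have "of_int ((t - r) div M) =
          - of_int (r + (t mod M - r) mod M) / of_int M + of_int t * (1 / of_int M :: rat)"
        using M by (simp add: field_simps)
      then show ?thesis by (simp add: poly_pcompose)
    qed
    then show ?thesis unfolding quasi_poly_def using M
      by (intro exI[of _ M] conjI
        exI[of _ "\<lambda>s. pcompose (q r) [:- of_int (r + (s - r) mod M) / of_int M, 1 / of_int M:]"]) auto
  qed
  have "S t - S (t - 1) = g t" for t
  proof -
    have "poly (q r) (of_int ((t - r) div M)) - poly (q r) (of_int ((t - 1 - r) div M))
        = of_bool (t mod M = r) * poly (p r) (of_int t)" if r: "r \<in> {0..<M}" for r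
    proof (cases "t mod M = r")
      case True
      define s where "s = t div M"
      have t: "t = M * s + r" using True by (metis mult_div_mod_eq s_def)
      have d1: "(t - r) div M = s" using M by (simp add: t)
      have d2: "(t - 1 - r) div M = s - 1"
        by (rule int_div_pos_eq[of _ _ _ "M - 1"]) (use M in \<open>auto simp: t algebra_simps\<close>)
      have "of_int t = of_int (M + r) + of_int (s - 1) * (of_int M :: rat)"
        unfolding t by (simp add: algebra_simps)
      moreover have "of_int s = of_int (s - 1) + (1::rat)" by simp
      ultimately show ?thesis unfolding d1 d2 using q[of r "of_int (s - 1)"] True
        by (simp only: poly_pcompose poly_pCons poly_0 mult_zero_right add_0_right of_bool_eq simp_thms mult_1_left)
    next
      case False
      then have "(t - r) mod M \<noteq> 0"
        using r by (metis atLeastLessThan_iff mod_pos_pos_trivial mod_eq_dvd_iff dvd_eq_mod_eq_0)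
      then have pos: "(t - r) mod M > 0"
        using M by (simp add: order_less_le)
      have dm: "t - r = M * ((t - r) div M) + (t - r) mod M" by simp
      have "(t - 1 - r) div M = (t - r) div M"
        by (rule int_div_pos_eq[of _ _ _ "(t - r) mod M - 1"])
          (use M pos dm Euclidean_Rings.pos_mod_bound[of M "t - r"] in linarith)+
      then show ?thesis using False by simp
    qed
    then show ?thesis by (simp add: S_def g flip: sum_subtractf)
  qed
  moreover have "quasi_poly S" unfolding S_def by (intro quasi_poly_sum qp)
  ultimately show ?thesis using that by blast
qed

text \<open>Moving the values to the multiples of \<open>c\<close> turns a sum over the \<open>z\<close> with \<open>l \<le> c * z \<le> u\<close> into a sum over
the full interval \<open>{l..u}\<close>, so that no rounded quotients \<open>l / c\<close>, \<open>u / c\<close> occur.\<close>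

lemma quasi_poly_spread:
  assumes "quasi_poly g" "c > 0"
  shows "quasi_poly (\<lambda>t. if c dvd t then g (t div c) else 0)"
proof -
  obtain M p where M: "M > 0" "\<And>t. g t = poly (p (t mod M)) (of_int t)"
    using assms unfolding quasi_poly_def by blast
  have "(if c dvd t then g (t div c) else 0) =
      poly (if c dvd t mod (c * M) then pcompose (p (t mod (c * M) div c)) [:0, 1 / of_int c:] else 0) (of_int t)" for t
  proof (cases "c dvd t")
    case True
    then obtain s where t: "t = c * s" by blast
    have "t mod (c * M) = c * (s mod M)" by (simp add: t)
    then show ?thesis using assms(2) M by (simp add: t poly_pcompose)
  next
    case False
    then have "\<not> c dvd t mod (c * M)" by (simp add: dvd_mod_iff)
    with False show ?thesis by simp
  qed
  then show ?thesis unfolding quasi_poly_def using M(1) assms(2)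
    by (intro exI[of _ "c * M"] conjI
      exI[of _ "\<lambda>s. if c dvd s then pcompose (p (s div c)) [:0, 1 / of_int c:] else 0"]) auto
qed

text \<open>The formula is claimed only for \<open>l \<le> u\<close>. This is a homogeneous condition on \<open>(l, u)\<close>, which is why
elimination of a variable stays inside the class of functions defined below. If \<open>l \<le> u\<close> but no multiple
of \<open>c\<close> lies between them, both sides vanish.\<close>

lemma quasi_poly_interval_sum:
  assumes "quasi_poly g" "c > 0"
  obtains S where "quasi_poly S"
    "\<And>l u. l \<le> u \<Longrightarrow> (\<Sum>z | l \<le> c * z \<and> c * z \<le> u. g z) = S u - S (l - 1)"
proof -
  obtain S where S: "quasi_poly S" "\<And>t. S t - S (t - 1) = (if c dvd t then g (t div c) else 0)"
    using quasi_poly_antidifference[OF quasi_poly_spread[OF assms]] by blast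
  have tele: "(\<Sum>t\<in>{l..u}. if c dvd t then g (t div c) else 0) = S u - S (l - 1)" if "l \<le> u" for l u
    using that
  proof (induction u rule: int_ge_induct)
    case base
    have "{l..l} = {l}" by simp
    then show ?case using S(2)[of l] by simp
  next
    case (step u)
    have "{l..u + 1} = insert (u + 1) {l..u}" using step by auto
    then show ?case using step S(2)[of "u + 1"] by simp
  qed
  have "(\<Sum>z | l \<le> c * z \<and> c * z \<le> u. g z) = S u - S (l - 1)" if "l \<le> u" for l u
  proof -
    have "(\<Sum>z | l \<le> c * z \<and> c * z \<le> u. g z) = (\<Sum>t | t \<in> {l..u} \<and> c dvd t. g (t div c))"
      by (rule sum.reindex_bij_witness[of _ "\<lambda>t. t div c" "\<lambda>z. c * z"]) (use assms(2) in auto)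
    also have "\<dots> = (\<Sum>t\<in>{l..u}. if c dvd t then g (t div c) else 0)"
      by (simp flip: sum.inter_filter)
    finally show ?thesis using tele that by simp
  qed
  with S(1) show ?thesis using that by blast
qed

section \<open>Lattice points in dilated rational polytopes\<close>

text \<open>Only linear forms without constant term: on a ray through the origin their signs are constant from
the first positive point on, and this is what makes the final counts quasi-polynomial for every
\<open>k \<ge> 1\<close> rather than for large \<open>k\<close>.\<close>

definition int_forms :: "nat \<Rightarrow> ((nat \<Rightarrow> int) \<Rightarrow> int) set" where
  "int_forms d = {L. \<exists>a. L = (\<lambda>w. \<Sum>i<d. a i * w i)}"

lemma int_formsI: "L = (\<lambda>w. \<Sum>i<d. a i * w i) \<Longrightarrow> L \<in> int_forms d"
  by (auto simp: int_forms_def)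

lemma int_forms_zero: "(\<lambda>w. 0) \<in> int_forms d"
  by (rule int_formsI[where a = "\<lambda>_. 0"]) simp

lemma int_forms_add: "L \<in> int_forms d \<Longrightarrow> K \<in> int_forms d \<Longrightarrow> (\<lambda>w. L w + K w) \<in> int_forms d"
proof -
  assume "L \<in> int_forms d" "K \<in> int_forms d"
  then obtain a b where "L = (\<lambda>w. \<Sum>i<d. a i * w i)" "K = (\<lambda>w. \<Sum>i<d. b i * w i)"
    unfolding int_forms_def by blast
  then show ?thesis
    by (intro int_formsI[where a = "\<lambda>i. a i + b i"]) (simp add: sum.distrib distrib_right)
qed

lemma int_forms_scale: "L \<in> int_forms d \<Longrightarrow> (\<lambda>w. c * L w) \<in> int_forms d"
proof -
  assume "L \<in> int_forms d"
  then obtain a where "L = (\<lambda>w. \<Sum>i<d. a i * w i)" unfolding int_forms_def by blast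
  then show ?thesis
    by (intro int_formsI[where a = "\<lambda>i. c * a i"]) (simp add: sum_distrib_left mult.assoc)
qed

lemma int_forms_uminus: "L \<in> int_forms d \<Longrightarrow> (\<lambda>w. - L w) \<in> int_forms d"
  using int_forms_scale[of L d "-1"] by simp

lemma int_forms_diff: "L \<in> int_forms d \<Longrightarrow> K \<in> int_forms d \<Longrightarrow> (\<lambda>w. L w - K w) \<in> int_forms d"
  using int_forms_add[OF _ int_forms_uminus, of L d K] by simp

lemma int_forms_proj: "i < d \<Longrightarrow> (\<lambda>w. c * w i) \<in> int_forms d"
  by (rule int_formsI[where a = "\<lambda>j. if j = i then c else 0"])
    (simp add: if_distrib[of "\<lambda>c. c * _"] cong: if_cong)

lemma int_forms_sum:
  "(\<And>i. i \<in> I \<Longrightarrow> f i \<in> int_forms d) \<Longrightarrow> (\<lambda>w. \<Sum>i\<in>I. f i w) \<in> int_forms d"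
  by (induction I rule: infinite_finite_induct) (auto intro: int_forms_add int_forms_zero)

lemma int_forms_Suc_split:
  assumes "L \<in> int_forms (Suc d)"
  obtains K a where "K \<in> int_forms d" "\<And>w z. L (w(d := z)) = K w + a * z"
proof -
  obtain a where "L = (\<lambda>w. \<Sum>i<Suc d. a i * w i)"
    using assms unfolding int_forms_def by blast
  then have "L (w(d := z)) = (\<Sum>i<d. a i * w i) + a d * z" for w z by simp
  then show ?thesis using that[of "\<lambda>w. \<Sum>i<d. a i * w i" "a d"] by (auto simp: int_forms_def)
qed

text \<open>Functions that are quasi-polynomial on each cone of a finite arrangement of rational half-spaces
through the origin, presented by generators so that closure properties are proved by induction.\<close>

inductive_set conic_quasi :: "nat \<Rightarrow> ((nat \<Rightarrow> int) \<Rightarrow> rat) set" for d where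
  const: "(\<lambda>w. c) \<in> conic_quasi d"
| form: "L \<in> int_forms d \<Longrightarrow> (\<lambda>w. of_int (L w)) \<in> conic_quasi d"
| residue: "L \<in> int_forms d \<Longrightarrow> M > 0 \<Longrightarrow> (\<lambda>w. of_bool (L w mod M = r)) \<in> conic_quasi d"
| halfspace: "L \<in> int_forms d \<Longrightarrow> (\<lambda>w. of_bool (0 \<le> L w)) \<in> conic_quasi d"
| add: "F \<in> conic_quasi d \<Longrightarrow> G \<in> conic_quasi d \<Longrightarrow> (\<lambda>w. F w + G w) \<in> conic_quasi d"
| mult: "F \<in> conic_quasi d \<Longrightarrow> G \<in> conic_quasi d \<Longrightarrow> (\<lambda>w. F w * G w) \<in> conic_quasi d"

lemma conic_quasi_diff:
  "F \<in> conic_quasi d \<Longrightarrow> G \<in> conic_quasi d \<Longrightarrow> (\<lambda>w. F w - G w) \<in> conic_quasi d"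
  using conic_quasi.add[OF _ conic_quasi.mult[OF conic_quasi.const[of "-1"]], of F d G] by simp

lemma conic_quasi_sum:
  "(\<And>i. i \<in> I \<Longrightarrow> F i \<in> conic_quasi d) \<Longrightarrow> (\<lambda>w. \<Sum>i\<in>I. F i w) \<in> conic_quasi d"
  by (induction I rule: infinite_finite_induct) (auto intro: conic_quasi.add conic_quasi.const)

lemma conic_quasi_prod:
  "(\<And>i. i \<in> I \<Longrightarrow> F i \<in> conic_quasi d) \<Longrightarrow> (\<lambda>w. \<Prod>i\<in>I. F i w) \<in> conic_quasi d"
  by (induction I rule: infinite_finite_induct) (auto intro: conic_quasi.mult conic_quasi.const)

lemma conic_quasi_poly_of_form:
  assumes "L \<in> int_forms d"
  shows "(\<lambda>w. poly p (of_int (L w))) \<in> conic_quasi d"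
  by (induction p) (auto intro!: conic_quasi.intros assms)

lemma conic_quasi_of_form:
  assumes "quasi_poly S" "L \<in> int_forms d"
  shows "(\<lambda>w. S (L w)) \<in> conic_quasi d"
proof -
  obtain M p where M: "M > 0"
    and S: "\<And>t. S t = (\<Sum>r\<in>{0..<M}. of_bool (t mod M = r) * poly (p r) (of_int t))"
    using quasi_poly_expand[OF assms(1)] by blast
  show ?thesis unfolding S
    by (intro conic_quasi_sum conic_quasi.mult conic_quasi.residue conic_quasi_poly_of_form assms(2) M)
qed

lemma conic_quasi_of_form_pred:
  assumes "quasi_poly S" "L \<in> int_forms d"
  shows "(\<lambda>w. S (L w - 1)) \<in> conic_quasi d"
proof (rule conic_quasi_of_form[OF _ assms(2)])
  obtain M p where M: "M > 0" "\<And>t. S t = poly (p (t mod M)) (of_int t)"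
    using assms(1) unfolding quasi_poly_def by blast
  have "S (t - 1) = poly (pcompose (p ((t mod M - 1) mod M)) [:-1, 1:]) (of_int t)" for t
    by (simp add: M poly_pcompose mod_diff_left_eq)
  then show "quasi_poly (\<lambda>t. S (t - 1))" unfolding quasi_poly_def using M(1)
    by (intro exI[of _ M] conjI exI[of _ "\<lambda>s. pcompose (p ((s - 1) mod M)) [:-1, 1:]"]) auto
qed

text \<open>A normal form with respect to one further variable \<open>z\<close>: on each piece, \<open>z\<close> is confined to a single
interval \<open>l w \<le> c * z \<le> u w\<close>. One common multiplier \<open>c\<close> serves both ends.\<close>

inductive_set fibred_quasi :: "nat \<Rightarrow> ((nat \<Rightarrow> int) \<Rightarrow> int \<Rightarrow> rat) set" for d where
  interval: "A \<in> conic_quasi d \<Longrightarrow> quasi_poly g \<Longrightarrow> c > 0 \<Longrightarrow> l \<in> int_forms d \<Longrightarrow> u \<in> int_forms d \<Longrightarrow>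
    (\<lambda>w z. A w * g z * of_bool (l w \<le> c * z \<and> c * z \<le> u w)) \<in> fibred_quasi d"
| plus: "H \<in> fibred_quasi d \<Longrightarrow> K \<in> fibred_quasi d \<Longrightarrow> (\<lambda>w z. H w z + K w z) \<in> fibred_quasi d"

lemma fibred_quasi_sum:
  assumes "finite I" "I \<noteq> {}" "\<And>i. i \<in> I \<Longrightarrow> H i \<in> fibred_quasi d"
  shows "(\<lambda>w z. \<Sum>i\<in>I. H i w z) \<in> fibred_quasi d"
  using assms by (induction I rule: finite_ne_induct) (auto intro: fibred_quasi.plus)

text \<open>After scaling to a common multiplier of \<open>z\<close>, the new half-space competes with one end of the interval.
Which of the two bounds is the sharper one is decided by the sign of a form in \<open>w\<close> alone, and the piece is
cut in two accordingly.\<close>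

lemma fibred_quasi_halfspace:
  assumes "A \<in> conic_quasi d" "quasi_poly g" "c > 0" "l \<in> int_forms d" "u \<in> int_forms d" "K \<in> int_forms d"
  shows "(\<lambda>w z. of_bool (0 \<le> K w + a * z) * (A w * g z * of_bool (l w \<le> c * z \<and> c * z \<le> u w)))
    \<in> fibred_quasi d"
proof -
  consider "a = 0" | "a > 0" | "a < 0" by linarith
  then show ?thesis
  proof cases
    case 1
    have "(\<lambda>w z. of_bool (0 \<le> K w) * A w * g z * of_bool (l w \<le> c * z \<and> c * z \<le> u w)) \<in> fibred_quasi d"
      by (intro fibred_quasi.interval conic_quasi.mult conic_quasi.halfspace assms)
    then show ?thesis using 1 by (simp add: mult.assoc)
  next
    case 2
    let ?K = "\<lambda>w. - c * K w" and ?l = "\<lambda>w. a * l w" and ?u = "\<lambda>w. a * u w"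
    have "(\<lambda>w z. of_bool (0 \<le> ?K w - ?l w) * A w * g z * of_bool (?K w \<le> (a * c) * z \<and> (a * c) * z \<le> ?u w)
      + (1 - of_bool (0 \<le> ?K w - ?l w)) * A w * g z * of_bool (?l w \<le> (a * c) * z \<and> (a * c) * z \<le> ?u w))
      \<in> fibred_quasi d" (is "?H \<in> _")
      using 2 assms(3) by (intro fibred_quasi.plus fibred_quasi.interval conic_quasi.mult
        conic_quasi.halfspace conic_quasi_diff conic_quasi.const int_forms_diff int_forms_scale assms) auto
    also have "?H = (\<lambda>w z. of_bool (0 \<le> K w + a * z) * (A w * g z * of_bool (l w \<le> c * z \<and> c * z \<le> u w)))"
    proof (intro ext)
      fix w z
      have "0 \<le> K w + a * z \<longleftrightarrow> 0 \<le> c * (K w + a * z)" using assms(3) by (simp add: zero_le_mult_iff)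
      then have K: "0 \<le> K w + a * z \<longleftrightarrow> ?K w \<le> (a * c) * z" by (simp add: algebra_simps) arith
      have l: "l w \<le> c * z \<longleftrightarrow> ?l w \<le> (a * c) * z" using 2 by (simp add: mult.assoc)
      have u: "c * z \<le> u w \<longleftrightarrow> (a * c) * z \<le> ?u w" using 2 by (simp add: mult.assoc)
      show "?H w z = of_bool (0 \<le> K w + a * z) * (A w * g z * of_bool (l w \<le> c * z \<and> c * z \<le> u w))"
        unfolding K l u by (auto simp: of_bool_def)
    qed
    finally show ?thesis .
  next
    case 3
    let ?K = "\<lambda>w. c * K w" and ?l = "\<lambda>w. (- a) * l w" and ?u = "\<lambda>w. (- a) * u w"
    have "(\<lambda>w z. of_bool (0 \<le> ?u w - ?K w) * A w * g z * of_bool (?l w \<le> (- a * c) * z \<and> (- a * c) * z \<le> ?K w)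
      + (1 - of_bool (0 \<le> ?u w - ?K w)) * A w * g z * of_bool (?l w \<le> (- a * c) * z \<and> (- a * c) * z \<le> ?u w))
      \<in> fibred_quasi d" (is "?H \<in> _")
      using 3 assms(3) by (intro fibred_quasi.plus fibred_quasi.interval conic_quasi.mult
        conic_quasi.halfspace conic_quasi_diff conic_quasi.const int_forms_diff int_forms_scale assms)
        (auto simp: mult_neg_pos)
    also have "?H = (\<lambda>w z. of_bool (0 \<le> K w + a * z) * (A w * g z * of_bool (l w \<le> c * z \<and> c * z \<le> u w)))"
    proof (intro ext)
      fix w z
      have "0 \<le> K w + a * z \<longleftrightarrow> 0 \<le> c * (K w + a * z)" using assms(3) by (simp add: zero_le_mult_iff)
      then have K: "0 \<le> K w + a * z \<longleftrightarrow> (- a * c) * z \<le> ?K w" by (simp add: algebra_simps) arith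
      have l: "l w \<le> c * z \<longleftrightarrow> ?l w \<le> (- a * c) * z" using 3 by (simp add: mult.assoc)
      have u: "c * z \<le> u w \<longleftrightarrow> (- a * c) * z \<le> ?u w" using 3 by (simp add: mult.assoc)
      show "?H w z = of_bool (0 \<le> K w + a * z) * (A w * g z * of_bool (l w \<le> c * z \<and> c * z \<le> u w))"
        unfolding K l u by (auto simp: of_bool_def)
    qed
    finally show ?thesis .
  qed
qed

text \<open>Once the residue of \<open>z\<close> is fixed, the congruence becomes one on \<open>w\<close>.\<close>

lemma fibred_quasi_residue:
  assumes "A \<in> conic_quasi d" "quasi_poly g" "c > 0" "l \<in> int_forms d" "u \<in> int_forms d" "K \<in> int_forms d"
    and "M > 0"
  shows "(\<lambda>w z. of_bool ((K w + a * z) mod M = r) * (A w * g z * of_bool (l w \<le> c * z \<and> c * z \<le> u w)))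
    \<in> fibred_quasi d"
proof -
  have "(\<lambda>w z. \<Sum>s\<in>{0..<M}. of_bool (K w mod M = (r - a * s) mod M \<and> 0 \<le> r \<and> r < M) * A w
      * (of_bool (z mod M = s) * g z) * of_bool (l w \<le> c * z \<and> c * z \<le> u w)) \<in> fibred_quasi d"
    (is "?H \<in> _")
  proof (rule fibred_quasi_sum)
    fix s assume "s \<in> {0..<M}"
    have "(\<lambda>w. of_bool (K w mod M = (r - a * s) mod M \<and> 0 \<le> r \<and> r < M)) \<in> conic_quasi d"
    proof (cases "0 \<le> r \<and> r < M")
      case True then show ?thesis using conic_quasi.residue[OF assms(6,7)] by simp
    next
      case False
      then have "(\<lambda>w. of_bool (K w mod M = (r - a * s) mod M \<and> 0 \<le> r \<and> r < M)) = (\<lambda>w. 0 :: rat)"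
        by (auto simp: fun_eq_iff)
      then show ?thesis using conic_quasi.const[of 0 d] by simp
    qed
    then show "(\<lambda>w z. of_bool (K w mod M = (r - a * s) mod M \<and> 0 \<le> r \<and> r < M) * A w
      * (of_bool (z mod M = s) * g z) * of_bool (l w \<le> c * z \<and> c * z \<le> u w)) \<in> fibred_quasi d"
      by (intro fibred_quasi.interval conic_quasi.mult quasi_poly_mult quasi_poly_of_bool_mod assms)
  qed (use assms(7) in auto)
  also have "?H = (\<lambda>w z. of_bool ((K w + a * z) mod M = r) * (A w * g z * of_bool (l w \<le> c * z \<and> c * z \<le> u w)))"
  proof (intro ext)
    fix w z
    have eq: "(K w + a * z) mod M = r \<longleftrightarrow> K w mod M = (r - a * (z mod M)) mod M \<and> 0 \<le> r \<and> r < M"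
    proof -
      have "K w mod M = (r - a * (z mod M)) mod M \<longleftrightarrow> M dvd K w - (r - a * (z mod M))"
        by (rule mod_eq_dvd_iff)
      also have "\<dots> \<longleftrightarrow> M dvd (K w + a * z) - r"
      proof -
        have "a * z = M * (a * (z div M)) + a * (z mod M)"
          by (metis distrib_left mult.left_commute mult_div_mod_eq)
        then have "(K w + a * z) - r = (K w - (r - a * (z mod M))) + M * (a * (z div M))"
          by linarith
        then show ?thesis by (metis dvd_add_times_triv_right_iff mult.commute)
      qed
      also have "\<dots> \<longleftrightarrow> (K w + a * z) mod M = r mod M" by (rule mod_eq_dvd_iff[symmetric])
      finally show ?thesis using assms(7) by auto
    qed
    have "?H w z = (\<Sum>s\<in>{0..<M}. if z mod M = s
      then of_bool (K w mod M = (r - a * s) mod M \<and> 0 \<le> r \<and> r < M) * A w * g z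
        * of_bool (l w \<le> c * z \<and> c * z \<le> u w) else 0)"
      by (intro sum.cong) auto
    then show "?H w z = of_bool ((K w + a * z) mod M = r) * (A w * g z * of_bool (l w \<le> c * z \<and> c * z \<le> u w))"
      using assms(7) unfolding eq by (simp add: sum.delta' mult.assoc)
  qed
  finally show ?thesis .
qed

lemma fibred_quasi_form:
  assumes "A \<in> conic_quasi d" "quasi_poly g" "c > 0" "l \<in> int_forms d" "u \<in> int_forms d" "K \<in> int_forms d"
  shows "(\<lambda>w z. of_int (K w + a * z) * (A w * g z * of_bool (l w \<le> c * z \<and> c * z \<le> u w)))
    \<in> fibred_quasi d"
proof -
  have "(\<lambda>w z. (of_int (K w) * A w) * g z * of_bool (l w \<le> c * z \<and> c * z \<le> u w)
     + A w * (of_int a * of_int z * g z) * of_bool (l w \<le> c * z \<and> c * z \<le> u w)) \<in> fibred_quasi d"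
    by (intro fibred_quasi.plus fibred_quasi.interval conic_quasi.mult conic_quasi.form quasi_poly_mult
      quasi_poly_const quasi_poly_of_int assms)
  then show ?thesis by (simp add: algebra_simps)
qed

lemma fibred_quasi_mult:
  assumes "F \<in> conic_quasi (Suc d)" "H \<in> fibred_quasi d"
  shows "(\<lambda>w z. F (w(d := z)) * H w z) \<in> fibred_quasi d"
  using assms
proof (induction arbitrary: H)
  case (const c)
  then show ?case
  proof induction
    case (interval A g e l u)
    have "(\<lambda>w z. (c * A w) * g z * of_bool (l w \<le> e * z \<and> e * z \<le> u w)) \<in> fibred_quasi d"
      by (intro fibred_quasi.interval conic_quasi.mult conic_quasi.const interval)
    then show ?case by (simp only: mult.assoc)
  next
    case (plus H K)
    from fibred_quasi.plus[OF plus.IH] show ?case by (simp only: distrib_left)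
  qed
next
  case (form L)
  obtain K a where K: "K \<in> int_forms d" "\<And>w z. L (w(d := z)) = K w + a * z"
    using int_forms_Suc_split[OF form(1)] by metis
  from form(2) show ?case unfolding K(2)
  proof induction
    case (interval A g e l u) then show ?case by (intro fibred_quasi_form K(1))
  next
    case (plus H K)
    from fibred_quasi.plus[OF plus.IH] show ?case by (simp only: distrib_left)
  qed
next
  case (residue L M r)
  obtain K a where K: "K \<in> int_forms d" "\<And>w z. L (w(d := z)) = K w + a * z"
    using int_forms_Suc_split[OF residue(1)] by metis
  from residue(3) show ?case unfolding K(2)
  proof induction
    case (interval A g e l u) then show ?case by (intro fibred_quasi_residue K(1) residue(2))
  next
    case (plus H K)
    from fibred_quasi.plus[OF plus.IH] show ?case by (simp only: distrib_left)
  qed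
next
  case (halfspace L)
  obtain K a where K: "K \<in> int_forms d" "\<And>w z. L (w(d := z)) = K w + a * z"
    using int_forms_Suc_split[OF halfspace(1)] by metis
  from halfspace(2) show ?case unfolding K(2)
  proof induction
    case (interval A g e l u) then show ?case by (intro fibred_quasi_halfspace K(1))
  next
    case (plus H K)
    from fibred_quasi.plus[OF plus.IH] show ?case by (simp only: distrib_left)
  qed
next
  case (add F G)
  have "(\<lambda>w z. F (w(d := z)) * H w z + G (w(d := z)) * H w z) \<in> fibred_quasi d"
    by (intro fibred_quasi.plus add)
  then show ?case by (simp only: distrib_right)
next
  case (mult F G)
  have "(\<lambda>w z. F (w(d := z)) * (G (w(d := z)) * H w z)) \<in> fibred_quasi d"
    by (intro mult)
  then show ?case by (simp only: mult.assoc)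
qed

text \<open>The sum over all integers \<open>z\<close>, expressed through the finite sets \<open>Z\<close> that contain the support; the
support is finite because every interval is bounded.\<close>

lemma fibred_quasi_total:
  assumes "H \<in> fibred_quasi d"
  shows "\<exists>G \<in> conic_quasi d. \<forall>w. \<exists>Z0. finite Z0 \<and> (\<forall>Z. finite Z \<and> Z0 \<subseteq> Z \<longrightarrow> (\<Sum>z\<in>Z. H w z) = G w)"
  using assms
proof induction
    case (interval A g c l u)
    obtain S where S: "quasi_poly S"
      "\<And>l u. l \<le> u \<Longrightarrow> (\<Sum>z | l \<le> c * z \<and> c * z \<le> u. g z) = S u - S (l - 1)"
      using quasi_poly_interval_sum[OF interval(2,3)] by blast
    define G where "G w = A w * (of_bool (0 \<le> u w - l w) * (S (u w) - S (l w - 1)))" for w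
    have "G \<in> conic_quasi d" unfolding G_def
      by (intro conic_quasi.mult conic_quasi.halfspace conic_quasi_diff conic_quasi_of_form
        conic_quasi_of_form_pred int_forms_diff interval S(1))
    moreover have "\<exists>Z0. finite Z0 \<and> (\<forall>Z. finite Z \<and> Z0 \<subseteq> Z \<longrightarrow>
      (\<Sum>z\<in>Z. A w * g z * of_bool (l w \<le> c * z \<and> c * z \<le> u w)) = G w)" for w
    proof (intro exI conjI allI impI)
      let ?Z0 = "{z. l w \<le> c * z \<and> c * z \<le> u w}"
      have "(*) c ` ?Z0 \<subseteq> {l w..u w}" by auto
      moreover have "inj_on ((*) c) ?Z0" using interval(3) by (auto simp: inj_on_def)
      ultimately show "finite ?Z0" by (meson finite_imageD finite_subset finite_atLeastAtMost_int)
      fix Z assume Z: "finite Z \<and> ?Z0 \<subseteq> Z"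
      have "(\<Sum>z\<in>Z. A w * g z * of_bool (l w \<le> c * z \<and> c * z \<le> u w)) = (\<Sum>z\<in>?Z0. A w * g z)"
        using Z by (intro sum.mono_neutral_cong_right) auto
      also have "\<dots> = A w * (\<Sum>z\<in>?Z0. g z)" by (simp add: sum_distrib_left)
      also have "(\<Sum>z\<in>?Z0. g z) = of_bool (0 \<le> u w - l w) * (S (u w) - S (l w - 1))"
      proof (cases "l w \<le> u w")
        case True then show ?thesis using S(2) by simp
      next
        case False
        then have empty: "?Z0 = {}" by auto
        show ?thesis unfolding empty using False by simp
      qed
      finally show "(\<Sum>z\<in>Z. A w * g z * of_bool (l w \<le> c * z \<and> c * z \<le> u w)) = G w"
        by (simp add: G_def)
    qed
    ultimately show ?case by (intro bexI[of _ G] allI)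
  next
    case (plus H K)
    from plus.IH(1) obtain G1 where G1: "G1 \<in> conic_quasi d"
      "\<forall>w. \<exists>Z0. finite Z0 \<and> (\<forall>Z. finite Z \<and> Z0 \<subseteq> Z \<longrightarrow> (\<Sum>z\<in>Z. H w z) = G1 w)" ..
    from plus.IH(2) obtain G2 where G2: "G2 \<in> conic_quasi d"
      "\<forall>w. \<exists>Z0. finite Z0 \<and> (\<forall>Z. finite Z \<and> Z0 \<subseteq> Z \<longrightarrow> (\<Sum>z\<in>Z. K w z) = G2 w)" ..
    show ?case
    proof (intro bexI[of _ "\<lambda>w. G1 w + G2 w"] allI)
      fix w
      from spec[OF G1(2), of w] obtain Z1 where Z1: "finite Z1"
        "\<forall>Z. finite Z \<and> Z1 \<subseteq> Z \<longrightarrow> (\<Sum>z\<in>Z. H w z) = G1 w" by (elim exE conjE)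
      from spec[OF G2(2), of w] obtain Z2 where Z2: "finite Z2"
        "\<forall>Z. finite Z \<and> Z2 \<subseteq> Z \<longrightarrow> (\<Sum>z\<in>Z. K w z) = G2 w" by (elim exE conjE)
      show "\<exists>Z0. finite Z0 \<and> (\<forall>Z. finite Z \<and> Z0 \<subseteq> Z \<longrightarrow> (\<Sum>z\<in>Z. H w z + K w z) = G1 w + G2 w)"
        using Z1 Z2 by (intro exI[of _ "Z1 \<union> Z2"]) (simp add: sum.distrib)
    qed (intro conic_quasi.add G1 G2)
qed

text \<open>Elimination of one variable: bringing the summand into the normal form, starting from the interval
of summation, reduces the claim to sums of one-variable quasi-polynomials over intervals.\<close>

lemma conic_quasi_sum_last:
  assumes "F \<in> conic_quasi (Suc d)" "l \<in> int_forms d" "u \<in> int_forms d"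
  shows "(\<lambda>w. \<Sum>z\<in>{l w..u w}. F (w(d := z))) \<in> conic_quasi d"
proof -
  have "(\<lambda>w z. 1 * 1 * of_bool (l w \<le> 1 * z \<and> 1 * z \<le> u w)) \<in> fibred_quasi d"
    by (intro fibred_quasi.interval conic_quasi.const quasi_poly_const assms) auto
  from fibred_quasi_mult[OF assms(1) this]
  have "(\<lambda>w z. F (w(d := z)) * of_bool (l w \<le> z \<and> z \<le> u w)) \<in> fibred_quasi d"
    by (simp only: mult_1_left)
  from fibred_quasi_total[OF this] obtain G where G: "G \<in> conic_quasi d"
    "\<forall>w. \<exists>Z0. finite Z0 \<and> (\<forall>Z. finite Z \<and> Z0 \<subseteq> Z \<longrightarrow>
      (\<Sum>z\<in>Z. F (w(d := z)) * of_bool (l w \<le> z \<and> z \<le> u w)) = G w)" ..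
  have "(\<lambda>w. \<Sum>z\<in>{l w..u w}. F (w(d := z))) = G"
  proof (rule ext)
    fix w
    from spec[OF G(2), of w] obtain Z0 where Z0: "finite Z0" "\<forall>Z. finite Z \<and> Z0 \<subseteq> Z \<longrightarrow>
      (\<Sum>z\<in>Z. F (w(d := z)) * of_bool (l w \<le> z \<and> z \<le> u w)) = G w" by (elim exE conjE)
    have "G w = (\<Sum>z\<in>Z0 \<union> {l w..u w}. F (w(d := z)) * of_bool (l w \<le> z \<and> z \<le> u w))"
      using Z0 by simp
    also have "\<dots> = (\<Sum>z\<in>{l w..u w}. F (w(d := z)))"
      using Z0 by (intro sum.mono_neutral_cong_right) auto
    finally show "(\<Sum>z\<in>{l w..u w}. F (w(d := z))) = G w" by simp
  qed
  then show ?thesis using G(1) by simp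
qed

lemma conic_quasi_ray:
  assumes "F \<in> conic_quasi (Suc 0)"
  obtains g where "quasi_poly g" "\<And>k. k > 0 \<Longrightarrow> F ((\<lambda>_. 0)(0 := k)) = g k"
proof -
  define e :: "int \<Rightarrow> nat \<Rightarrow> int" where "e k = (\<lambda>_. 0)(0 := k)" for k
  have ray: "\<exists>a. \<forall>k. L (e k) = a * k" if "L \<in> int_forms (Suc 0)" for L
    using that by (auto simp: int_forms_def e_def)
  have "\<exists>g. quasi_poly g \<and> (\<forall>k > 0. F (e k) = g k)"
    using assms
  proof induction
    case (const c) then show ?case using quasi_poly_const by blast
  next
    case (form L)
    obtain a where "\<And>k. L (e k) = a * k" using ray[OF form] by blast
    then show ?case using quasi_poly_mult[OF quasi_poly_const quasi_poly_of_int, of "of_int a"]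
      by (intro exI[of _ "\<lambda>k. of_int a * of_int k"]) auto
  next
    case (residue L M r)
    obtain a where a: "\<And>k. L (e k) = a * k" using ray[OF residue(1)] by blast
    have "quasi_poly (\<lambda>k. of_bool ((a * k) mod M = r))"
      unfolding quasi_poly_def using residue(2)
      by (intro exI[of _ M] conjI exI[of _ "\<lambda>s. if (a * s) mod M = r then 1 else 0"])
        (auto simp: mod_mult_right_eq)
    then show ?case unfolding a by blast
  next
    case (halfspace L)
    obtain a where "\<And>k. L (e k) = a * k" using ray[OF halfspace] by blast
    then have "\<forall>k>0. of_bool (0 \<le> L (e k)) = (of_bool (0 \<le> a) :: rat)"
      by (auto simp: zero_le_mult_iff)
    then show ?case using quasi_poly_const by blast
  next
    case (add F G)
    then obtain f g where fg: "quasi_poly f" "quasi_poly g"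
      "\<And>k. k > 0 \<Longrightarrow> F (e k) = f k" "\<And>k. k > 0 \<Longrightarrow> G (e k) = g k" by blast
    show ?case by (rule exI[of _ "\<lambda>k. f k + g k"]) (simp add: fg quasi_poly_add)
  next
    case (mult F G)
    then obtain f g where fg: "quasi_poly f" "quasi_poly g"
      "\<And>k. k > 0 \<Longrightarrow> F (e k) = f k" "\<And>k. k > 0 \<Longrightarrow> G (e k) = g k" by blast
    show ?case by (rule exI[of _ "\<lambda>k. f k * g k"]) (simp add: fg quasi_poly_mult)
  qed
  then show ?thesis using that unfolding e_def by blast
qed

text \<open>The points of a dilated box, with the dilation factor \<open>k\<close> stored as coordinate \<open>0\<close>, so that inequalities
which are affine with \<open>k\<close>-proportional constants become homogeneous. Coordinates after \<open>d\<close> are fixed to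
keep the set finite.\<close>

definition ray_box :: "(nat \<Rightarrow> int) \<Rightarrow> (nat \<Rightarrow> int) \<Rightarrow> nat \<Rightarrow> int \<Rightarrow> (nat \<Rightarrow> int) set" where
  "ray_box lo hi d k =
     {w. w 0 = k \<and> (\<forall>v\<in>{1..d}. lo v * k \<le> w v \<and> w v \<le> hi v * k) \<and> (\<forall>v > d. w v = 0)}"

lemma ray_box_0: "ray_box lo hi 0 k = {(\<lambda>_. 0)(0 := k)}"
  by (auto simp: ray_box_def fun_eq_iff)

lemma ray_box_Suc:
  "bij_betw (\<lambda>(w, z). w(Suc d := z)) (ray_box lo hi d k \<times> {lo (Suc d) * k..hi (Suc d) * k})
     (ray_box lo hi (Suc d) k)"
proof (rule bij_betw_byWitness[where f' = "\<lambda>w. (w(Suc d := 0), w (Suc d))"])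
  show "\<forall>p \<in> ray_box lo hi d k \<times> {lo (Suc d) * k..hi (Suc d) * k}.
      (((case p of (w, z) \<Rightarrow> w(Suc d := z))(Suc d := 0)), (case p of (w, z) \<Rightarrow> w(Suc d := z)) (Suc d)) = p"
    by (auto simp: ray_box_def fun_eq_iff)
  show "\<forall>w \<in> ray_box lo hi (Suc d) k. (case (w(Suc d := 0), w (Suc d)) of (w, z) \<Rightarrow> w(Suc d := z)) = w"
    by (auto simp: fun_eq_iff)
  show "(\<lambda>(w, z). w(Suc d := z)) ` (ray_box lo hi d k \<times> {lo (Suc d) * k..hi (Suc d) * k})
      \<subseteq> ray_box lo hi (Suc d) k"
  proof (clarify)
    fix w z assume w: "w \<in> ray_box lo hi d k" and z: "z \<in> {lo (Suc d) * k..hi (Suc d) * k}"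
    have "lo v * k \<le> (w(Suc d := z)) v \<and> (w(Suc d := z)) v \<le> hi v * k" if "v \<in> {1..Suc d}" for v
      using w z that by (cases "v = Suc d") (auto simp: ray_box_def)
    then show "w(Suc d := z) \<in> ray_box lo hi (Suc d) k"
      using w by (auto simp: ray_box_def)
  qed
  show "(\<lambda>w. (w(Suc d := 0), w (Suc d))) ` ray_box lo hi (Suc d) k
      \<subseteq> ray_box lo hi d k \<times> {lo (Suc d) * k..hi (Suc d) * k}"
    by (auto simp: ray_box_def)
qed

lemma finite_ray_box: "finite (ray_box lo hi d k)"
proof (induction d)
  case (Suc d)
  have "finite (ray_box lo hi d k \<times> {lo (Suc d) * k..hi (Suc d) * k})" using Suc by simp
  then show ?case using bij_betw_finite[OF ray_box_Suc] by blast
qed (simp add: ray_box_0)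

lemma conic_quasi_sum_ray_box:
  assumes "F \<in> conic_quasi (Suc d)"
  shows "\<exists>g. quasi_poly g \<and> (\<forall>k > 0. (\<Sum>w\<in>ray_box lo hi d k. F w) = g k)"
  using assms
proof (induction d arbitrary: F)
  case 0
  then obtain g where "quasi_poly g" "\<And>k. k > 0 \<Longrightarrow> F ((\<lambda>_. 0)(0 := k)) = g k"
    by (rule conic_quasi_ray) blast
  moreover have "(\<Sum>w\<in>{v}. F w) = F v" for v by simp
  ultimately show ?case unfolding ray_box_0 by (intro exI[of _ g]) metis
next
  case (Suc d)
  define G where "G w = (\<Sum>z\<in>{lo (Suc d) * w 0..hi (Suc d) * w 0}. F (w(Suc d := z)))" for w
  have "G \<in> conic_quasi (Suc d)" unfolding G_def
    by (rule conic_quasi_sum_last[OF Suc.prems]) (simp_all add: int_forms_proj)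
  moreover have "(\<Sum>w\<in>ray_box lo hi (Suc d) k. F w) = (\<Sum>w\<in>ray_box lo hi d k. G w)" for k
  proof -
    have "(\<Sum>w\<in>ray_box lo hi (Suc d) k. F w)
        = (\<Sum>(w, z)\<in>ray_box lo hi d k \<times> {lo (Suc d) * k..hi (Suc d) * k}. F (w(Suc d := z)))"
      using sum.reindex_bij_betw[OF ray_box_Suc, of F d lo hi k] by (simp add: case_prod_unfold)
    also have "\<dots> = (\<Sum>w\<in>ray_box lo hi d k. \<Sum>z\<in>{lo (Suc d) * k..hi (Suc d) * k}. F (w(Suc d := z)))"
      by (rule sum.cartesian_product[symmetric])
    also have "\<dots> = (\<Sum>w\<in>ray_box lo hi d k. G w)"
      by (intro sum.cong refl) (simp add: G_def ray_box_def)
    finally show ?thesis .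
  qed
  ultimately show ?case using Suc.IH[of G] by simp
qed

text \<open>Lattice points of the dilates of a bounded rational polytope: the count is the sum of the product of
the indicators of the inequalities, and summing out the coordinates one after the other ends with a
function of the dilation factor only.\<close>

theorem card_ray_box_quasi_poly:
  assumes "finite Ls" "Ls \<subseteq> int_forms (Suc d)"
  shows "\<exists>g. quasi_poly g \<and> (\<forall>k > 0. of_nat (card {w \<in> ray_box lo hi d k. \<forall>L\<in>Ls. 0 \<le> L w}) = g k)"
proof -
  have "(\<lambda>w. \<Prod>L\<in>Ls. of_bool (0 \<le> L w)) \<in> conic_quasi (Suc d)"
    using assms(2) by (intro conic_quasi_prod conic_quasi.halfspace) auto
  then obtain g where g: "quasi_poly g"
    "\<And>k. k > 0 \<Longrightarrow> (\<Sum>w\<in>ray_box lo hi d k. \<Prod>L\<in>Ls. of_bool (0 \<le> L w)) = g k"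
    using conic_quasi_sum_ray_box by metis
  have prod: "(\<Prod>L\<in>Ls. of_bool (0 \<le> L w)) = (of_bool (\<forall>L\<in>Ls. 0 \<le> L w) :: rat)" for w
    using assms(1) by (induction Ls) auto
  have "of_nat (card {w \<in> ray_box lo hi d k. \<forall>L\<in>Ls. 0 \<le> L w}) = g k" if "k > 0" for k
  proof -
    have "of_nat (card {w \<in> ray_box lo hi d k. \<forall>L\<in>Ls. 0 \<le> L w})
        = (\<Sum>w\<in>ray_box lo hi d k. if \<forall>L\<in>Ls. 0 \<le> L w then 1 else 0 :: rat)"
      using finite_ray_box by (simp flip: sum.inter_filter)
    then show ?thesis using g(2)[OF that] unfolding prod by (simp add: of_bool_def)
  qed
  with g(1) show ?thesis by blast
qed

section \<open>Hilbert functions of graded families of vectors\<close>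

text \<open>Polynomiality for large arguments. No bound for the threshold is kept, since it is removed in the
end by comparison with a quasi-polynomial.\<close>

definition eventually_poly :: "(nat \<Rightarrow> rat) \<Rightarrow> bool" where
  "eventually_poly f \<longleftrightarrow> (\<exists>p k0. \<forall>k\<ge>k0. f k = poly p (of_nat k))"

lemma eventually_polyI: "(\<And>k. k \<ge> k0 \<Longrightarrow> f k = poly p (of_nat k)) \<Longrightarrow> eventually_poly f"
  unfolding eventually_poly_def by blast

lemma eventually_polyE:
  assumes "eventually_poly f"
  obtains p k0 where "\<And>k. k \<ge> k0 \<Longrightarrow> f k = poly p (of_nat k)"
  using assms unfolding eventually_poly_def by blast

lemma eventually_poly_cong:
  assumes "eventually_poly f" "\<And>k. k \<ge> k0 \<Longrightarrow> g k = f k"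
  shows "eventually_poly g"
proof -
  obtain p k1 where p: "\<And>k. k \<ge> k1 \<Longrightarrow> f k = poly p (of_nat k)"
    using eventually_polyE[OF assms(1)] by blast
  show ?thesis by (rule eventually_polyI[of "max k0 k1" _ p]) (simp add: assms(2) p)
qed

lemma eventually_poly_const: "eventually_poly (\<lambda>k. c)"
  by (rule eventually_polyI[of 0 _ "[:c:]"]) simp

lemma eventually_poly_add:
  assumes "eventually_poly f" "eventually_poly g"
  shows "eventually_poly (\<lambda>k. f k + g k)"
proof -
  obtain p k1 where p: "\<And>k. k \<ge> k1 \<Longrightarrow> f k = poly p (of_nat k)"
    using eventually_polyE[OF assms(1)] by blast
  obtain q k2 where q: "\<And>k. k \<ge> k2 \<Longrightarrow> g k = poly q (of_nat k)"
    using eventually_polyE[OF assms(2)] by blast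
  show ?thesis by (rule eventually_polyI[of "max k1 k2" _ "p + q"]) (simp add: p q)
qed

lemma eventually_poly_cmult:
  assumes "eventually_poly f"
  shows "eventually_poly (\<lambda>k. c * f k)"
proof -
  obtain p k1 where p: "\<And>k. k \<ge> k1 \<Longrightarrow> f k = poly p (of_nat k)"
    using eventually_polyE[OF assms(1)] by blast
  show ?thesis by (rule eventually_polyI[of k1 _ "smult c p"]) (simp add: p)
qed

lemma eventually_poly_sum:
  "(\<And>i. i \<in> I \<Longrightarrow> eventually_poly (f i)) \<Longrightarrow> eventually_poly (\<lambda>k. \<Sum>i\<in>I. f i k)"
  by (induction I rule: infinite_finite_induct) (auto intro: eventually_poly_add eventually_poly_const)

lemma eventually_poly_shift:
  assumes "eventually_poly f"
  shows "eventually_poly (\<lambda>k. f (k - c))"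
proof -
  obtain p k1 where p: "\<And>k. k \<ge> k1 \<Longrightarrow> f k = poly p (of_nat k)"
    using eventually_polyE[OF assms(1)] by blast
  show ?thesis
    by (rule eventually_polyI[of "k1 + c" _ "pcompose p [:- of_nat c, 1:]"])
      (simp add: p poly_pcompose of_nat_diff)
qed

lemma eventually_poly_unshift:
  assumes "eventually_poly (\<lambda>m. f (c + m))"
  shows "eventually_poly f"
  by (rule eventually_poly_cong[OF eventually_poly_shift[OF assms, of c], of c]) simp

lemma eventually_poly_partial_sums:
  assumes "eventually_poly f"
  shows "eventually_poly (\<lambda>m. \<Sum>i\<le>m. f i)"
proof -
  obtain p k1 where p: "\<And>k. k \<ge> k1 \<Longrightarrow> f k = poly p (of_nat k)"
    using eventually_polyE[OF assms(1)] by blast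
  obtain q where q: "\<And>t. poly q (t + 1) - poly q t = poly p t"
    using poly_antidifference by blast
  define C where "C = (\<Sum>i\<le>k1. f i) - poly q (of_nat k1 + 1)"
  show ?thesis
  proof (rule eventually_polyI[of k1 _ "pcompose q [:1, 1:] + [:C:]"])
    fix m assume "m \<ge> k1"
    then have "(\<Sum>i\<le>m. f i) = poly q (of_nat m + 1) + C"
    proof (induction m rule: dec_induct)
      case base then show ?case by (simp add: C_def)
    next
      case (step m)
      have "(\<Sum>i\<le>Suc m. f i) = poly q (of_nat m + 1) + C + poly p (of_nat (Suc m))"
        using step p[of "Suc m"] by simp
      also have "\<dots> = poly q (of_nat (Suc m) + 1) + C"
        using q[of "of_nat (Suc m)"] by (simp add: add.commute)
      finally show ?case .
    qed
    then show "(\<Sum>i\<le>m. f i) = poly (pcompose q [:1, 1:] + [:C:]) (of_nat m)"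
      by (simp add: poly_pcompose add.commute)
  qed
qed

lemma nat_seq_mono_subseq:
  fixes h :: "nat \<Rightarrow> nat"
  shows "\<exists>g :: nat \<Rightarrow> nat. strict_mono g \<and> (\<forall>i j. i \<le> j \<longrightarrow> h (g i) \<le> h (g j))"
proof -
  obtain g :: "nat \<Rightarrow> nat" where g: "strict_mono g" "monoseq (\<lambda>n. h (g n))"
    using seq_monosub[of h] by blast
  show ?thesis
  proof (cases "\<forall>i j. i \<le> j \<longrightarrow> h (g i) \<le> h (g j)")
    case True then show ?thesis using g(1) by (intro exI[of _ g] conjI)
  next
    case False
    then have dec: "\<And>i j. i \<le> j \<Longrightarrow> h (g j) \<le> h (g i)"
      using g(2) unfolding monoseq_def by blast
    obtain n0 where n0: "\<And>n. h (g n0) \<le> h (g n)"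
      using ex_has_least_nat[of "\<lambda>_. True" 0 "\<lambda>n. h (g n)"] by auto
    have "h (g (n0 + n)) = h (g n0)" for n
      using dec[of n0 "n0 + n"] n0[of "n0 + n"] by simp
    moreover have "strict_mono (\<lambda>n. g (n0 + n))" using g(1) by (simp add: strict_mono_def)
    ultimately show ?thesis by (intro exI[of _ "\<lambda>n. g (n0 + n)"]) simp
  qed
qed

text \<open>Dickson's lemma in the form of a subsequence that increases in all coordinates.\<close>

lemma dickson:
  fixes f :: "nat \<Rightarrow> nat list"
  assumes "\<And>i. length (f i) = N"
  shows "\<exists>g :: nat \<Rightarrow> nat. strict_mono g \<and> (\<forall>i j. i \<le> j \<longrightarrow> list_all2 (\<le>) (f (g i)) (f (g j)))"
  using assms
proof (induction N arbitrary: f)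
  case 0
  then show ?case by (intro exI[of _ id]) (auto simp: strict_mono_def)
next
  case (Suc N)
  obtain g :: "nat \<Rightarrow> nat" where g: "strict_mono g" "\<forall>i j. i \<le> j \<longrightarrow> hd (f (g i)) \<le> hd (f (g j))"
    using nat_seq_mono_subseq[of "\<lambda>i. hd (f i)"] by (elim exE conjE)
  have "\<And>i. length (tl (f (g i))) = N" using Suc.prems by simp
  then have "\<exists>g' :: nat \<Rightarrow> nat. strict_mono g' \<and> (\<forall>i j. i \<le> j \<longrightarrow> list_all2 (\<le>) (tl (f (g (g' i)))) (tl (f (g (g' j)))))"
    by (rule Suc.IH[of "\<lambda>i. tl (f (g i))"])
  then obtain g' :: "nat \<Rightarrow> nat" where g'_mono: "strict_mono g'"
    and g': "\<forall>i j. i \<le> j \<longrightarrow> list_all2 (\<le>) (tl (f (g (g' i)))) (tl (f (g (g' j))))"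
    by (elim exE conjE)
  have "list_all2 (\<le>) (f (g (g' i))) (f (g (g' j)))" if "i \<le> j" for i j
  proof -
    have "g' i \<le> g' j" using that g'_mono by (simp add: strict_mono_less_eq)
    then have "hd (f (g (g' i))) \<le> hd (f (g (g' j)))" by (rule g(2)[rule_format])
    then have "list_all2 (\<le>) (hd (f (g (g' i))) # tl (f (g (g' i)))) (hd (f (g (g' j))) # tl (f (g (g' j))))"
      using g'[rule_format, OF that] by simp
    moreover have "hd (f (g (g' l))) # tl (f (g (g' l))) = f (g (g' l))" for l
      using Suc.prems[of "g (g' l)"] by (cases "f (g (g' l))") auto
    ultimately show ?thesis by simp
  qed
  moreover have "strict_mono (\<lambda>n. g (g' n))"
    using g(1) g'_mono by (simp add: strict_mono_def)
  ultimately show ?case by (intro exI[of _ "\<lambda>n. g (g' n)"] conjI allI impI)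
qed

definition down_closed :: "nat list set \<Rightarrow> bool" where
  "down_closed A \<longleftrightarrow> (\<forall>xs\<in>A. \<forall>ys. list_all2 (\<le>) ys xs \<longrightarrow> ys \<in> A)"

text \<open>If the chain kept dropping, picking one lost vector at every drop would give a sequence in which, by
Dickson's lemma, an earlier vector lies below a later one. The later one is still present after the drop
at which the earlier one was lost, a contradiction to closure under smaller vectors.\<close>

lemma down_closed_chain_stable:
  fixes A :: "nat \<Rightarrow> nat list set"
  assumes down: "\<And>j. down_closed (A j)" and len: "\<And>j xs. xs \<in> A j \<Longrightarrow> length xs = N"
    and anti: "\<And>i j. i \<le> j \<Longrightarrow> A j \<subseteq> A i"
  shows "\<exists>J. \<forall>j\<ge>J. A j = A J"
proof (rule ccontr)
    assume "\<not> ?thesis"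
    then have "\<forall>J. \<exists>j\<ge>J. A j \<noteq> A J" by simp
    then obtain nxt where nxt_ne: "\<And>J. nxt J \<ge> J" "\<And>J. A (nxt J) \<noteq> A J" by metis
    have "\<exists>x. x \<in> A J - A (nxt J)" for J using anti[OF nxt_ne(1)[of J]] nxt_ne(2)[of J] by blast
    then obtain x where "\<And>J. x J \<in> A J - A (nxt J)" by metis
    note nxt = nxt_ne(1) this
    define s where "s i = (nxt ^^ i) 0" for i
    have s_Suc: "s (Suc i) = nxt (s i)" for i by (simp add: s_def)
    have s_mono: "s i \<le> s j" if "i \<le> j" for i j
      by (rule lift_Suc_mono_le[OF _ that]) (simp add: s_Suc nxt(1))
    have "\<And>i. length (x (s i)) = N" using nxt(2) len by blast
    from dickson[of "\<lambda>i. x (s i)", OF this] obtain g :: "nat \<Rightarrow> nat" where g: "strict_mono g"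
      "\<forall>i j. i \<le> j \<longrightarrow> list_all2 (\<le>) (x (s (g i))) (x (s (g j)))" by (elim exE conjE)
    have "Suc (g 0) \<le> g 1" using g(1) by (simp add: strict_mono_def Suc_leI)
    then have "x (s (g 1)) \<in> A (s (Suc (g 0)))" using nxt(2) anti[OF s_mono] by blast
    moreover have "list_all2 (\<le>) (x (s (g 0))) (x (s (g 1)))" using g(2)[rule_format, of 0 1] by simp
    ultimately have "x (s (g 0)) \<in> A (s (Suc (g 0)))" using down unfolding down_closed_def by blast
    then show False using nxt(2)[of "s (g 0)"] by (simp add: s_Suc)
qed

lemma finite_lists_sum: "finite {xs :: nat list. length xs = N \<and> sum_list xs = m}"
proof (rule finite_subset)
  show "{xs. length xs = N \<and> sum_list xs = m} \<subseteq> {xs. set xs \<subseteq> {..m} \<and> length xs = N}"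
    by (auto intro: member_le_sum_list)
qed (simp add: finite_lists_length_eq)

text \<open>The sets of exponent vectors outside a monomial ideal are exactly the down-closed sets, so this is the
polynomiality of Hilbert functions. Slicing by the first coordinate gives a decreasing chain of slices, which
stabilises; the constant part of the chain contributes partial sums of one Hilbert function.\<close>

lemma eventually_poly_card_down_closed:
  assumes "down_closed A" "\<And>xs. xs \<in> A \<Longrightarrow> length xs = N"
  shows "eventually_poly (\<lambda>m. of_nat (card {xs \<in> A. sum_list xs = m}))"
  using assms
proof (induction N arbitrary: A)
  case 0
  show ?case
  proof (rule eventually_polyI[of 1 _ 0])
    fix m :: nat assume "m \<ge> 1"
    then have empty: "{xs \<in> A. sum_list xs = m} = {}" using 0(2) by fastforce
    show "of_nat (card {xs \<in> A. sum_list xs = m}) = poly 0 (of_nat m :: rat)"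
      unfolding empty by simp
  qed
next
  case (Suc N)
  define B where "B j = {ys. j # ys \<in> A}" for j
  have down: "down_closed (B j)" for j
    using Suc.prems(1) unfolding down_closed_def B_def by fastforce
  have len: "length ys = N" if "ys \<in> B j" for j ys using Suc.prems(2) that unfolding B_def by fastforce
  have anti: "B j \<subseteq> B i" if "i \<le> j" for i j
  proof
    fix ys assume "ys \<in> B j"
    moreover have "list_all2 (\<le>) (i # ys) (j # ys)" using that by (simp add: list_all2_refl)
    ultimately show "ys \<in> B i" using Suc.prems(1) unfolding down_closed_def B_def by blast
  qed
  have "\<exists>J. \<forall>j\<ge>J. B j = B J"
    by (rule down_closed_chain_stable[of B, OF down len anti])
  then obtain J where J: "\<forall>j\<ge>J. B j = B J" by (elim exE)
  define b :: "nat \<Rightarrow> nat \<Rightarrow> rat" where "b j m = of_nat (card {ys \<in> B j. sum_list ys = m})" for j m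
  have b_stable: "b j = b J" if "j \<ge> J" for j
  proof -
    have "B j = B J" using J that by blast
    then show ?thesis by (intro ext) (simp only: b_def)
  qed
  have b_poly: "eventually_poly (b j)" for j
    unfolding b_def using Suc.IH[OF down len] .
  have fin: "finite {ys \<in> B j. sum_list ys = m}" for j m
    by (rule finite_subset[OF _ finite_lists_sum[of N m]]) (use len in auto)
  have card_eq: "of_nat (card {xs \<in> A. sum_list xs = m}) = (\<Sum>j\<le>m. b j (m - j))" for m
  proof -
    have "{xs \<in> A. sum_list xs = m} = (\<Union>j\<le>m. (#) j ` {ys \<in> B j. sum_list ys = m - j})"
    proof (intro set_eqI iffI)
      fix xs assume xs: "xs \<in> {xs \<in> A. sum_list xs = m}"
      have "xs \<noteq> []" using xs Suc.prems(2)[of xs] by auto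
      then obtain j ys where cons: "xs = j # ys" by (cases xs) simp_all
      have mem: "j # ys \<in> A" "j + sum_list ys = m" using xs by (simp_all add: cons)
      then have "ys \<in> {ys \<in> B j. sum_list ys = m - j}" by (simp add: B_def)
      then have "xs \<in> (#) j ` {ys \<in> B j. sum_list ys = m - j}" unfolding cons by (rule imageI)
      moreover have "j \<in> {..m}" using mem(2) by simp
      ultimately show "xs \<in> (\<Union>j\<le>m. (#) j ` {ys \<in> B j. sum_list ys = m - j})"
        by (rule UN_I[rotated])
    qed (auto simp: B_def)
    moreover have "card (\<Union>j\<le>m. (#) j ` {ys \<in> B j. sum_list ys = m - j})
        = (\<Sum>j\<le>m. card ((#) j ` {ys \<in> B j. sum_list ys = m - j}))"
      by (rule card_UN_disjoint) (auto simp: fin)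
    moreover have "card ((#) j ` {ys \<in> B j. sum_list ys = m - j}) = card {ys \<in> B j. sum_list ys = m - j}" for j
      by (rule card_image) (simp add: inj_on_def)
    ultimately show ?thesis by (simp add: b_def)
  qed
  have "eventually_poly (\<lambda>m. (\<Sum>j<J. b j (m - j)) + (\<Sum>i\<le>m - J. b J i))"
    by (intro eventually_poly_add eventually_poly_sum eventually_poly_shift[OF b_poly]
      eventually_poly_shift[OF eventually_poly_partial_sums[OF b_poly]])
  then show ?case
  proof (rule eventually_poly_cong)
    fix m assume m: "m \<ge> J"
    have split: "{..m} = {..<J} \<union> {J..m}" using m by auto
    have "(\<Sum>j\<le>m. b j (m - j)) = (\<Sum>j<J. b j (m - j)) + (\<Sum>j\<in>{J..m}. b j (m - j))"
      unfolding split by (rule sum.union_disjoint) auto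
    also have "(\<Sum>j\<in>{J..m}. b j (m - j)) = (\<Sum>j\<in>{J..m}. b J (m - j))"
    proof (rule sum.cong[OF refl])
      fix j assume "j \<in> {J..m}"
      then have "b j = b J" by (intro b_stable) simp
      then show "b j (m - j) = b J (m - j)" by (rule fun_cong)
    qed
    also have "(\<Sum>j\<in>{J..m}. b J (m - j)) = (\<Sum>i\<le>m - J. b J i)"
      by (rule sum.reindex_bij_witness[of _ "\<lambda>i. m - i" "\<lambda>j. m - j"]) (use m in auto)
    finally show "of_nat (card {xs \<in> A. sum_list xs = m})
        = (\<Sum>j<J. b j (m - j)) + (\<Sum>i\<le>m - J. b J i)" unfolding card_eq by simp
  qed
qed

text \<open>Translation invariance of the lexicographic order, which makes the canonical representations below
closed under passing to smaller exponents.\<close>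

lemma list_less_map2_add:
  fixes a b d :: "nat list"
  assumes "a < b" "length a = length b" "length d = length b"
  shows "map2 (+) a d < map2 (+) b d"
  using assms
proof (induction a arbitrary: b d)
  case (Cons x a)
  then obtain y b' z d' where "b = y # b'" "d = z # d'" by (metis Suc_length_conv)
  with Cons show ?case by auto
qed simp

text \<open>The sets \<open>E k\<close> form a graded module over the monoid generated by \<open>S\<close>, with all generators of the monoid in
degree one and module generators \<open>E k0\<close>. Every element is some generator plus a combination of \<open>S\<close>. Among
all such representations the lexicographically least is chosen. Replacing a part of a least representation
by a smaller one would improve the whole, so for each module generator the exponents of least
representations are down-closed, and their number in each degree is eventually polynomial. It is
essential that \<open>S\<close> lies in degree one: generators of higher degree would only give quasi-polynomials.\<close>

lemma eventually_poly_card_generated: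
  fixes E :: "nat \<Rightarrow> ('i \<Rightarrow> nat) set" and S :: "('i \<Rightarrow> nat) set"
  assumes "finite S" and finE: "finite (E k0)"
    and closed: "\<And>k e s. k \<ge> k0 \<Longrightarrow> e \<in> E k \<Longrightarrow> s \<in> S \<Longrightarrow> (\<lambda>z. e z + s z) \<in> E (Suc k)"
    and generated: "\<And>k e. k \<ge> k0 \<Longrightarrow> e \<in> E (Suc k) \<Longrightarrow> \<exists>e'\<in>E k. \<exists>s\<in>S. e = (\<lambda>z. e' z + s z)"
  shows "eventually_poly (\<lambda>k. of_nat (card (E k)))"
proof -
  obtain ss where ss: "set ss = S" using finite_list[OF \<open>finite S\<close>] by blast
  obtain gs where gs: "set gs = E k0" using finite_list[OF finE] by blast
  define N where "N = length ss"
  define val where "val h a = (\<lambda>z. (gs ! h) z + (\<Sum>i<N. a ! i * (ss ! i) z))" for h a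
  \<comment> \<open>Head: index of the module generator; tail: exponents of the elements of \<open>S\<close>.\<close>
  define R where "R m e = {h # a | h a. h < length gs \<and> length a = N \<and> sum_list a = m \<and> val h a = e}" for m e
  have R_D: "\<exists>h a. xs = h # a \<and> h < length gs \<and> length a = N \<and> sum_list a = m \<and> val h a = e"
    if "xs \<in> R m e" for xs m e
    using that by (simp add: R_def)
  have sum_list_N: "sum_list a = (\<Sum>i<N. a ! i)" if "length a = N" for a :: "nat list"
    using that by (simp add: sum_list_sum_nth atLeast0LessThan)
  have bump: "val h (a[i := Suc (a ! i)]) = (\<lambda>z. val h a z + (ss ! i) z)"
    "sum_list (a[i := Suc (a ! i)]) = Suc (sum_list a)" if "i < N" "length a = N" for h a i
  proof -
    have eq: "(\<Sum>l<N. (a[i := Suc (a ! i)]) ! l * f l) = (\<Sum>l<N. a ! l * f l) + f i" for f :: "nat \<Rightarrow> nat"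
    proof -
      have "(\<Sum>l<N. (a[i := Suc (a ! i)]) ! l * f l) = (\<Sum>l<N. a ! l * f l + (if l = i then f i else 0))"
        using that by (intro sum.cong) (auto simp: nth_list_update)
      then show ?thesis using that by (simp add: sum.distrib)
    qed
    show "val h (a[i := Suc (a ! i)]) = (\<lambda>z. val h a z + (ss ! i) z)"
      unfolding val_def by (simp add: eq add.assoc)
    show "sum_list (a[i := Suc (a ! i)]) = Suc (sum_list a)"
      using that eq[of "\<lambda>_. 1"] by (simp add: sum_list_N)
  qed
  have val_in: "val h a \<in> E (k0 + m)" if "h < length gs" "length a = N" "sum_list a = m" for h a m
    using that(2,3)
  proof (induction m arbitrary: a)
    case 0
    then have "\<And>i. i < N \<Longrightarrow> a ! i = 0" by (simp add: sum_list_N)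
    then have "val h a = gs ! h" by (simp add: val_def)
    then show ?case using that(1) gs by (metis add_0_right nth_mem)
  next
    case (Suc m)
    have "\<exists>i<N. a ! i > 0"
    proof (rule ccontr)
      assume "\<not> ?thesis"
      then have "sum_list a = 0" using Suc.prems(1) by (simp add: sum_list_N)
      then show False using Suc.prems(2) by simp
    qed
    then obtain i where i: "i < N" "a ! i > 0" by blast
    define a' where "a' = a[i := a ! i - 1]"
    have a': "length a' = N" "a = a'[i := Suc (a' ! i)]" using i Suc.prems(1) by (simp_all add: a'_def)
    then have "sum_list a' = m" using bump(2)[OF i(1) a'(1)] Suc.prems(2) by simp
    then have "val h a' \<in> E (k0 + m)" using Suc.IH a'(1) by blast
    then have "(\<lambda>z. val h a' z + (ss ! i) z) \<in> E (Suc (k0 + m))"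
      using closed i(1) ss by (metis N_def le_add1 nth_mem)
    then show ?case using bump(1)[OF i(1) a'(1)] a'(2) by simp
  qed
  have val_onto: "\<exists>h a. h < length gs \<and> length a = N \<and> sum_list a = m \<and> val h a = e"
    if "e \<in> E (k0 + m)" for m e
    using that
  proof (induction m arbitrary: e)
    case 0
    then obtain h where "h < length gs" "gs ! h = e" using gs by (metis add_0_right in_set_conv_nth)
    then show ?case by (intro exI[of _ h] exI[of _ "replicate N 0"]) (simp add: val_def)
  next
    case (Suc m)
    then obtain e' s where e': "e' \<in> E (k0 + m)" "s \<in> S" "e = (\<lambda>z. e' z + s z)"
      using generated[of "k0 + m" e] by auto
    obtain h a where a: "h < length gs" "length a = N" "sum_list a = m" "val h a = e'"
      using Suc.IH[OF e'(1)] by blast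
    obtain i where i: "i < N" "ss ! i = s" using e'(2) ss by (metis N_def in_set_conv_nth)
    show ?case using a e'(3) bump(1)[OF i(1) a(2), of h] bump(2)[OF i(1) a(2)] i
      by (intro exI[of _ h] exI[of _ "a[i := Suc (a ! i)]"]) simp
  qed
  have finR: "finite (R m e)" for m e
  proof (rule finite_subset)
    show "R m e \<subseteq> (\<lambda>(h, a). h # a) ` ({..<length gs} \<times> {a. length a = N \<and> sum_list a = m})"
      by (auto simp: R_def)
  qed (intro finite_imageI finite_cartesian_product finite_lessThan finite_lists_sum)
  define A where "A h = {a. length a = N \<and> h # a = Min (R (sum_list a) (val h a))}" for h
  have down: "down_closed (A h)" if h: "h < length gs" for h
    unfolding down_closed_def
  proof (intro ballI allI impI)
    fix a a' assume a: "a \<in> A h" and le: "list_all2 (\<le>) a' a"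
    have a_Min: "h # a = Min (R (sum_list a) (val h a))" using a unfolding A_def by blast
    have len: "length a = N" "length a' = N" using a le by (auto simp: A_def list_all2_lengthD)
    define d where "d = map2 (-) a a'"
    have d: "length d = N" using len by (simp add: d_def)
    have a_d: "a = map2 (+) a' d"
      using le len by (auto simp: d_def list_all2_conv_all_nth intro!: nth_equalityI)
    have sum_d: "sum_list (map2 (+) b d) = sum_list b + sum_list d" if "length b = N" for b
      using that d by (simp add: sum_list_N sum.distrib)
    have val_d: "val h' (map2 (+) b d) = (\<lambda>z. val h' b z + (\<Sum>i<N. d ! i * (ss ! i) z))" if "length b = N" for b h'
      using that d by (simp add: val_def sum.distrib distrib_right add.assoc)
    have "h # a' \<in> R (sum_list a') (val h a')" using h len by (auto simp: R_def)
    moreover have "h # a' \<le> y" if y: "y \<in> R (sum_list a') (val h a')" for y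
    proof (rule ccontr)
      assume "\<not> h # a' \<le> y"
      then have less: "y < h # a'" by simp
      obtain h' b where b: "y = h' # b" "h' < length gs" "length b = N" "sum_list b = sum_list a'"
        "val h' b = val h a'" using y by (auto simp: R_def)
      have "val h' (map2 (+) b d) = val h a"
        unfolding val_d[OF b(3)] b(5) by (subst a_d) (simp add: val_d[OF len(2)])
      moreover have "sum_list (map2 (+) b d) = sum_list a"
        unfolding sum_d[OF b(3)] b(4) by (subst a_d) (simp add: sum_d[OF len(2)])
      ultimately have "h' # map2 (+) b d \<in> R (sum_list a) (val h a)"
        using b d by (auto simp: R_def)
      from Min_le[OF finR this] have "h # a \<le> h' # map2 (+) b d"
        unfolding a_Min[symmetric] .
      moreover have "h' # map2 (+) b d < h # map2 (+) a' d"
        using less list_less_map2_add[of b a' d] b(3) len d unfolding b(1) by auto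
      ultimately show False using a_d by (metis leD)
    qed
    ultimately have "h # a' = Min (R (sum_list a') (val h a'))"
      by (intro Min_eqI[OF finR, symmetric])
    then show "a' \<in> A h" using len unfolding A_def by blast
  qed
  have card_E: "card (E (k0 + m)) = (\<Sum>h<length gs. card {a \<in> A h. sum_list a = m})" for m
  proof -
    have "bij_betw (\<lambda>(h, a). val h a) (SIGMA h:{..<length gs}. {a \<in> A h. sum_list a = m}) (E (k0 + m))"
      unfolding bij_betw_def
    proof
      show "inj_on (\<lambda>(h, a). val h a) (SIGMA h:{..<length gs}. {a \<in> A h. sum_list a = m})"
      proof (rule inj_onI)
        fix p q
        assume p: "p \<in> (SIGMA h:{..<length gs}. {a \<in> A h. sum_list a = m})"
          and q: "q \<in> (SIGMA h:{..<length gs}. {a \<in> A h. sum_list a = m})"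
          and eq: "(case p of (h, a) \<Rightarrow> val h a) = (case q of (h, a) \<Rightarrow> val h a)"
        have least: "fst r # snd r = Min (R m (val (fst r) (snd r)))"
          if "r \<in> (SIGMA h:{..<length gs}. {a \<in> A h. sum_list a = m})" for r
          using that unfolding A_def by auto
        have "val (fst p) (snd p) = val (fst q) (snd q)" using eq by (simp add: case_prod_unfold)
        then have "fst p # snd p = fst q # snd q" by (simp only: least[OF p] least[OF q])
        then show "p = q" by (simp add: prod_eq_iff)
      qed
      show "(\<lambda>(h, a). val h a) ` (SIGMA h:{..<length gs}. {a \<in> A h. sum_list a = m}) = E (k0 + m)"
      proof (intro set_eqI iffI)
        fix e assume "e \<in> E (k0 + m)"
        from val_onto[OF this] have "R m e \<noteq> {}" unfolding R_def by blast
        then have "Min (R m e) \<in> R m e" using finR by simp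
        from R_D[OF this] obtain h a where ha: "Min (R m e) = h # a" "h < length gs" "length a = N"
          "sum_list a = m" "val h a = e" by (elim exE conjE)
        have "a \<in> A h" unfolding A_def using ha by simp
        then show "e \<in> (\<lambda>(h, a). val h a) ` (SIGMA h:{..<length gs}. {a \<in> A h. sum_list a = m})"
          using ha by (intro image_eqI[of _ _ "(h, a)"]) simp_all
      next
        fix e assume "e \<in> (\<lambda>(h, a). val h a) ` (SIGMA h:{..<length gs}. {a \<in> A h. sum_list a = m})"
        then obtain h a where "e = val h a" "h < length gs" "a \<in> A h" "sum_list a = m" by auto
        moreover from this have "length a = N" unfolding A_def by blast
        ultimately show "e \<in> E (k0 + m)" using val_in by blast
      qed
    qed
    then have "card (E (k0 + m)) = card (SIGMA h:{..<length gs}. {a \<in> A h. sum_list a = m})"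
      by (simp add: bij_betw_same_card)
    also have "\<dots> = (\<Sum>h<length gs. card {a \<in> A h. sum_list a = m})"
    proof (rule card_SigmaI)
      show "\<forall>h\<in>{..<length gs}. finite {a \<in> A h. sum_list a = m}"
        by (intro ballI finite_subset[OF _ finite_lists_sum[of N m]]) (auto simp: A_def)
    qed simp
    finally show ?thesis .
  qed
  have "eventually_poly (\<lambda>m. \<Sum>h<length gs. of_nat (card {a \<in> A h. sum_list a = m}))"
    by (intro eventually_poly_sum eventually_poly_card_down_closed[of _ N] down) (auto simp: A_def)
  then have "eventually_poly (\<lambda>m. of_nat (card (E (k0 + m))))"
    by (simp only: card_E of_nat_sum)
  then show ?thesis by (rule eventually_poly_unshift[of "\<lambda>k. of_nat (card (E k))"])
qed

section \<open>Nonnegative integer matrices with given margins\<close>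

text \<open>An integral submatrix with given margins exists as soon as no cut is too small (Gale's criterion). Take
a positive entry. Either it can be decreased with the margins kept, or one unit of it can be put into the
submatrix and both margins decreased. If each of these spoiled the criterion, there would be two tight
cuts, the first of which counts the entry while the second contains its column but not its row. Cut capacity is
submodular, and the entry counts in neither the union nor the intersection of the two cuts, so one of
these would violate the criterion.\<close>

lemma gale_supply_demand:
  fixes M :: "'a \<times> 'b \<Rightarrow> nat" and p :: "'a \<Rightarrow> int" and c :: "'b \<Rightarrow> int"
  assumes "finite I" "finite J"
    and "\<And>S T. S \<subseteq> I \<Longrightarrow> T \<subseteq> J \<Longrightarrow>
      sum p S \<le> sum c T + (\<Sum>z\<in>I \<times> J. of_bool (fst z \<in> S \<and> snd z \<notin> T) * int (M z))"
    and "sum p I = sum c J"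
  shows "\<exists>M'. (\<forall>z. M' z \<le> M z) \<and> (\<forall>z. z \<notin> I \<times> J \<longrightarrow> M' z = 0) \<and>
    (\<forall>i\<in>I. (\<Sum>j\<in>J. int (M' (i, j))) = p i) \<and> (\<forall>j\<in>J. (\<Sum>i\<in>I. int (M' (i, j))) = c j)"
  using assms(3,4)
proof (induction "\<Sum>z\<in>I \<times> J. M z" arbitrary: M p c rule: less_induct)
  case less
  define cut where "cut M S T = (\<Sum>z\<in>I \<times> J. of_bool (fst z \<in> S \<and> snd z \<notin> T) * int (M z))"
    for M :: "'a \<times> 'b \<Rightarrow> nat" and S T
  have cond: "sum p S \<le> sum c T + cut M S T" if "S \<subseteq> I" "T \<subseteq> J" for S T
    using less.prems(1)[OF that] by (simp add: cut_def)
  show ?case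
  proof (cases "\<exists>z\<in>I \<times> J. M z > 0")
    case False
    then have cut0: "cut M S T = 0" for S T unfolding cut_def by (intro sum.neutral) auto
    have p_le: "p i \<le> 0" if "i \<in> I" for i using cond[of "{i}" "{}"] that cut0 by simp
    have c_ge: "c j \<ge> 0" if "j \<in> J" for j using cond[of "{}" "{j}"] that cut0 by simp
    have "sum p I \<le> 0" "sum c J \<ge> 0" using p_le c_ge by (auto intro: sum_nonpos sum_nonneg)
    then have "sum p I = 0" "sum c J = 0" using less.prems(2) by auto
    then have "\<forall>i\<in>I. - p i = 0" "\<forall>j\<in>J. c j = 0"
      using p_le c_ge assms(1,2)
        sum_nonneg_eq_0_iff[of J c] sum_nonneg_eq_0_iff[of I "\<lambda>i. - p i"]
      by (auto simp: sum_negf)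
    then show ?thesis by (intro exI[of _ "\<lambda>_. 0"]) simp
  next
    case True
    then obtain i j where ij: "i \<in> I" "j \<in> J" "M (i, j) > 0" by auto
    define M1 where "M1 = M((i, j) := M (i, j) - 1)"
    define p1 where "p1 = p(i := p i - 1)"
    define c1 where "c1 = c(j := c j - 1)"
    have M_M1: "int (M z) = int (M1 z) + of_bool (z = (i, j))" for z
      using ij by (auto simp: M1_def)
    have cut_M1: "cut M S T = cut M1 S T + of_bool (i \<in> S \<and> j \<notin> T)" for S T
    proof -
      have "cut M S T = (\<Sum>z\<in>I \<times> J. of_bool (fst z \<in> S \<and> snd z \<notin> T) * int (M1 z)
          + (if z = (i, j) then of_bool (i \<in> S \<and> j \<notin> T) else 0))"
        unfolding cut_def M_M1 by (intro sum.cong) auto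
      then show ?thesis using ij assms(1,2) by (simp add: sum.distrib cut_def)
    qed
    have sum_p1: "sum p S = sum p1 S + of_bool (i \<in> S)" if "S \<subseteq> I" for S
    proof -
      have "sum p S = (\<Sum>l\<in>S. p1 l + (if l = i then 1 else 0))"
        by (intro sum.cong) (auto simp: p1_def)
      then show ?thesis using finite_subset[OF that assms(1)] by (simp add: sum.distrib)
    qed
    have sum_c1: "sum c T = sum c1 T + of_bool (j \<in> T)" if "T \<subseteq> J" for T
    proof -
      have "sum c T = (\<Sum>l\<in>T. c1 l + (if l = j then 1 else 0))"
        by (intro sum.cong) (auto simp: c1_def)
      then show ?thesis using finite_subset[OF that assms(2)] by (simp add: sum.distrib)
    qed
    have "(\<Sum>z\<in>I \<times> J. int (M z)) = (\<Sum>z\<in>I \<times> J. int (M1 z)) + 1"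
      unfolding M_M1 using ij assms(1,2) by (simp add: sum.distrib of_bool_def)
    then have smaller: "(\<Sum>z\<in>I \<times> J. M1 z) < (\<Sum>z\<in>I \<times> J. M z)"
      by (simp flip: of_nat_sum)
    have M1_le: "M1 z \<le> M z" for z by (simp add: M1_def)
    consider (delete) "\<And>S T. S \<subseteq> I \<Longrightarrow> T \<subseteq> J \<Longrightarrow> sum p S \<le> sum c T + cut M1 S T"
      | (use_entry) "\<And>S T. S \<subseteq> I \<Longrightarrow> T \<subseteq> J \<Longrightarrow> sum p1 S \<le> sum c1 T + cut M1 S T"
      | (tight) S1 T1 S2 T2 where "S1 \<subseteq> I" "T1 \<subseteq> J" "sum p S1 > sum c T1 + cut M1 S1 T1"
        "S2 \<subseteq> I" "T2 \<subseteq> J" "sum p1 S2 > sum c1 T2 + cut M1 S2 T2"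
      by (meson linorder_not_le)
    then show ?thesis
    proof cases
      case delete
      then have "\<exists>M'. (\<forall>z. M' z \<le> M1 z) \<and> (\<forall>z. z \<notin> I \<times> J \<longrightarrow> M' z = 0) \<and>
        (\<forall>i\<in>I. (\<Sum>j\<in>J. int (M' (i, j))) = p i) \<and> (\<forall>j\<in>J. (\<Sum>i\<in>I. int (M' (i, j))) = c j)"
        by (intro less.hyps smaller less.prems(2)) (simp_all add: cut_def)
      then show ?thesis using M1_le by (meson order_trans)
    next
      case use_entry
      have "sum p1 I = sum c1 J" using sum_p1[of I] sum_c1[of J] less.prems(2) ij by simp
      then have "\<exists>M'. (\<forall>z. M' z \<le> M1 z) \<and> (\<forall>z. z \<notin> I \<times> J \<longrightarrow> M' z = 0) \<and>
        (\<forall>i\<in>I. (\<Sum>j\<in>J. int (M' (i, j))) = p1 i) \<and> (\<forall>j\<in>J. (\<Sum>i\<in>I. int (M' (i, j))) = c1 j)"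
        using use_entry by (intro less.hyps smaller) (simp_all add: cut_def)
      then obtain M' where "\<forall>z. M' z \<le> M1 z" "\<forall>z. z \<notin> I \<times> J \<longrightarrow> M' z = 0"
        "\<forall>l\<in>I. (\<Sum>j\<in>J. int (M' (l, j))) = p1 l" "\<forall>l\<in>J. (\<Sum>i\<in>I. int (M' (i, l))) = c1 l"
        by (elim exE conjE)
      note M' = this[rule_format]
      define M2 where "M2 = M'((i, j) := Suc (M' (i, j)))"
      have M2: "int (M2 (k, l)) = int (M' (k, l)) + (if k = i \<and> l = j then 1 else 0)" for k l
        by (simp add: M2_def)
      show ?thesis
      proof (intro exI[of _ M2] conjI allI ballI impI)
        fix z show "M2 z \<le> M z"
          using M'(1)[of z] M'(1)[of "(i, j)"] ij by (auto simp: M2_def M1_def split: if_splits)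
      next
        fix z assume "z \<notin> I \<times> J" then show "M2 z = 0" using ij M'(2) by (auto simp: M2_def)
      next
        fix k assume "k \<in> I"
        then show "(\<Sum>l\<in>J. int (M2 (k, l))) = p k"
          using M'(3)[of k] ij assms(2) by (cases "k = i") (simp_all add: M2 sum.distrib p1_def)
      next
        fix l assume "l \<in> J"
        then show "(\<Sum>k\<in>I. int (M2 (k, l))) = c l"
          using M'(4)[of l] ij assms(1) by (cases "l = j") (simp_all add: M2 sum.distrib c1_def)
      qed
    next
      case tight
      have 1: "i \<in> S1" "j \<notin> T1" "sum p S1 = sum c T1 + cut M S1 T1"
        using tight(3) cond[OF tight(1,2)] cut_M1[of S1 T1] by (auto simp: of_bool_def split: if_splits)
      have 2: "i \<notin> S2" "j \<in> T2" "sum p S2 = sum c T2 + cut M S2 T2"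
        using tight(6) cond[OF tight(4,5)] cut_M1[of S2 T2] sum_p1[OF tight(4)] sum_c1[OF tight(5)]
        by (auto simp: of_bool_def split: if_splits)
      have "cut M (S1 \<union> S2) (T1 \<union> T2) + cut M (S1 \<inter> S2) (T1 \<inter> T2) + int (M (i, j))
          \<le> cut M S1 T1 + cut M S2 T2"
      proof -
        have "int (M (i, j)) = (\<Sum>z\<in>I \<times> J. if z = (i, j) then int (M z) else 0)"
          using ij assms(1,2) by simp
        then have "cut M (S1 \<union> S2) (T1 \<union> T2) + cut M (S1 \<inter> S2) (T1 \<inter> T2) + int (M (i, j))
          = (\<Sum>z\<in>I \<times> J. of_bool (fst z \<in> S1 \<union> S2 \<and> snd z \<notin> T1 \<union> T2) * int (M z)
            + of_bool (fst z \<in> S1 \<inter> S2 \<and> snd z \<notin> T1 \<inter> T2) * int (M z)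
            + (if z = (i, j) then int (M z) else 0))"
          unfolding cut_def by (simp only: sum.distrib)
        also have "\<dots> \<le> (\<Sum>z\<in>I \<times> J. of_bool (fst z \<in> S1 \<and> snd z \<notin> T1) * int (M z)
            + of_bool (fst z \<in> S2 \<and> snd z \<notin> T2) * int (M z))"
          by (rule sum_mono) (use 1 2 in \<open>auto simp: of_bool_def\<close>)
        finally show ?thesis unfolding cut_def by (simp only: sum.distrib)
      qed
      moreover have "sum p (S1 \<union> S2) + sum p (S1 \<inter> S2) = sum p S1 + sum p S2"
        using tight finite_subset[OF _ assms(1)] by (intro sum.union_inter) auto
      moreover have "sum c (T1 \<union> T2) + sum c (T1 \<inter> T2) = sum c T1 + sum c T2"
        using tight finite_subset[OF _ assms(2)] by (intro sum.union_inter) auto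
      moreover have "sum p (S1 \<union> S2) \<le> sum c (T1 \<union> T2) + cut M (S1 \<union> S2) (T1 \<union> T2)"
        using tight by (intro cond) auto
      moreover have "sum p (S1 \<inter> S2) \<le> sum c (T1 \<inter> T2) + cut M (S1 \<inter> S2) (T1 \<inter> T2)"
        using tight by (intro cond) auto
      ultimately have False using 1(3) 2(3) ij(3) by linarith
      then show ?thesis ..
    qed
  qed
qed

text \<open>Matrices are extended by zero so that equal matrices are equal functions.\<close>

definition margin_matrices :: "'a set \<Rightarrow> 'b set \<Rightarrow> ('a \<Rightarrow> int) \<Rightarrow> ('b \<Rightarrow> int) \<Rightarrow> ('a \<times> 'b \<Rightarrow> nat) set" where
  "margin_matrices I J r c = {M. (\<forall>z. z \<notin> I \<times> J \<longrightarrow> M z = 0) \<and>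
     (\<forall>i\<in>I. (\<Sum>j\<in>J. int (M (i, j))) = r i) \<and> (\<forall>j\<in>J. (\<Sum>i\<in>I. int (M (i, j))) = c j)}"

lemma margin_matrices_total:
  assumes "M \<in> margin_matrices I J r c"
  shows "sum r I = sum c J"
proof -
  have "sum r I = (\<Sum>i\<in>I. \<Sum>j\<in>J. int (M (i, j)))" "sum c J = (\<Sum>j\<in>J. \<Sum>i\<in>I. int (M (i, j)))"
    using assms by (simp_all add: margin_matrices_def)
  then show ?thesis by (simp add: sum.swap[of _ J I])
qed

lemma finite_margin_matrices:
  assumes "finite I" "finite J"
  shows "finite (margin_matrices I J r c)"
proof (rule finite_subset)
  let ?B = "nat (\<Sum>i\<in>I. \<bar>r i\<bar>)"
  show "margin_matrices I J r c \<subseteq> {M. M ` (I \<times> J) \<subseteq> {..?B} \<and> (\<forall>z. z \<notin> I \<times> J \<longrightarrow> M z = 0)}"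
  proof (clarsimp simp: margin_matrices_def)
    fix M :: "'a \<times> 'b \<Rightarrow> nat" and i j
    assume M: "\<forall>i\<in>I. (\<Sum>j\<in>J. int (M (i, j))) = r i" and ij: "i \<in> I" "j \<in> J"
    have "int (M (i, j)) \<le> (\<Sum>j\<in>J. int (M (i, j)))"
      using ij(2) assms(2) by (intro member_le_sum) auto
    also have "\<dots> = r i" using M ij by simp
    also have "\<dots> \<le> \<bar>r i\<bar>" by simp
    also have "\<dots> \<le> (\<Sum>i\<in>I. \<bar>r i\<bar>)" using ij(1) assms(1) by (intro member_le_sum) auto
    finally show "M (i, j) \<le> ?B" by simp
  qed
  show "finite {M. M ` (I \<times> J) \<subseteq> {..?B} \<and> (\<forall>z. z \<notin> I \<times> J \<longrightarrow> M z = 0)}"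
    using finite_set_of_finite_funs[of "I \<times> J" "{..?B}" 0] assms
    by (rule_tac finite_subset[rotated]) auto
qed

text \<open>For large \<open>k\<close> every matrix with margins \<open>(k + 1) * p + q\<close> and \<open>(k + 1) * c\<close> contains one with margins \<open>p\<close>
and \<open>c\<close>. Gale's criterion needs care only for cuts with \<open>p A > c T\<close>, and there the margins force the
capacity to be at least \<open>(k + 1) * (p A - c T) - |q A|\<close>. Hence the sets form a module over a monoid generated in
degree one, and their sizes are eventually polynomial. If the totals of \<open>p\<close> and \<open>c\<close> differ, the sets are empty
from some \<open>k\<close> on.\<close>

theorem eventually_poly_card_margin_matrices:
  fixes p q :: "'a \<Rightarrow> int" and c :: "'b \<Rightarrow> int"
  assumes fin: "finite I" "finite J"
  shows "eventually_poly (\<lambda>k. of_nat (card (margin_matrices I J (\<lambda>i. int k * p i + q i) (\<lambda>j. int k * c j))))"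
    (is "eventually_poly (\<lambda>k. of_nat (card (?E k)))")
proof (cases "sum p I = sum c J")
  case False
  have "?E k = {}" if k: "k \<ge> Suc (nat \<bar>sum q I\<bar>)" for k
  proof (rule ccontr)
    assume "?E k \<noteq> {}"
    then obtain M where "M \<in> ?E k" by blast
    then have "(\<Sum>i\<in>I. int k * p i + q i) = (\<Sum>j\<in>J. int k * c j)" by (rule margin_matrices_total)
    then have eq: "int k * (sum c J - sum p I) = sum q I"
      by (simp add: sum.distrib algebra_simps flip: sum_distrib_left)
    have "1 \<le> \<bar>sum c J - sum p I\<bar>" using False by linarith
    then have "int k \<le> int k * \<bar>sum c J - sum p I\<bar>" by (simp add: mult_le_cancel_left1)
    also have "\<dots> = \<bar>sum q I\<bar>" unfolding eq[symmetric] by (simp add: abs_mult)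
    finally show False using k by linarith
  qed
  then show ?thesis
    by (intro eventually_polyI[of "Suc (nat \<bar>sum q I\<bar>)" _ 0]) simp
next
  case True
  define S where "S = margin_matrices I J p c"
  \<comment> \<open>From here on the dilation outweighs the shift \<open>q\<close> on every set of rows.\<close>
  define k0 where "k0 = nat (\<Sum>i\<in>I. \<bar>q i\<bar>)"
  show ?thesis
  proof (rule eventually_poly_card_generated[of S ?E k0])
    show "finite S" unfolding S_def by (rule finite_margin_matrices[OF fin])
    show "finite (?E k0)" by (rule finite_margin_matrices[OF fin])
  next
    fix k e s assume e: "e \<in> ?E k" and s: "s \<in> S"
    then show "(\<lambda>z. e z + s z) \<in> ?E (Suc k)"
      by (simp add: S_def margin_matrices_def sum.distrib algebra_simps)
  next
    fix k e assume k: "k \<ge> k0" and e: "e \<in> ?E (Suc k)"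
    have rows: "(\<Sum>j\<in>J. int (e (i, j))) = int (Suc k) * p i + q i" if "i \<in> I" for i
      using e that by (simp add: margin_matrices_def)
    have cols: "(\<Sum>i\<in>I. int (e (i, j))) = int (Suc k) * c j" if "j \<in> J" for j
      using e that by (simp add: margin_matrices_def)
    have "sum p A \<le> sum c T + (\<Sum>z\<in>I \<times> J. of_bool (fst z \<in> A \<and> snd z \<notin> T) * int (e z))" (is "_ \<le> _ + ?cut")
      if A: "A \<subseteq> I" and T: "T \<subseteq> J" for A T
    proof -
      have finA: "finite A" "finite T" using A T fin finite_subset by blast+
      have cut_nonneg: "?cut \<ge> 0" by (intro sum_nonneg) simp
      have "(\<Sum>z\<in>I \<times> J. of_bool (fst z \<in> A) * int (e z)) = (\<Sum>i\<in>I. \<Sum>j\<in>J. of_bool (i \<in> A) * int (e (i, j)))"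
        by (simp add: sum.cartesian_product case_prod_unfold)
      also have "\<dots> = (\<Sum>i\<in>I. if i \<in> A then int (Suc k) * p i + q i else 0)"
        by (intro sum.cong) (simp_all add: rows of_bool_def)
      also have "\<dots> = int (Suc k) * sum p A + sum q A"
        using A fin(1) by (simp add: sum.inter_restrict[symmetric] Int_absorb1 sum.distrib sum_distrib_left del: of_nat_Suc)
      finally have row_part: "(\<Sum>z\<in>I \<times> J. of_bool (fst z \<in> A) * int (e z)) = int (Suc k) * sum p A + sum q A" .
      have "(\<Sum>z\<in>I \<times> J. of_bool (snd z \<in> T) * int (e z)) = (\<Sum>i\<in>I. \<Sum>j\<in>J. of_bool (j \<in> T) * int (e (i, j)))"
        by (simp add: sum.cartesian_product case_prod_unfold)
      also have "\<dots> = (\<Sum>j\<in>J. \<Sum>i\<in>I. of_bool (j \<in> T) * int (e (i, j)))" by (rule sum.swap)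
      also have "\<dots> = (\<Sum>j\<in>J. if j \<in> T then int (Suc k) * c j else 0)"
        by (intro sum.cong) (simp_all add: cols of_bool_def)
      also have "\<dots> = int (Suc k) * sum c T"
        using T fin(2) by (simp add: sum.inter_restrict[symmetric] Int_absorb1 sum_distrib_left del: of_nat_Suc)
      finally have col_part: "(\<Sum>z\<in>I \<times> J. of_bool (snd z \<in> T) * int (e z)) = int (Suc k) * sum c T" .
      have "(\<Sum>z\<in>I \<times> J. of_bool (fst z \<in> A) * int (e z))
          \<le> (\<Sum>z\<in>I \<times> J. of_bool (snd z \<in> T) * int (e z) + of_bool (fst z \<in> A \<and> snd z \<notin> T) * int (e z))"
        by (rule sum_mono) (auto simp: of_bool_def)
      then have "int (Suc k) * sum p A + sum q A \<le> int (Suc k) * sum c T + ?cut"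
        unfolding sum.distrib row_part col_part .
      then have bound: "int (Suc k) * (sum p A - sum c T) + sum q A \<le> ?cut"
        by (simp add: right_diff_distrib)
      show ?thesis
      proof (cases "sum p A \<le> sum c T")
        case True then show ?thesis using cut_nonneg by linarith
      next
        case False
        then have "1 \<le> sum p A - sum c T" by linarith
        then have diff: "int k \<le> int k * (sum p A - sum c T)" by (simp add: mult_le_cancel_left1)
        have "\<bar>sum q A\<bar> \<le> (\<Sum>i\<in>A. \<bar>q i\<bar>)" by (rule sum_abs)
        also have "\<dots> \<le> (\<Sum>i\<in>I. \<bar>q i\<bar>)" using A fin by (intro sum_mono2) auto
        also have "\<dots> = int k0" unfolding k0_def by (simp add: sum_nonneg)
        also have "\<dots> \<le> int k" using k by simp
        also have "\<dots> \<le> int k * (sum p A - sum c T)" by (rule diff)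
        finally have "\<bar>sum q A\<bar> \<le> int k * (sum p A - sum c T)" .
        moreover have "int (Suc k) * (sum p A - sum c T) = int k * (sum p A - sum c T) + (sum p A - sum c T)"
          by (simp add: algebra_simps)
        ultimately show ?thesis using bound by linarith
      qed
    qed
    then have "\<exists>s. (\<forall>z. s z \<le> e z) \<and> (\<forall>z. z \<notin> I \<times> J \<longrightarrow> s z = 0) \<and>
      (\<forall>i\<in>I. (\<Sum>j\<in>J. int (s (i, j))) = p i) \<and> (\<forall>j\<in>J. (\<Sum>i\<in>I. int (s (i, j))) = c j)"
      by (intro gale_supply_demand[OF fin _ True])
    then obtain s where s: "\<forall>z. s z \<le> e z" "\<forall>z. z \<notin> I \<times> J \<longrightarrow> s z = 0"
      "\<forall>i\<in>I. (\<Sum>j\<in>J. int (s (i, j))) = p i" "\<forall>j\<in>J. (\<Sum>i\<in>I. int (s (i, j))) = c j"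
      by (elim exE conjE)
    have "s \<in> S" using s by (simp add: S_def margin_matrices_def)
    moreover have "(\<lambda>z. e z - s z) \<in> ?E k"
      using e s by (simp add: margin_matrices_def of_nat_diff sum_subtractf algebra_simps)
    moreover have "e = (\<lambda>z. (e z - s z) + s z)" using s(1) by (simp add: fun_eq_iff)
    ultimately show "\<exists>e'\<in>?E k. \<exists>s\<in>S. e = (\<lambda>z. e' z + s z)"
      by (intro bexI[of _ "\<lambda>z. e z - s z"] bexI[of _ s])
  qed
qed

section \<open>Free and strict steps on a circle\<close>

text \<open>Read as positions of particles on a circle of length \<open>L\<close>, lifted to the line: \<open>y\<close> particles, repeated with
decreasing positions for increasing index.\<close>

definition quasi_periodic :: "int \<Rightarrow> int \<Rightarrow> (int \<Rightarrow> int) set" where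
  "quasi_periodic y L = {Q. \<forall>j. Q (j + y) = Q j - L}"

lemma quasi_periodic_shift:
  assumes "Q \<in> quasi_periodic y L"
  shows "Q (j + m * y) = Q j - m * L"
proof (induction m rule: int_induct[where k = 0])
  case base then show ?case by simp
next
  case (step1 m)
  have "Q (j + (m + 1) * y) = Q ((j + m * y) + y)" by (simp add: algebra_simps)
  also have "\<dots> = Q (j + m * y) - L" using assms by (simp add: quasi_periodic_def)
  finally show ?case using step1 by (simp add: algebra_simps)
next
  case (step2 m)
  have "Q (j + m * y) = Q ((j + (m - 1) * y) + y)" by (simp add: algebra_simps)
  also have "\<dots> = Q (j + (m - 1) * y) - L" using assms by (simp add: quasi_periodic_def)
  finally show ?case using step2 by (simp add: algebra_simps)
qed

lemma quasi_periodic_mod: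
  assumes "Q \<in> quasi_periodic y L"
  shows "Q j = Q (j mod y) - (j div y) * L"
  using quasi_periodic_shift[OF assms, of "j mod y" "j div y"] by simp

lemma quasi_periodic_eqI:
  assumes "Q \<in> quasi_periodic y L" "R \<in> quasi_periodic y L" "y > 0"
    and "\<And>j. j \<in> {0..<y} \<Longrightarrow> Q j = R j"
  shows "Q = R"
proof
  fix j
  have "Q (j mod y) = R (j mod y)" using assms(3) by (intro assms(4)) simp
  then show "Q j = R j"
    by (simp add: quasi_periodic_mod[OF assms(1), of j] quasi_periodic_mod[OF assms(2), of j])
qed

definition free_step :: "int \<Rightarrow> int \<Rightarrow> int \<Rightarrow> (int \<Rightarrow> int) \<Rightarrow> (int \<Rightarrow> int) set" where
  "free_step y L b P =
     {Q \<in> quasi_periodic y L. (\<forall>j. P j \<le> Q j) \<and> (\<Sum>j\<in>{0..<y}. Q j - P j) = b}"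

text \<open>No particle reaches the old position of the particle ahead of it; in particular the order of the
particles is preserved.\<close>

definition strict_step :: "int \<Rightarrow> int \<Rightarrow> int \<Rightarrow> (int \<Rightarrow> int) \<Rightarrow> (int \<Rightarrow> int) set" where
  "strict_step y L b P = {Q \<in> free_step y L b P. \<forall>j. Q j < P (j - 1)}"

lemma finite_free_step:
  assumes "y > 0"
  shows "finite (free_step y L b P)"
proof (rule finite_imageD)
  have bound: "Q j \<le> P j + b" if Q: "Q \<in> free_step y L b P" and j: "j \<in> {0..<y}" for Q j
  proof -
    have "Q j - P j \<le> (\<Sum>j\<in>{0..<y}. Q j - P j)"
      using Q j by (intro member_le_sum) (auto simp: free_step_def)
    then show ?thesis using Q by (simp add: free_step_def)
  qed
  show "finite ((\<lambda>Q. restrict Q {0..<y}) ` free_step y L b P)"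
  proof (rule finite_subset)
    show "(\<lambda>Q. restrict Q {0..<y}) ` free_step y L b P \<subseteq> (\<Pi>\<^sub>E j\<in>{0..<y}. {P j..P j + b})"
    proof
      fix f assume "f \<in> (\<lambda>Q. restrict Q {0..<y}) ` free_step y L b P"
      then obtain Q where Q: "Q \<in> free_step y L b P" "f = restrict Q {0..<y}" by auto
      then show "f \<in> (\<Pi>\<^sub>E j\<in>{0..<y}. {P j..P j + b})"
        using bound by (auto simp: free_step_def)
    qed
  qed (auto intro: finite_PiE)
  show "inj_on (\<lambda>Q. restrict Q {0..<y}) (free_step y L b P)"
  proof (rule inj_onI)
    fix Q R assume Q: "Q \<in> free_step y L b P" and R: "R \<in> free_step y L b P"
      and eq: "restrict Q {0..<y} = restrict R {0..<y}"
    show "Q = R"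
    proof (rule quasi_periodic_eqI[of _ y L])
      fix j assume "j \<in> {0..<y}"
      then show "Q j = R j" using fun_cong[OF eq, of j] by simp
    qed (use Q R assms in \<open>auto simp: free_step_def\<close>)
  qed
qed

lemma finite_strict_step: "y > 0 \<Longrightarrow> finite (strict_step y L b P)"
  by (rule finite_subset[OF _ finite_free_step]) (auto simp: strict_step_def)

text \<open>The simple reflections of the affine symmetric group of \<open>y\<close> letters: \<open>j\<close> and \<open>j - 1\<close> are interchanged,
simultaneously in all periods.\<close>

definition swap_adjacent :: "int \<Rightarrow> int \<Rightarrow> int \<Rightarrow> int" where
  "swap_adjacent y j i = (if y dvd i - j then i - 1 else if y dvd i - j + 1 then i + 1 else i)"

lemma not_dvd_two_consecutive:
  fixes y a :: int
  assumes "y \<ge> 2" "y dvd a" shows "\<not> y dvd a - 1" "\<not> y dvd a + 1"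
proof -
  have "\<not> y dvd 1" using assms(1) by auto
  then show "\<not> y dvd a - 1" "\<not> y dvd a + 1"
    using assms(2) by (metis dvd_diff_right_iff, metis dvd_add_right_iff)
qed

lemma swap_adjacent_involution:
  assumes "y \<ge> 2" shows "swap_adjacent y j (swap_adjacent y j i) = i"
proof -
  consider "y dvd i - j" | "\<not> y dvd i - j" "y dvd i - j + 1" | "\<not> y dvd i - j" "\<not> y dvd i - j + 1"
    by blast
  then show ?thesis
  proof cases
    case 1
    then have "\<not> y dvd (i - 1) - j" using not_dvd_two_consecutive(1)[OF assms, of "i - j"]
      by (simp add: algebra_simps)
    with 1 show ?thesis by (simp add: swap_adjacent_def)
  next
    case 2
    then have "y dvd (i + 1) - j" by (simp add: algebra_simps)
    with 2 show ?thesis by (simp add: swap_adjacent_def)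
  next
    case 3 then show ?thesis by (simp add: swap_adjacent_def)
  qed
qed

lemma swap_adjacent_shift: "swap_adjacent y j (i + y) = swap_adjacent y j i + y"
proof -
  have "y dvd (i + y) - j \<longleftrightarrow> y dvd i - j" "y dvd (i + y) - j + 1 \<longleftrightarrow> y dvd i - j + 1"
    by (metis add.commute add_diff_eq dvd_add_triv_left_iff)
      (metis add.assoc add.commute add_diff_eq dvd_add_triv_left_iff)
  then show ?thesis by (simp add: swap_adjacent_def)
qed

lemma quasi_periodic_swap:
  "Q \<in> quasi_periodic y L \<Longrightarrow> Q \<circ> swap_adjacent y j \<in> quasi_periodic y L"
  by (simp add: quasi_periodic_def swap_adjacent_shift)

lemma sum_residue:
  fixes f :: "int \<Rightarrow> int"
  assumes "y > 0"
  shows "(\<Sum>i\<in>{0..<y}. if y dvd i - a then f i else 0) = f (a mod y)"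
proof -
  have "y dvd i - a \<longleftrightarrow> i = a mod y" if "i \<in> {0..<y}" for i
    using that by (simp add: mod_eq_dvd_iff[symmetric])
  then have "(\<Sum>i\<in>{0..<y}. if y dvd i - a then f i else 0) = (\<Sum>i\<in>{0..<y}. if i = a mod y then f i else 0)"
    by (intro sum.cong) auto
  then show ?thesis using assms by simp
qed

lemma sum_swap_adjacent:
  assumes Q: "Q \<in> quasi_periodic y L" and "y \<ge> 2"
  shows "(\<Sum>i\<in>{0..<y}. Q (swap_adjacent y j i)) = (\<Sum>i\<in>{0..<y}. Q i)"
proof -
  define e where "e i = Q (i - 1) - Q i" for i
  have e_mod: "e i = e (i + m * y)" for i m
    using quasi_periodic_shift[OF Q, of i m] quasi_periodic_shift[OF Q, of "i - 1" m]
    by (simp add: e_def algebra_simps)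
  have "Q (swap_adjacent y j i) = Q i + (if y dvd i - j then e i else 0)
      - (if y dvd i - (j - 1) then e (i + 1) else 0)" for i
    using not_dvd_two_consecutive(2)[OF assms(2), of "i - j"]
    by (auto simp: swap_adjacent_def e_def algebra_simps)
  then have "(\<Sum>i\<in>{0..<y}. Q (swap_adjacent y j i)) =
      (\<Sum>i\<in>{0..<y}. Q i) + e (j mod y) - e ((j - 1) mod y + 1)"
    using assms(2) by (simp add: sum.distrib sum_subtractf sum_residue[of y j e]
      sum_residue[of y "j - 1" "\<lambda>i. e (i + 1)"])
  moreover have "e (j mod y) = e j" using e_mod[of "j mod y" "j div y"] by simp
  moreover have "e ((j - 1) mod y + 1) = e j"
  proof -
    have "(j - 1) mod y + 1 + (j - 1) div y * y = j"
      using mod_div_mult_eq[of "j - 1" y] by linarith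
    then show ?thesis using e_mod[of "(j - 1) mod y + 1" "(j - 1) div y"] by simp
  qed
  ultimately show ?thesis by simp
qed

text \<open>For a single particle (\<open>y = 1\<close>) the residues of \<open>j\<close> and \<open>j - 1\<close> coincide and there is no reflection.\<close>

definition alternating :: "int \<Rightarrow> int \<Rightarrow> ((int \<Rightarrow> int) \<Rightarrow> int) \<Rightarrow> bool" where
  "alternating y L \<Phi> \<longleftrightarrow>
     (y \<ge> 2 \<longrightarrow> (\<forall>Q\<in>quasi_periodic y L. \<forall>j. \<Phi> (Q \<circ> swap_adjacent y j) = - \<Phi> Q))"

lemma alternating_free_step_sum:
  assumes alt: "alternating y L \<Phi>"
  shows "alternating y L (\<lambda>P. \<Sum>Q\<in>free_step y L b P. \<Phi> Q)"
  unfolding alternating_def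
proof (intro impI ballI allI)
  fix P j assume y: "y \<ge> 2" and P: "P \<in> quasi_periodic y L"
  let ?s = "swap_adjacent y j"
  have ss: "?s (?s i) = i" for i by (rule swap_adjacent_involution[OF y])
  have sw: "Q \<circ> ?s \<in> free_step y L b (P \<circ> ?s)" if "Q \<in> free_step y L b P" "P \<in> quasi_periodic y L" for P Q
  proof -
    have Q: "Q \<in> quasi_periodic y L" using that by (simp add: free_step_def)
    show ?thesis using that quasi_periodic_swap[OF Q, of j]
      by (simp add: free_step_def sum_subtractf sum_swap_adjacent[OF Q y] sum_swap_adjacent[OF that(2) y])
  qed
  have Pss: "(P \<circ> ?s) \<circ> ?s = P" by (simp add: fun_eq_iff ss)
  have "(\<Sum>Q\<in>free_step y L b (P \<circ> ?s). \<Phi> Q) = (\<Sum>Q\<in>free_step y L b P. \<Phi> (Q \<circ> ?s))"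
  proof (rule sum.reindex_bij_witness[of _ "\<lambda>Q. Q \<circ> ?s" "\<lambda>Q. Q \<circ> ?s"])
    fix Q assume "Q \<in> free_step y L b (P \<circ> ?s)"
    from sw[OF this quasi_periodic_swap[OF P]] show "Q \<circ> ?s \<in> free_step y L b P"
      by (simp only: Pss)
  next
    fix Q assume "Q \<in> free_step y L b P"
    from sw[OF this P] show "Q \<circ> ?s \<in> free_step y L b (P \<circ> ?s)" .
  qed (simp_all add: fun_eq_iff ss comp_def)
  also have "\<dots> = (\<Sum>Q\<in>free_step y L b P. - \<Phi> Q)"
    using alt y by (intro sum.cong refl) (simp add: alternating_def free_step_def)
  finally show "(\<Sum>Q\<in>free_step y L b (P \<circ> ?s). \<Phi> Q) = - (\<Sum>Q\<in>free_step y L b P. \<Phi> Q)"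
    by (simp add: sum_negf)
qed

definition overtaking :: "int \<Rightarrow> (int \<Rightarrow> int) \<Rightarrow> (int \<Rightarrow> int) \<Rightarrow> int set" where
  "overtaking y P Q = {j \<in> {0..<y}. P (j - 1) \<le> Q j}"

lemma free_step_overtaking_iff:
  assumes P: "P \<in> quasi_periodic y L" and Q: "Q \<in> quasi_periodic y L" and "y > 0"
  shows "P (j - 1) \<le> Q j \<longleftrightarrow> j mod y \<in> overtaking y P Q"
proof -
  have pred: "j - 1 = (j mod y - 1) + (j div y) * y" using mod_div_mult_eq[of j y] by linarith
  have "P (j - 1) = P (j mod y - 1) - (j div y) * L"
    by (subst pred) (rule quasi_periodic_shift[OF P])
  moreover have "Q j = Q (j mod y) - (j div y) * L" by (rule quasi_periodic_mod[OF Q])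
  ultimately show ?thesis using assms(3) by (simp add: overtaking_def)
qed

lemma exists_boundary_residue:
  assumes "U \<subseteq> {0..<y}" "U \<noteq> {}" "U \<noteq> {0..<y}" "(y::int) > 0"
  obtains j where "j \<in> U" "(j - 1) mod y \<notin> U"
proof -
  have "\<exists>j\<in>U. (j - 1) mod y \<notin> U"
  proof (rule ccontr)
    assume "\<not> ?thesis"
    then have pred: "\<And>j. j \<in> U \<Longrightarrow> (j - 1) mod y \<in> U" by blast
    obtain u where u: "u \<in> U" using assms(2) by blast
    have all: "(u - int m) mod y \<in> U" for m
    proof (induction m)
      case 0 then show ?case using u assms(1) by auto
    next
      case (Suc m)
      have "((u - int m) mod y - 1) mod y = (u - int (Suc m)) mod y"
        by (simp add: mod_diff_left_eq algebra_simps)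
      then show ?case using pred[OF Suc] by simp
    qed
    have "t \<in> U" if t: "t \<in> {0..<y}" for t
    proof -
      have "(u - int (nat ((u - t) mod y))) mod y = t"
        using t assms(4) by (simp add: mod_diff_right_eq)
      then show ?thesis using all[of "nat ((u - t) mod y)"] by simp
    qed
    then show False using assms(1,3) by blast
  qed
  then show ?thesis using that by blast
qed

text \<open>If \<open>j\<close> overtakes \<open>j - 1\<close>, both particles end at or beyond the old position of \<open>j - 1\<close>. Exchanging their final
positions keeps the step free, keeps \<open>j\<close> overtaking and changes no other status except possibly that of
\<open>j - 1\<close>. This is a sign-reversing involution on the steps whose overtaking set is \<open>U\<close>, with or without
\<open>j - 1\<close>.\<close>

lemma free_step_sum_cancel:
  assumes alt: "alternating y L \<Phi>" and y: "y \<ge> 2"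
    and P: "P \<in> quasi_periodic y L" and dec: "\<And>j. P j < P (j - 1)"
    and U: "U \<subseteq> {0..<y}" and j: "j \<in> U" and j': "(j - 1) mod y \<notin> U"
  shows "(\<Sum>Q | Q \<in> free_step y L b P \<and> overtaking y P Q = U. \<Phi> Q)
       + (\<Sum>Q | Q \<in> free_step y L b P \<and> overtaking y P Q = insert ((j - 1) mod y) U. \<Phi> Q) = 0"
proof -
  let ?s = "swap_adjacent y j" and ?j' = "(j - 1) mod y"
  define H where "H = {Q \<in> free_step y L b P. overtaking y P Q = U \<or> overtaking y P Q = insert ?j' U}"
  have y0: "y > 0" using y by simp
  have ss: "?s (?s i) = i" for i by (rule swap_adjacent_involution[OF y])
  have j_range: "j \<in> {0..<y}" using U j by blast
  have H_swap: "Q \<circ> ?s \<in> H" if "Q \<in> H" for Q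
  proof -
    have free: "Q \<in> free_step y L b P" and over: "overtaking y P Q = U \<or> overtaking y P Q = insert ?j' U"
      using that by (auto simp: H_def)
    have Q: "Q \<in> quasi_periodic y L" and ge: "\<And>i. P i \<le> Q i" using free by (auto simp: free_step_def)
    have over_iff: "P (i - 1) \<le> Q i \<longleftrightarrow> i mod y \<in> overtaking y P Q" for i
      by (rule free_step_overtaking_iff[OF P Q y0])
    have at_j: "P (i - 1) \<le> Q i" if "y dvd i - j" for i
    proof -
      have "i mod y = j mod y" using that by (simp add: mod_eq_dvd_iff)
      then have "i mod y = j" using j_range by simp
      then show ?thesis using over j by (auto simp: over_iff)
    qed
    have "P i \<le> Q (?s i)" for i
    proof -
      have "P i \<le> Q (i - 1)" using ge[of "i - 1"] dec[of i] by linarith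
      moreover have "P i \<le> Q (i + 1)" if "y dvd i - j + 1"
        using at_j[of "i + 1"] that by (simp add: algebra_simps)
      ultimately show ?thesis using ge[of i] by (simp add: swap_adjacent_def)
    qed
    then have free': "Q \<circ> ?s \<in> free_step y L b P"
      using free quasi_periodic_swap[OF Q, of j] sum_swap_adjacent[OF Q y, of j]
      by (simp add: free_step_def sum_subtractf)
    have "i \<in> overtaking y P (Q \<circ> ?s) \<longleftrightarrow> i \<in> overtaking y P Q" if "i \<noteq> ?j'" for i
    proof (cases "i \<in> {0..<y}")
      case True
      have "\<not> y dvd i - j + 1"
      proof
        assume "y dvd i - j + 1"
        then have "y dvd i - (j - 1)" by (simp add: algebra_simps)
        then have "i mod y = ?j'" by (simp add: mod_eq_dvd_iff)
        then show False using True that by simp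
      qed
      moreover have "P (i - 1) \<le> Q (i - 1)" by (rule ge)
      ultimately show ?thesis using True at_j[of i]
        by (simp add: overtaking_def swap_adjacent_def)
    qed (auto simp: overtaking_def)
    then have "overtaking y P (Q \<circ> ?s) - {?j'} = U - {?j'}" using over by blast
    then have "overtaking y P (Q \<circ> ?s) = U \<or> overtaking y P (Q \<circ> ?s) = insert ?j' U"
      using j' by blast
    then show ?thesis using free' by (simp add: H_def)
  qed
  have "(\<Sum>Q\<in>H. \<Phi> Q) = (\<Sum>Q\<in>H. \<Phi> (Q \<circ> ?s))"
    by (rule sum.reindex_bij_witness[of _ "\<lambda>Q. Q \<circ> ?s" "\<lambda>Q. Q \<circ> ?s"])
      (simp_all add: H_swap[unfolded comp_def] fun_eq_iff ss comp_def)
  also have "\<dots> = (\<Sum>Q\<in>H. - \<Phi> Q)"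
    using alt y by (intro sum.cong refl) (simp add: alternating_def free_step_def H_def)
  finally have "(\<Sum>Q\<in>H. \<Phi> Q) = 0" by (simp add: sum_negf)
  moreover have "H = {Q. Q \<in> free_step y L b P \<and> overtaking y P Q = U}
      \<union> {Q. Q \<in> free_step y L b P \<and> overtaking y P Q = insert ?j' U}" unfolding H_def by blast
  moreover have "(\<Sum>Q\<in>{Q. Q \<in> free_step y L b P \<and> overtaking y P Q = U}
      \<union> {Q. Q \<in> free_step y L b P \<and> overtaking y P Q = insert ?j' U}. \<Phi> Q)
    = (\<Sum>Q | Q \<in> free_step y L b P \<and> overtaking y P Q = U. \<Phi> Q)
       + (\<Sum>Q | Q \<in> free_step y L b P \<and> overtaking y P Q = insert ?j' U. \<Phi> Q)"
    using finite_free_step[OF y0, of L b P] j' by (intro sum.union_disjoint) auto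
  ultimately show ?thesis by simp
qed

lemma sum_pred_quasi_periodic:
  assumes "P \<in> quasi_periodic y L" "y > 0"
  shows "(\<Sum>j\<in>{0..<y}. P (j - 1)) = (\<Sum>j\<in>{0..<y}. P j) + L"
proof -
  have "(\<Sum>j\<in>{0..<y}. P (j - 1)) = (\<Sum>j\<in>{-1..<y - 1}. P j)"
    by (rule sum.reindex_bij_witness[of _ "\<lambda>j. j + 1" "\<lambda>j. j - 1"]) auto
  also have "{-1..<y - 1} = insert (- 1) {0..<y - 1}" using assms(2) by auto
  also have "(\<Sum>j\<in>insert (- 1) {0..<y - 1}. P j) = P (- 1) + (\<Sum>j\<in>{0..<y - 1}. P j)" by simp
  also have "P (- 1) = P (y - 1) + L"
    using assms(1) quasi_periodic_shift[OF assms(1), of "-1" 1] by simp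
  also have "P (y - 1) + L + (\<Sum>j\<in>{0..<y - 1}. P j) = (\<Sum>j\<in>insert (y - 1) {0..<y - 1}. P j) + L" by simp
  also have "insert (y - 1) {0..<y - 1} = {0..<y}" using assms(2) by auto
  finally show ?thesis .
qed

text \<open>By the cancellation, the part with overtaking set \<open>U\<close> changes only its sign when the predecessor of an
element is added to \<open>U\<close>. Going around the circle, every nonempty \<open>U\<close> grows to the full set. For the full set
the part is empty, because all particles would together move by at least \<open>L\<close>, while the step moves them by
\<open>b < L\<close>. What remains is the part of the empty set, the strict steps.\<close>

lemma alternating_free_step_eq_strict_step:
  assumes alt: "alternating y L \<Phi>" and y: "y > 0" and b: "b < L"
    and P: "P \<in> quasi_periodic y L" and dec: "\<And>j. P j < P (j - 1)"
  shows "(\<Sum>Q\<in>free_step y L b P. \<Phi> Q) = (\<Sum>Q\<in>strict_step y L b P. \<Phi> Q)"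
proof -
  let ?F = "free_step y L b P"
  define S where "S U = (\<Sum>Q | Q \<in> ?F \<and> overtaking y P Q = U. \<Phi> Q)" for U
  have fin: "finite ?F" by (rule finite_free_step[OF y])
  have S0: "S U = 0" if "U \<subseteq> {0..<y}" "U \<noteq> {}" for U
    using that
  proof (induction "card ({0..<y} - U)" arbitrary: U rule: less_induct)
    case less
    show ?case
    proof (cases "U = {0..<y}")
      case True
      have empty: "{Q. Q \<in> ?F \<and> overtaking y P Q = U} = {}"
      proof (rule ccontr)
        assume "{Q. Q \<in> ?F \<and> overtaking y P Q = U} \<noteq> {}"
        then obtain Q where Q: "Q \<in> ?F" "overtaking y P Q = {0..<y}" using True by blast
        have "P (j - 1) \<le> Q j" if "j \<in> {0..<y}" for j
          using Q(2) that unfolding overtaking_def by blast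
        then have "(\<Sum>j\<in>{0..<y}. P (j - 1)) \<le> (\<Sum>j\<in>{0..<y}. Q j)" by (intro sum_mono) auto
        moreover have "(\<Sum>j\<in>{0..<y}. Q j) - (\<Sum>j\<in>{0..<y}. P j) = b"
          using Q(1) by (simp add: free_step_def sum_subtractf)
        ultimately show False using b sum_pred_quasi_periodic[OF P y] by linarith
      qed
      show ?thesis unfolding S_def empty by simp
    next
      case False
      obtain j where j: "j \<in> U" "(j - 1) mod y \<notin> U"
        using exists_boundary_residue[OF less.prems False y] by blast
      have "(j - 1) mod y \<noteq> j" using j by auto
      then have "y \<noteq> 1" using less.prems(1) j(1) by auto
      then have y2: "y \<ge> 2" using y by simp
      have range: "(j - 1) mod y \<in> {0..<y}" using y by simp
      have "{0..<y} - insert ((j - 1) mod y) U \<subset> {0..<y} - U" using range j(2) by blast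
      then have "card ({0..<y} - insert ((j - 1) mod y) U) < card ({0..<y} - U)"
        by (intro psubset_card_mono) auto
      then have "S (insert ((j - 1) mod y) U) = 0"
        using less.prems range by (intro less.hyps) auto
      then show ?thesis
        using free_step_sum_cancel[OF alt y2 P dec less.prems(1) j, of b] by (simp add: S_def)
    qed
  qed
  have "(\<Sum>Q\<in>?F. \<Phi> Q) = (\<Sum>U\<in>Pow {0..<y}. \<Sum>Q | Q \<in> ?F \<and> overtaking y P Q = U. \<Phi> Q)"
    by (rule sum.group[symmetric]) (auto simp: fin overtaking_def)
  also have "\<dots> = (\<Sum>U\<in>Pow {0..<y}. S U)" by (simp add: S_def)
  also have "\<dots> = (\<Sum>U\<in>{{}}. S U)" by (rule sum.mono_neutral_right) (auto simp: S0)
  also have "\<dots> = S {}" by simp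
  also have "{Q. Q \<in> ?F \<and> overtaking y P Q = {}} = strict_step y L b P"
  proof (intro set_eqI iffI)
    fix Q assume Q: "Q \<in> {Q. Q \<in> ?F \<and> overtaking y P Q = {}}"
    then have "Q \<in> quasi_periodic y L" by (simp add: free_step_def)
    then have "\<not> P (j - 1) \<le> Q j" for j
      using free_step_overtaking_iff[OF P _ y, of Q j] Q by simp
    then show "Q \<in> strict_step y L b P" using Q by (simp add: strict_step_def not_le)
  next
    fix Q assume "Q \<in> strict_step y L b P"
    then show "Q \<in> {Q. Q \<in> ?F \<and> overtaking y P Q = {}}"
      by (auto simp: strict_step_def overtaking_def not_le)
  qed
  then have "S {} = (\<Sum>Q\<in>strict_step y L b P. \<Phi> Q)" by (simp add: S_def)
  finally show ?thesis .
qed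

section \<open>A Jacobi-Trudi formula on the cylinder\<close>

text \<open>The states after time \<open>n\<close> are fixed so that walks of length \<open>n\<close> are counted once.\<close>

definition walks :: "(nat \<Rightarrow> (int \<Rightarrow> int) \<Rightarrow> (int \<Rightarrow> int) set) \<Rightarrow> nat \<Rightarrow> (int \<Rightarrow> int) \<Rightarrow> (nat \<Rightarrow> int \<Rightarrow> int) set" where
  "walks St n P = {G. G 0 = P \<and> (\<forall>i<n. G (Suc i) \<in> St i (G i)) \<and> (\<forall>i>n. G i = (\<lambda>_. 0))}"

lemma walks_Suc_bij:
  "bij_betw (\<lambda>(G, Q). G(Suc n := Q)) (SIGMA G:walks St n P. St n (G n)) (walks St (Suc n) P)"
proof (rule bij_betw_byWitness[where f' = "\<lambda>G. (G(Suc n := (\<lambda>_. 0)), G (Suc n))"])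
  show "\<forall>p \<in> (SIGMA G:walks St n P. St n (G n)).
    ((case p of (G, Q) \<Rightarrow> G(Suc n := Q))(Suc n := (\<lambda>_. 0)), (case p of (G, Q) \<Rightarrow> G(Suc n := Q)) (Suc n)) = p"
    by (auto simp: walks_def fun_eq_iff)
  show "\<forall>G \<in> walks St (Suc n) P.
    (case (G(Suc n := (\<lambda>_. 0)), G (Suc n)) of (G, Q) \<Rightarrow> G(Suc n := Q)) = G"
    by (auto simp: fun_eq_iff)
  show "(\<lambda>(G, Q). G(Suc n := Q)) ` (SIGMA G:walks St n P. St n (G n)) \<subseteq> walks St (Suc n) P"
    by (auto simp: walks_def less_Suc_eq)
  show "(\<lambda>G. (G(Suc n := (\<lambda>_. 0)), G (Suc n))) ` walks St (Suc n) P \<subseteq> (SIGMA G:walks St n P. St n (G n))"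
  proof
    fix p assume "p \<in> (\<lambda>G. (G(Suc n := (\<lambda>_. 0)), G (Suc n))) ` walks St (Suc n) P"
    then obtain G where G: "G \<in> walks St (Suc n) P" and p: "p = (G(Suc n := (\<lambda>_. 0)), G (Suc n))" by blast
    have "(G(Suc n := (\<lambda>_. 0))) i = (\<lambda>_. 0)" if "i > n" for i
      using G that by (cases "i = Suc n") (simp_all add: walks_def)
    then have "G(Suc n := (\<lambda>_. 0)) \<in> walks St n P" using G by (simp add: walks_def)
    moreover have "G (Suc n) \<in> St n (G n)" using G by (simp add: walks_def)
    ultimately show "p \<in> (SIGMA G:walks St n P. St n (G n))" by (simp add: p)
  qed
qed

lemma walks_0: "walks St 0 P = {\<lambda>i. if i = 0 then P else (\<lambda>_. 0)}"
  by (auto simp: walks_def fun_eq_iff)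

lemma finite_walks:
  assumes "\<And>i Q. finite (St i Q)"
  shows "finite (walks St n P)"
proof (induction n)
  case (Suc n)
  have "finite (SIGMA G:walks St n P. St n (G n))" using Suc assms by (intro finite_SigmaI)
  then show ?case using bij_betw_finite[OF walks_Suc_bij] by blast
qed (simp add: walks_0)

lemma sum_walks_Suc:
  fixes f :: "(int \<Rightarrow> int) \<Rightarrow> int"
  assumes "\<And>i Q. finite (St i Q)"
  shows "(\<Sum>G\<in>walks St (Suc n) P. f (G (Suc n))) = (\<Sum>G\<in>walks St n P. \<Sum>Q\<in>St n (G n). f Q)"
proof -
  have "(\<Sum>G\<in>walks St (Suc n) P. f (G (Suc n)))
      = (\<Sum>p\<in>(SIGMA G:walks St n P. St n (G n)). f (snd p))"
    using sum.reindex_bij_betw[OF walks_Suc_bij, of "\<lambda>G. f (G (Suc n))" n St P]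
    by (simp add: case_prod_unfold)
  also have "\<dots> = (\<Sum>G\<in>walks St n P. \<Sum>Q\<in>St n (G n). f Q)"
    using finite_walks[of St n P, OF assms] assms by (simp add: sum.Sigma case_prod_unfold)
  finally show ?thesis .
qed

lemma strict_walk_state:
  assumes G: "G \<in> walks (\<lambda>i. strict_step y L (\<beta> i)) n P" and P: "P \<in> quasi_periodic y L"
    and dec: "\<And>j. P j < P (j - 1)" and i: "i \<le> n"
  shows "G i \<in> quasi_periodic y L \<and> (\<forall>j. G i j < G i (j - 1))
    \<and> (\<Sum>j\<in>{0..<y}. G i j) = (\<Sum>j\<in>{0..<y}. P j) + (\<Sum>l<i. \<beta> l)"
  using i
proof (induction i)
  case 0 then show ?case using G P dec by (simp add: walks_def)
next
  case (Suc i)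
  have step: "G (Suc i) \<in> strict_step y L (\<beta> i) (G i)" using G Suc.prems by (simp add: walks_def)
  have "G (Suc i) j < G (Suc i) (j - 1)" for j
    using step by (auto simp: strict_step_def free_step_def intro: less_le_trans)
  then show ?case using step Suc by (simp add: strict_step_def free_step_def sum_subtractf)
qed

lemma alternating_strict_walks:
  assumes y: "y > 0" and P: "P \<in> quasi_periodic y L" and dec: "\<And>j. P j < P (j - 1)"
    and \<beta>: "\<And>i. i < n \<Longrightarrow> \<beta> i < L" and alt: "alternating y L \<Phi>"
  shows "(\<Sum>G\<in>walks (\<lambda>i. strict_step y L (\<beta> i)) n P. \<Phi> (G n))
       = (\<Sum>G\<in>walks (\<lambda>i. free_step y L (\<beta> i)) n P. \<Phi> (G n))"
  using \<beta> alt
proof (induction n arbitrary: \<Phi>)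
  case 0 then show ?case by (simp add: walks_0)
next
  case (Suc n)
  have "(\<Sum>G\<in>walks (\<lambda>i. strict_step y L (\<beta> i)) (Suc n) P. \<Phi> (G (Suc n)))
      = (\<Sum>G\<in>walks (\<lambda>i. strict_step y L (\<beta> i)) n P. \<Sum>Q\<in>strict_step y L (\<beta> n) (G n). \<Phi> Q)"
    by (rule sum_walks_Suc) (rule finite_strict_step[OF y])
  also have "\<dots> = (\<Sum>G\<in>walks (\<lambda>i. strict_step y L (\<beta> i)) n P. \<Sum>Q\<in>free_step y L (\<beta> n) (G n). \<Phi> Q)"
  proof (rule sum.cong[OF refl])
    fix G assume G: "G \<in> walks (\<lambda>i. strict_step y L (\<beta> i)) n P"
    note state = strict_walk_state[OF G P dec order_refl]
    show "(\<Sum>Q\<in>strict_step y L (\<beta> n) (G n). \<Phi> Q) = (\<Sum>Q\<in>free_step y L (\<beta> n) (G n). \<Phi> Q)"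
      using state Suc.prems
      by (intro alternating_free_step_eq_strict_step[symmetric] y) simp_all
  qed
  also have "\<dots> = (\<Sum>G\<in>walks (\<lambda>i. free_step y L (\<beta> i)) n P. \<Sum>Q\<in>free_step y L (\<beta> n) (G n). \<Phi> Q)"
    using Suc.prems by (intro Suc.IH alternating_free_step_sum) simp_all
  also have "\<dots> = (\<Sum>G\<in>walks (\<lambda>i. free_step y L (\<beta> i)) (Suc n) P. \<Phi> (G (Suc n)))"
    by (rule sum_walks_Suc[symmetric]) (rule finite_free_step[OF y])
  finally show ?case .
qed

definition matches_mod :: "int \<Rightarrow> int \<Rightarrow> (int \<Rightarrow> int) \<Rightarrow> (int \<Rightarrow> int) \<Rightarrow> (int \<Rightarrow> int) \<Rightarrow> bool" where
  "matches_mod y L R p Q \<longleftrightarrow> (\<forall>i\<in>{0..<y}. L dvd Q i - R (p i))"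

text \<open>On sequences with the same sum over a period as \<open>R\<close>, this is the antisymmetrisation of the indicator of
\<open>R\<close> under the affine symmetric group: such a sequence lies in the orbit of \<open>R\<close> iff its residues modulo \<open>L\<close>
are those of \<open>R\<close> up to a permutation of a period, and translations have sign one.\<close>

definition signed_match :: "int \<Rightarrow> int \<Rightarrow> (int \<Rightarrow> int) \<Rightarrow> (int \<Rightarrow> int) \<Rightarrow> int" where
  "signed_match y L R Q = (\<Sum>p | p permutes {0..<y}. sign p * of_bool (matches_mod y L R p Q))"

lemma swap_adjacent_transpose:
  assumes "i \<in> {0..<y}" "y > 0"
  shows "\<exists>m. swap_adjacent y j i = transpose (j mod y) ((j - 1) mod y) i + m * y"
proof -
  have mod: "a = a mod y + (a div y) * y" for a by simp
  consider "y dvd i - j" | "\<not> y dvd i - j" "y dvd i - (j - 1)" | "\<not> y dvd i - j" "\<not> y dvd i - (j - 1)"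
    by blast
  then show ?thesis
  proof cases
    case 1
    then have i: "i = j mod y" using assms by (simp add: mod_eq_dvd_iff[symmetric])
    have "i - 1 = (i - 1) mod y + ((i - 1) div y) * y" by simp
    moreover have "(i - 1) mod y = (j - 1) mod y" unfolding i by (simp add: mod_diff_left_eq)
    moreover have "transpose (j mod y) ((j - 1) mod y) i = (j - 1) mod y" unfolding i by simp
    moreover have "swap_adjacent y j i = i - 1" using 1 by (simp add: swap_adjacent_def)
    ultimately show ?thesis by metis
  next
    case 2
    then have i: "i = (j - 1) mod y" using assms by (simp add: mod_eq_dvd_iff[symmetric])
    have "i + 1 = (i + 1) mod y + ((i + 1) div y) * y" by simp
    moreover have "(i + 1) mod y = j mod y" unfolding i by (simp add: mod_add_left_eq)
    moreover have "i \<noteq> j mod y" using 2(1) assms by (metis atLeastLessThan_iff mod_eq_dvd_iff mod_mod_trivial)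
    moreover have "transpose (j mod y) ((j - 1) mod y) i = j mod y" unfolding i by simp
    moreover have "swap_adjacent y j i = i + 1"
      using 2 by (simp add: swap_adjacent_def algebra_simps)
    ultimately show ?thesis by metis
  next
    case 3
    then have "i \<noteq> j mod y" "i \<noteq> (j - 1) mod y" using assms
      by (metis atLeastLessThan_iff mod_eq_dvd_iff mod_mod_trivial)+
    moreover have "\<not> y dvd i - j + 1" using 3(2) by (simp add: algebra_simps)
    ultimately show ?thesis using 3
      by (intro exI[of _ 0]) (simp add: swap_adjacent_def)
  qed
qed

lemma alternating_signed_match: "alternating y L (signed_match y L R)"
  unfolding alternating_def
proof (intro impI ballI allI)
  fix Q j assume y: "y \<ge> 2" and Q: "Q \<in> quasi_periodic y L"
  define t where "t = transpose (j mod y) ((j - 1) mod y)"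
  have range: "j mod y \<in> {0..<y}" "(j - 1) mod y \<in> {0..<y}" using y by auto
  have ne: "j mod y \<noteq> (j - 1) mod y"
  proof
    assume "j mod y = (j - 1) mod y"
    then have "y dvd j - (j - 1)" by (simp only: mod_eq_dvd_iff)
    then show False using y by auto
  qed
  have t: "t permutes {0..<y}" unfolding t_def by (rule permutes_swap_id[OF range])
  have tt: "t \<circ> t = id" by (simp add: t_def fun_eq_iff)
  have t_range: "t i \<in> {0..<y}" if "i \<in> {0..<y}" for i using permutes_in_image[OF t] that by simp
  have sw: "matches_mod y L R p (Q \<circ> swap_adjacent y j) \<longleftrightarrow> matches_mod y L R (p \<circ> t) Q" for p
  proof -
    have "L dvd Q (swap_adjacent y j i) - R (p i) \<longleftrightarrow> L dvd Q (t i) - R (p i)" if i: "i \<in> {0..<y}" for i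
    proof -
      obtain m where "swap_adjacent y j i = t i + m * y"
        using swap_adjacent_transpose[OF i, of j] y unfolding t_def by auto
      then have "Q (swap_adjacent y j i) - R (p i) = (Q (t i) - R (p i)) + L * (- m)"
        using quasi_periodic_shift[OF Q, of "t i" m] by (simp add: algebra_simps)
      then show ?thesis by (metis dvd_add_left_iff dvd_triv_left)
    qed
    then have "matches_mod y L R p (Q \<circ> swap_adjacent y j) \<longleftrightarrow> (\<forall>i\<in>{0..<y}. L dvd Q (t i) - R (p i))"
      by (simp add: matches_mod_def)
    also have "\<dots> \<longleftrightarrow> matches_mod y L R (p \<circ> t) Q"
    proof
      assume A: "\<forall>i\<in>{0..<y}. L dvd Q (t i) - R (p i)"
      have "L dvd Q i - R (p (t i))" if "i \<in> {0..<y}" for i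
        using bspec[OF A t_range[OF that]] fun_cong[OF tt, of i] by simp
      then show "matches_mod y L R (p \<circ> t) Q" by (simp add: matches_mod_def)
    next
      assume A: "matches_mod y L R (p \<circ> t) Q"
      show "\<forall>i\<in>{0..<y}. L dvd Q (t i) - R (p i)"
      proof
        fix i assume "i \<in> {0..<y}"
        then show "L dvd Q (t i) - R (p i)"
          using A t_range[of i] fun_cong[OF tt, of i] unfolding matches_mod_def by fastforce
      qed
    qed
    finally show ?thesis .
  qed
  have "signed_match y L R (Q \<circ> swap_adjacent y j)
      = (\<Sum>p | p permutes {0..<y}. sign p * of_bool (matches_mod y L R (p \<circ> t) Q))"
    unfolding signed_match_def sw ..
  also have "\<dots> = (\<Sum>p | p permutes {0..<y}. sign (p \<circ> t) * of_bool (matches_mod y L R p Q))"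
    by (rule sum.reindex_bij_witness[of _ "\<lambda>p. p \<circ> t" "\<lambda>p. p \<circ> t"])
      (simp_all add: permutes_compose[OF t] comp_assoc tt)
  also have "\<dots> = (\<Sum>p | p permutes {0..<y}. - (sign p * of_bool (matches_mod y L R p Q)))"
  proof (rule sum.cong[OF refl])
    fix p assume "p \<in> {p. p permutes {0..<y}}"
    then have "permutation p" by (simp add: permutes_imp_permutation[of "{0..<y}"])
    moreover have "permutation t" by (rule permutes_imp_permutation[OF _ t]) simp
    moreover have "sign t = -1" unfolding t_def by (simp add: sign_swap_id ne)
    ultimately show "sign (p \<circ> t) * of_bool (matches_mod y L R p Q) = - (sign p * of_bool (matches_mod y L R p Q))"
      by (simp add: sign_compose)
  qed
  finally show "signed_match y L R (Q \<circ> swap_adjacent y j) = - signed_match y L R Q"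
    by (simp add: signed_match_def sum_negf)
qed

lemma strict_dec_less_iff:
  fixes R :: "int \<Rightarrow> int"
  assumes "\<And>j. R j < R (j - 1)"
  shows "R i < R j \<longleftrightarrow> j < i"
proof -
  have less: "R b < R a" if "a < b" for a b
    using that
  proof (induction b rule: int_gr_induct)
    case base then show ?case using assms[of "a + 1"] by simp
  next
    case (step b) then show ?case using assms[of "b + 1"] by simp
  qed
  show ?thesis using less[of i j] less[of j i] by (cases i j rule: linorder_cases) auto
qed

text \<open>Matching residues mean \<open>Q = R \<circ> w\<close> for a map \<open>w\<close> that commutes with the shift by \<open>y\<close>. As \<open>Q\<close> and \<open>R\<close> both
decrease, \<open>w\<close> increases, hence grows in steps of one and is a translation; equal sums over a period
exclude all translations but the identity.\<close>

lemma matches_mod_strict: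
  assumes y: "y > 0" and Q: "Q \<in> quasi_periodic y L" and R: "R \<in> quasi_periodic y L"
    and Qdec: "\<And>j. Q j < Q (j - 1)" and Rdec: "\<And>j. R j < R (j - 1)"
    and total: "(\<Sum>j\<in>{0..<y}. Q j) = (\<Sum>j\<in>{0..<y}. R j)"
    and p: "p permutes {0..<y}" and m: "matches_mod y L R p Q"
  shows "Q = R \<and> p = id"
proof -
  have "\<exists>a. \<forall>i\<in>{0..<y}. Q i - R (p i) = L * a i"
    using m unfolding matches_mod_def dvd_def by (intro bchoice)
  then obtain a where a: "\<And>i. i \<in> {0..<y} \<Longrightarrow> Q i - R (p i) = L * a i" by blast
  define w where "w j = p (j mod y) + (j div y - a (j mod y)) * y" for j
  have Qw: "Q j = R (w j)" for j
  proof -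
    have "R (w j) = R (p (j mod y)) - (j div y - a (j mod y)) * L"
      unfolding w_def by (rule quasi_periodic_shift[OF R])
    then show ?thesis using a[of "j mod y"] y quasi_periodic_mod[OF Q, of j]
      by (simp add: algebra_simps)
  qed
  have w_step: "w (j - 1) < w j" for j
    using Qdec[of j] strict_dec_less_iff[of R, OF Rdec] by (simp add: Qw)
  have w_ge: "w j + int m \<le> w (j + int m)" for j m
  proof (induction m)
    case (Suc m)
    then show ?case using w_step[of "j + int m + 1"] by (simp add: algebra_simps)
  qed simp
  have w_y: "w y = w 0 + y" using y by (simp add: w_def algebra_simps)
  have w_eq: "w j = w 0 + j" if "j \<in> {0..<y}" for j
    using w_ge[of 0 "nat j"] w_ge[of j "nat (y - j)"] w_y that by simp
  have R_shift: "Q j = R (w 0 + j)" if "j \<in> {0..<y}" for j using Qw[of j] w_eq[OF that] by simp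
  have w0: "w 0 = 0"
  proof (rule ccontr)
    assume "w 0 \<noteq> 0"
    then consider "w 0 > 0" | "w 0 < 0" by linarith
    then show False
    proof cases
      case 1
      then have "(\<Sum>j\<in>{0..<y}. Q j) < (\<Sum>j\<in>{0..<y}. R j)"
        using y by (intro sum_strict_mono) (auto simp: R_shift strict_dec_less_iff[of R, OF Rdec])
      then show False using total by simp
    next
      case 2
      then have "(\<Sum>j\<in>{0..<y}. R j) < (\<Sum>j\<in>{0..<y}. Q j)"
        using y by (intro sum_strict_mono) (auto simp: R_shift strict_dec_less_iff[of R, OF Rdec])
      then show False using total by simp
    qed
  qed
  have "Q = R" by (rule quasi_periodic_eqI[OF Q R y]) (simp add: R_shift w0)
  moreover have "p j = j" for j
  proof (cases "j \<in> {0..<y}")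
    case True
    have "p j \<in> {0..<y}" using permutes_in_image[OF p] True by simp
    moreover have "p j + (- a j) * y = j" using w_eq[OF True] w0 True by (simp add: w_def)
    ultimately show ?thesis using True
      by (metis mod_mult_self1 atLeastLessThan_iff mod_pos_pos_trivial)
  next
    case False then show ?thesis using permutes_not_in[OF p] by simp
  qed
  ultimately show ?thesis by (simp add: fun_eq_iff)
qed

lemma signed_match_strict:
  assumes y: "y > 0" and Q: "Q \<in> quasi_periodic y L" and R: "R \<in> quasi_periodic y L"
    and Qdec: "\<And>j. Q j < Q (j - 1)" and Rdec: "\<And>j. R j < R (j - 1)"
    and total: "(\<Sum>j\<in>{0..<y}. Q j) = (\<Sum>j\<in>{0..<y}. R j)"
  shows "signed_match y L R Q = of_bool (Q = R)"
proof (cases "Q = R")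
  case True
  have "signed_match y L R Q = (\<Sum>p | p permutes {0..<y}. if p = id then 1 else 0)"
    unfolding signed_match_def
  proof (rule sum.cong[OF refl])
    fix p assume p: "p \<in> {p. p permutes {0..<y}}"
    have "matches_mod y L R p Q \<longleftrightarrow> p = id"
      using matches_mod_strict[OF assms, of p] p True by (auto simp: matches_mod_def)
    then show "sign p * of_bool (matches_mod y L R p Q) = (if p = id then 1 else 0)"
      by (simp add: sign_id)
  qed
  then show ?thesis using True by (simp add: finite_permutations permutes_id)
next
  case False
  have "signed_match y L R Q = (\<Sum>p | p permutes {0..<y}. 0)"
    unfolding signed_match_def
  proof (rule sum.cong[OF refl])
    fix p assume p: "p \<in> {p. p permutes {0..<y}}"
    have "\<not> matches_mod y L R p Q"
      using matches_mod_strict[OF assms, of p] p False by auto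
    then show "sign p * of_bool (matches_mod y L R p Q) = 0" by simp
  qed
  then show ?thesis using False by simp
qed

text \<open>The Jacobi-Trudi formula on the cylinder. Strict walks from \<open>P\<close> to \<open>R\<close> are strict walks from \<open>P\<close> weighted by an
alternating function of the end point; for such a weight the steps may be made free one at a time,
from the last to the first.\<close>

theorem card_strict_walks_jacobi_trudi:
  assumes y: "y > 0" and P: "P \<in> quasi_periodic y L" and R: "R \<in> quasi_periodic y L"
    and Pdec: "\<And>j. P j < P (j - 1)" and Rdec: "\<And>j. R j < R (j - 1)"
    and total: "(\<Sum>j\<in>{0..<y}. R j) = (\<Sum>j\<in>{0..<y}. P j) + (\<Sum>i<n. \<beta> i)"
    and \<beta>: "\<And>i. i < n \<Longrightarrow> \<beta> i < L"
  shows "int (card {G \<in> walks (\<lambda>i. strict_step y L (\<beta> i)) n P. G n = R})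
    = (\<Sum>p | p permutes {0..<y}.
        sign p * int (card {G \<in> walks (\<lambda>i. free_step y L (\<beta> i)) n P. matches_mod y L R p (G n)}))"
proof -
  let ?S = "walks (\<lambda>i. strict_step y L (\<beta> i)) n P" and ?F = "walks (\<lambda>i. free_step y L (\<beta> i)) n P"
  have finS: "finite ?S" by (intro finite_walks finite_strict_step y)
  have finF: "finite ?F" by (intro finite_walks finite_free_step y)
  have "int (card {G \<in> ?S. G n = R}) = (\<Sum>G\<in>?S. of_bool (G n = R))"
    using finS by (simp add: of_bool_def flip: sum.inter_filter)
  also have "\<dots> = (\<Sum>G\<in>?S. signed_match y L R (G n))"
  proof (rule sum.cong[OF refl])
    fix G assume G: "G \<in> ?S"
    note state = strict_walk_state[OF G P Pdec order_refl]
    show "of_bool (G n = R) = signed_match y L R (G n)"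
      using state total by (intro signed_match_strict[symmetric] y R Rdec) simp_all
  qed
  also have "\<dots> = (\<Sum>G\<in>?F. signed_match y L R (G n))"
    by (rule alternating_strict_walks[OF y P Pdec \<beta> alternating_signed_match])
  also have "\<dots> = (\<Sum>p | p permutes {0..<y}. \<Sum>G\<in>?F. sign p * of_bool (matches_mod y L R p (G n)))"
    unfolding signed_match_def by (rule sum.swap)
  also have "\<dots> = (\<Sum>p | p permutes {0..<y}. sign p * int (card {G \<in> ?F. matches_mod y L R p (G n)}))"
    using finF by (intro sum.cong refl) (simp add: of_bool_def flip: sum.inter_filter sum_distrib_left)
  finally show ?thesis .
qed

section \<open>Eventual polynomiality of the number of strict walks\<close>

text \<open>The increments of a free walk, particle by particle and step by step, form an arbitrary matrix of
nonnegative integers: its row sums are the total displacements and its column sums the step sizes.\<close>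

lemma card_free_walks_eq_card_margin_matrices:
  assumes y: "y > 0" and P: "P \<in> quasi_periodic y L"
  shows "card {G \<in> walks (\<lambda>i. free_step y L (\<beta> i)) n P. \<forall>i\<in>{0..<y}. G n i = P i + r i}
    = card (margin_matrices {0..<y} {..<n} r \<beta>)"
proof -
  let ?W = "{G \<in> walks (\<lambda>i. free_step y L (\<beta> i)) n P. \<forall>i\<in>{0..<y}. G n i = P i + r i}"
  let ?M = "margin_matrices {0..<y} {..<n} r \<beta>"
  define f where "f G = (\<lambda>(i, l). if i \<in> {0..<y} \<and> l < n then nat (G (Suc l) i - G l i) else 0)"
    for G :: "nat \<Rightarrow> int \<Rightarrow> int"
  define g where "g M = (\<lambda>l j. if l \<le> n then P j + (\<Sum>l'<l. int (M (j mod y, l'))) else 0)"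
    for M :: "int \<times> nat \<Rightarrow> nat"
  have step: "G (Suc l) \<in> free_step y L (\<beta> l) (G l)" if "G \<in> ?W" "l < n" for G l
    using that by (simp add: walks_def)
  have le: "G l i \<le> G (Suc l) i" if "G \<in> ?W" "l < n" for G l i
    using step[OF that] by (simp add: free_step_def)
  have qp: "G l \<in> quasi_periodic y L" if "G \<in> ?W" "l \<le> n" for G l
  proof (cases l)
    case 0 then show ?thesis using that P by (simp add: walks_def)
  next
    case (Suc m) then show ?thesis using step[OF that(1), of m] that(2) by (simp add: free_step_def)
  qed
  have tele: "(\<Sum>l'<l. G (Suc l') i - G l' i) = G l i - P i" if "G \<in> ?W" for G l i
    using sum_lessThan_telescope[of "\<lambda>l. G l i" l] that by (simp add: walks_def)
  have "bij_betw f ?W ?M"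
  proof (rule bij_betw_byWitness[where f' = g])
    show "\<forall>G\<in>?W. g (f G) = G"
    proof
      fix G assume G: "G \<in> ?W"
      show "g (f G) = G"
      proof (intro ext)
        fix l j
        show "g (f G) l j = G l j"
        proof (cases "l \<le> n")
          case True
          have "(\<Sum>l'<l. int (f G (j mod y, l'))) = (\<Sum>l'<l. G (Suc l') (j mod y) - G l' (j mod y))"
            using True y G by (intro sum.cong refl) (simp add: f_def le[OF G])
          also have "\<dots> = G l (j mod y) - P (j mod y)" by (rule tele[OF G])
          finally show ?thesis
            using True quasi_periodic_mod[OF qp[OF G True], of j] quasi_periodic_mod[OF P, of j]
            by (simp add: g_def)
        next
          case False
          then show ?thesis using G by (simp add: g_def walks_def)
        qed
      qed
    qed
    show "\<forall>M\<in>?M. f (g M) = M"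
    proof
      fix M assume M: "M \<in> ?M"
      show "f (g M) = M"
      proof
        fix z show "f (g M) z = M z"
          using M by (cases z) (auto simp: f_def g_def margin_matrices_def)
      qed
    qed
    show "f ` ?W \<subseteq> ?M"
    proof
      fix M assume "M \<in> f ` ?W"
      then obtain G where G: "G \<in> ?W" and M: "M = f G" by blast
      have rows: "(\<Sum>l<n. int (f G (i, l))) = r i" if "i \<in> {0..<y}" for i
      proof -
        have "(\<Sum>l<n. int (f G (i, l))) = (\<Sum>l<n. G (Suc l) i - G l i)"
          using that G by (intro sum.cong refl) (simp add: f_def le[OF G])
        then show ?thesis using tele[OF G, of i n] that G by simp
      qed
      have cols: "(\<Sum>i\<in>{0..<y}. int (f G (i, l))) = \<beta> l" if "l < n" for l
      proof -
        have "(\<Sum>i\<in>{0..<y}. int (f G (i, l))) = (\<Sum>i\<in>{0..<y}. G (Suc l) i - G l i)"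
          using that G by (intro sum.cong refl) (simp add: f_def le[OF G])
        then show ?thesis using step[OF G that] by (simp add: free_step_def)
      qed
      have "f G z = 0" if "z \<notin> {0..<y} \<times> {..<n}" for z
        using that by (cases z) (auto simp: f_def)
      then show "M \<in> ?M" using rows cols by (simp add: M margin_matrices_def)
    qed
    show "g ` ?M \<subseteq> ?W"
    proof
      fix G assume "G \<in> g ` ?M"
      then obtain M where M: "M \<in> ?M" and G: "G = g M" by blast
      have "g M (Suc l) \<in> free_step y L (\<beta> l) (g M l)" if l: "l < n" for l
      proof -
        have "(\<Sum>j\<in>{0..<y}. g M (Suc l) j - g M l j) = (\<Sum>j\<in>{0..<y}. int (M (j, l)))"
          using l by (intro sum.cong refl) (simp add: g_def)
        also have "\<dots> = \<beta> l" using M l by (simp add: margin_matrices_def)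
        finally show ?thesis using l P by (simp add: free_step_def g_def quasi_periodic_def)
      qed
      moreover have "g M n i = P i + r i" if "i \<in> {0..<y}" for i
        using M that by (simp add: g_def margin_matrices_def)
      moreover have "g M 0 = P" by (simp add: g_def)
      moreover have "g M l = (\<lambda>_. 0)" if "l > n" for l using that by (simp add: g_def fun_eq_iff)
      ultimately show "G \<in> ?W" by (simp add: G walks_def)
    qed
  qed
  then show ?thesis by (rule bij_betw_same_card)
qed

lemma free_walk_gap_bounds:
  assumes "G \<in> walks (\<lambda>i. free_step y L (\<beta> i)) n P" "i \<in> {0..<y}" "y > 0"
  shows "0 \<le> G n i - P i" "G n i - P i \<le> (\<Sum>l<n. \<beta> l)"
proof -
  have step: "G (Suc l) \<in> free_step y L (\<beta> l) (G l)" if "l < n" for l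
    using that assms(1) by (simp add: walks_def)
  have tele: "G n i - P i = (\<Sum>l<n. G (Suc l) i - G l i)"
    using sum_lessThan_telescope[of "\<lambda>l. G l i" n] assms(1) by (simp add: walks_def)
  have low: "0 \<le> G (Suc l) j - G l j" if "l < n" for l j using step[OF that] by (simp add: free_step_def)
  have high: "G (Suc l) i - G l i \<le> \<beta> l" if "l < n" for l
  proof -
    have "G (Suc l) i - G l i \<le> (\<Sum>j\<in>{0..<y}. G (Suc l) j - G l j)"
      using assms(2) low[OF that] by (intro member_le_sum) auto
    then show ?thesis using step[OF that] by (simp add: free_step_def)
  qed
  show "0 \<le> G n i - P i" unfolding tele by (intro sum_nonneg low) simp
  show "G n i - P i \<le> (\<Sum>l<n. \<beta> l)" unfolding tele by (intro sum_mono high) simp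
qed

text \<open>The Jacobi-Trudi formula expresses the number as a signed sum over permutations \<open>p\<close> of free walks whose
end point is determined up to multiples \<open>m i * L\<close> of the period length. Since \<open>L \<ge> k\<close> while all displacements
are bounded by a multiple of \<open>k\<close>, the vectors \<open>m\<close> range over a finite box that does not depend on \<open>k\<close>. For fixed
\<open>p\<close> and \<open>m\<close> the walks are matrices with margins of the form \<open>k * p' + q'\<close> and \<open>k * \<beta>\<close>. The bound \<open>\<beta> i \<le> x\<close> is what the
cancellation needs: it makes every step smaller than \<open>L = k * x + y\<close>. If the sums over a period of the two ends do not
differ by the total of \<open>\<beta>\<close>, no walk joins them for \<open>k \<ge> 1\<close>.\<close>

theorem eventually_poly_card_strict_walks:
  fixes \<mu> \<kappa> :: "int \<Rightarrow> int" and \<beta> :: "nat \<Rightarrow> int"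
  assumes x: "x \<ge> 1" and y: "y \<ge> 1"
    and \<mu>: "\<mu> \<in> quasi_periodic y x" and \<kappa>: "\<kappa> \<in> quasi_periodic y x"
    and \<mu>dec: "\<And>j. \<mu> j \<le> \<mu> (j - 1)" and \<kappa>dec: "\<And>j. \<kappa> j \<le> \<kappa> (j - 1)"
    and \<beta>: "\<And>i. i < n \<Longrightarrow> 0 \<le> \<beta> i \<and> \<beta> i \<le> x"
  shows "eventually_poly (\<lambda>k. of_nat (card
    {G \<in> walks (\<lambda>i. strict_step y (int k * x + y) (int k * \<beta> i)) n (\<lambda>j. int k * \<mu> j - j).
       G n = (\<lambda>j. int k * \<kappa> j - j)}))"
proof (cases "(\<Sum>j\<in>{0..<y}. \<kappa> j) = (\<Sum>j\<in>{0..<y}. \<mu> j) + (\<Sum>i<n. \<beta> i)")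
  case True
  define L P R where "L k = int k * x + y" and "P k = (\<lambda>j. int k * \<mu> j - j)" and "R k = (\<lambda>j. int k * \<kappa> j - j)"
    for k :: nat
  have y0: "y > 0" using y by simp
  have PR: "P k \<in> quasi_periodic y (L k)" "R k \<in> quasi_periodic y (L k)"
    "P k j < P k (j - 1)" "R k j < R k (j - 1)" for k j
  proof -
    show "P k \<in> quasi_periodic y (L k)" "R k \<in> quasi_periodic y (L k)"
      using \<mu> \<kappa> by (simp_all add: quasi_periodic_def P_def R_def L_def right_diff_distrib)
    have "int k * \<mu> j \<le> int k * \<mu> (j - 1)" "int k * \<kappa> j \<le> int k * \<kappa> (j - 1)"
      using \<mu>dec \<kappa>dec by (simp_all add: mult_left_mono)
    then show "P k j < P k (j - 1)" "R k j < R k (j - 1)" by (simp_all add: P_def R_def)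
  qed
  have \<beta>_less: "int k * \<beta> i < L k" if "i < n" for k i
  proof -
    have "int k * \<beta> i \<le> int k * x" using \<beta>[OF that] by (simp add: mult_left_mono)
    then show ?thesis using y by (simp add: L_def)
  qed
  have total: "(\<Sum>j\<in>{0..<y}. R k j) = (\<Sum>j\<in>{0..<y}. P k j) + (\<Sum>i<n. int k * \<beta> i)" for k
    using True by (simp add: R_def P_def sum_subtractf algebra_simps flip: sum_distrib_left)
  define F where "F k = walks (\<lambda>i. free_step y (L k) (int k * \<beta> i)) n (P k)" for k
  have finF: "finite (F k)" for k unfolding F_def by (intro finite_walks finite_free_step y0)
  define C where "C = (\<Sum>i<n. \<beta> i) + (\<Sum>j\<in>{0..<y}. \<bar>\<mu> j\<bar> + \<bar>\<kappa> j\<bar>) + y"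
  define Box where "Box = (\<Pi>\<^sub>E j\<in>{0..<y}. {- C..C})"
  define N where "N p m k = card (margin_matrices {0..<y} {..<n}
      (\<lambda>i. int k * (\<kappa> (p i) - \<mu> i + m i * x) + (i - p i + m i * y)) (\<lambda>l. int k * \<beta> l))" for p m k
  have count: "card {G \<in> F k. matches_mod y (L k) (R k) p (G n)} = (\<Sum>m\<in>Box. N p m k)"
    if p: "p permutes {0..<y}" and k: "k \<ge> 1" for p k
  proof -
    define A where "A m = {G \<in> F k. \<forall>i\<in>{0..<y}. G n i = R k (p i) + L k * m i}" for m :: "int \<Rightarrow> int"
    have "int k * 1 \<le> int k * x" using x by (intro mult_left_mono) auto
    then have L_k: "L k \<ge> int k" "L k > 0" unfolding L_def using y k by linarith+
    have bound: "\<bar>m\<bar> \<le> C" if G: "G \<in> F k" and i: "i \<in> {0..<y}" and m: "G n i = R k (p i) + L k * m" for G i m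
    proof -
      note gap = free_walk_gap_bounds[OF G[unfolded F_def] i y0]
      have pi: "p i \<in> {0..<y}" using permutes_in_image[OF p] i by simp
      have "L k * m = (G n i - P k i) + int k * (\<mu> i - \<kappa> (p i)) + (p i - i)"
        using m by (simp add: P_def R_def algebra_simps)
      then have "\<bar>L k * m\<bar> \<le> \<bar>G n i - P k i\<bar> + \<bar>int k * (\<mu> i - \<kappa> (p i))\<bar> + \<bar>p i - i\<bar>" by linarith
      moreover have "\<bar>G n i - P k i\<bar> \<le> int k * (\<Sum>i<n. \<beta> i)" using gap by (simp add: sum_distrib_left)
      moreover have "\<bar>\<mu> i - \<kappa> (p i)\<bar> \<le> (\<Sum>j\<in>{0..<y}. \<bar>\<mu> j\<bar> + \<bar>\<kappa> j\<bar>)"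
      proof -
        have "\<bar>\<mu> i\<bar> \<le> (\<Sum>j\<in>{0..<y}. \<bar>\<mu> j\<bar>)" using i by (intro member_le_sum) auto
        moreover have "\<bar>\<kappa> (p i)\<bar> \<le> (\<Sum>j\<in>{0..<y}. \<bar>\<kappa> j\<bar>)" using pi by (intro member_le_sum) auto
        ultimately show ?thesis by (simp add: sum.distrib)
      qed
      then have "\<bar>int k * (\<mu> i - \<kappa> (p i))\<bar> \<le> int k * (\<Sum>j\<in>{0..<y}. \<bar>\<mu> j\<bar> + \<bar>\<kappa> j\<bar>)"
        by (simp add: abs_mult mult_left_mono)
      moreover have "\<bar>p i - i\<bar> \<le> int k * y"
      proof -
        have "\<bar>p i - i\<bar> \<le> y" using pi i by auto
        also have "y \<le> int k * y" using k y by (simp add: mult_le_cancel_right1)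
        finally show ?thesis .
      qed
      ultimately have "\<bar>L k * m\<bar> \<le> int k * C" by (simp add: C_def distrib_left)
      moreover have "int k * \<bar>m\<bar> \<le> \<bar>L k * m\<bar>"
        using L_k by (simp add: abs_mult mult_right_mono)
      ultimately have "int k * \<bar>m\<bar> \<le> int k * C" by linarith
      then show ?thesis using k by simp
    qed
    have "{G \<in> F k. matches_mod y (L k) (R k) p (G n)} = (\<Union>m\<in>Box. A m)"
    proof (intro set_eqI iffI)
      fix G assume G: "G \<in> {G \<in> F k. matches_mod y (L k) (R k) p (G n)}"
      then have "\<forall>i\<in>{0..<y}. \<exists>m. G n i - R k (p i) = L k * m"
        by (simp add: matches_mod_def dvd_def)
      from bchoice[OF this] obtain m where m: "\<forall>i\<in>{0..<y}. G n i - R k (p i) = L k * m i" ..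
      have "restrict m {0..<y} \<in> Box"
      proof -
        have "\<bar>m i\<bar> \<le> C" if "i \<in> {0..<y}" for i
          using bound[of G i "m i"] G bspec[OF m that] that by simp
        then show ?thesis by (fastforce simp: Box_def abs_le_iff)
      qed
      moreover have "G \<in> A (restrict m {0..<y})" using G m by (simp add: A_def algebra_simps)
      ultimately show "G \<in> (\<Union>m\<in>Box. A m)" by (intro UN_I[of "restrict m {0..<y}"])
    next
      fix G assume "G \<in> (\<Union>m\<in>Box. A m)"
      then show "G \<in> {G \<in> F k. matches_mod y (L k) (R k) p (G n)}"
        by (auto simp: A_def matches_mod_def)
    qed
    moreover have "card (\<Union>m\<in>Box. A m) = (\<Sum>m\<in>Box. card (A m))"
    proof (rule card_UN_disjoint)
      show "finite Box" unfolding Box_def by (intro finite_PiE) auto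
      show "\<forall>m\<in>Box. finite (A m)" unfolding A_def using finF by simp
      show "\<forall>m\<in>Box. \<forall>m'\<in>Box. m \<noteq> m' \<longrightarrow> A m \<inter> A m' = {}"
      proof (intro ballI impI)
        fix m m' assume m: "m \<in> Box" "m' \<in> Box" "m \<noteq> m'"
        then obtain i where "i \<in> {0..<y}" "m i \<noteq> m' i"
          unfolding Box_def by (metis PiE_ext)
        then show "A m \<inter> A m' = {}" using L_k(2) by (auto simp: A_def)
      qed
    qed
    moreover have "card (A m) = N p m k" for m
    proof -
      have "A m = {G \<in> walks (\<lambda>i. free_step y (L k) (int k * \<beta> i)) n (P k). \<forall>i\<in>{0..<y}. G n i = P k i +
        (int k * (\<kappa> (p i) - \<mu> i + m i * x) + (i - p i + m i * y))}"
        unfolding A_def F_def by (simp add: P_def R_def L_def algebra_simps)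
      then show ?thesis unfolding N_def
        using card_free_walks_eq_card_margin_matrices[OF y0 PR(1)] by simp
    qed
    ultimately show ?thesis by simp
  qed
  have N_poly: "eventually_poly (\<lambda>k. of_nat (N p m k))" for p m
    unfolding N_def by (rule eventually_poly_card_margin_matrices) auto
  have "eventually_poly (\<lambda>k. \<Sum>p | p permutes {0..<y}. of_int (sign p) * (\<Sum>m\<in>Box. of_nat (N p m k)))"
    by (intro eventually_poly_sum eventually_poly_cmult N_poly)
  then show ?thesis
  proof (rule eventually_poly_cong[where ?k0.0 = 1])
    fix k :: nat assume k: "k \<ge> 1"
    have "int (card {G \<in> walks (\<lambda>i. strict_step y (L k) (int k * \<beta> i)) n (P k). G n = R k})
      = (\<Sum>p | p permutes {0..<y}. sign p * int (card {G \<in> F k. matches_mod y (L k) (R k) p (G n)}))"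
      unfolding F_def using \<beta>_less total
      by (intro card_strict_walks_jacobi_trudi y0 PR) simp_all
    also have "\<dots> = (\<Sum>p | p permutes {0..<y}. sign p * (\<Sum>m\<in>Box. int (N p m k)))"
      using count[OF _ k] by (intro sum.cong refl) simp
    finally have "of_int (int (card {G \<in> walks (\<lambda>i. strict_step y (L k) (int k * \<beta> i)) n (P k). G n = R k}))
      = (of_int (\<Sum>p | p permutes {0..<y}. sign p * (\<Sum>m\<in>Box. int (N p m k))) :: rat)" by simp
    then show "of_nat (card {G \<in> walks (\<lambda>i. strict_step y (int k * x + y) (int k * \<beta> i)) n (\<lambda>j. int k * \<mu> j - j).
       G n = (\<lambda>j. int k * \<kappa> j - j)}) = (\<Sum>p | p permutes {0..<y}. rat_of_int (sign p) * (\<Sum>m\<in>Box. of_nat (N p m k)))"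
      by (simp add: L_def P_def R_def)
  qed
next
  case False
  have empty: "{G \<in> walks (\<lambda>i. strict_step y (int k * x + y) (int k * \<beta> i)) n (\<lambda>j. int k * \<mu> j - j).
       G n = (\<lambda>j. int k * \<kappa> j - j)} = {}" if k: "k \<ge> 1" for k
  proof (rule ccontr)
    assume "{G \<in> walks (\<lambda>i. strict_step y (int k * x + y) (int k * \<beta> i)) n (\<lambda>j. int k * \<mu> j - j).
       G n = (\<lambda>j. int k * \<kappa> j - j)} \<noteq> {}"
    then obtain G where G: "G \<in> walks (\<lambda>i. strict_step y (int k * x + y) (int k * \<beta> i)) n (\<lambda>j. int k * \<mu> j - j)"
      "G n = (\<lambda>j. int k * \<kappa> j - j)" by blast
    have qp: "(\<lambda>j. int k * \<mu> j - j) \<in> quasi_periodic y (int k * x + y)"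
      using \<mu> by (simp add: quasi_periodic_def right_diff_distrib)
    have mono: "int k * \<mu> j \<le> int k * \<mu> (j - 1)" for j using \<mu>dec by (simp add: mult_left_mono)
    have dec: "int k * \<mu> j - j < int k * \<mu> (j - 1) - (j - 1)" for j
      using mono[of j] by linarith
    have "(\<Sum>j\<in>{0..<y}. G n j) = (\<Sum>j\<in>{0..<y}. int k * \<mu> j - j) + (\<Sum>l<n. int k * \<beta> l)"
      using strict_walk_state[OF G(1) qp dec order_refl] by simp
    then have "int k * (\<Sum>j\<in>{0..<y}. \<kappa> j) = int k * ((\<Sum>j\<in>{0..<y}. \<mu> j) + (\<Sum>i<n. \<beta> i))"
      unfolding G(2) by (simp add: sum_subtractf algebra_simps flip: sum_distrib_left)
    then show False using False k by simp
  qed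
  show ?thesis
  proof (rule eventually_polyI[of 1 _ 0])
    fix k :: nat assume "k \<ge> 1"
    show "of_nat (card {G \<in> walks (\<lambda>i. strict_step y (int k * x + y) (int k * \<beta> i)) n (\<lambda>j. int k * \<mu> j - j).
       G n = (\<lambda>j. int k * \<kappa> j - j)}) = poly 0 (of_nat k :: rat)"
      unfolding empty[OF \<open>k \<ge> 1\<close>] by simp
  qed
qed

section \<open>Cylindric diagrams by rows\<close>

lemma cyl_eq_iff:
  "cyl x y p = cyl x y q \<longleftrightarrow> (\<exists>t. fst q = fst p + t * x \<and> snd q = snd p - t * y)"
proof
  assume "cyl x y p = cyl x y q"
  moreover have "q \<in> cyl x y q" by (auto simp: cyl_def cyl_rel_def intro!: exI[of _ 0])
  ultimately have "q \<in> cyl x y p" by simp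
  then show "\<exists>t. fst q = fst p + t * x \<and> snd q = snd p - t * y"
    by (simp add: cyl_def cyl_rel_def)
next
  assume "\<exists>t. fst q = fst p + t * x \<and> snd q = snd p - t * y"
  then obtain t where t: "fst q = fst p + t * x" "snd q = snd p - t * y" by blast
  have "(\<exists>s. fst r = fst p + s * x \<and> snd r = snd p - s * y)
      \<longleftrightarrow> (\<exists>s. fst r = fst q + s * x \<and> snd r = snd q - s * y)" for r
  proof
    assume "\<exists>s. fst r = fst p + s * x \<and> snd r = snd p - s * y"
    then obtain s where "fst r = fst p + s * x" "snd r = snd p - s * y" by blast
    then show "\<exists>s. fst r = fst q + s * x \<and> snd r = snd q - s * y"
      using t by (intro exI[of _ "s - t"]) (simp add: algebra_simps)
  next
    assume "\<exists>s. fst r = fst q + s * x \<and> snd r = snd q - s * y"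
    then obtain s where "fst r = fst q + s * x" "snd r = snd q - s * y" by blast
    then show "\<exists>s. fst r = fst p + s * x \<and> snd r = snd p - s * y"
      using t by (intro exI[of _ "s + t"]) (simp add: algebra_simps)
  qed
  then show "cyl x y p = cyl x y q" by (auto simp: cyl_def cyl_rel_def)
qed

lemma cyl_shift: "cyl x y (i + t * x, j - t * y) = cyl x y (i, j)"
  by (subst eq_commute) (auto simp: cyl_eq_iff)

text \<open>The parameter of a lattice path can be read off from the point, since every step raises the difference
of the coordinates by one.\<close>

lemma lattice_path_monotone:
  assumes "lattice_path p" "s \<le> t"
  shows "fst (p s) \<le> fst (p t) \<and> snd (p t) \<le> snd (p s) \<and>
    fst (p t) - snd (p t) = fst (p s) - snd (p s) + (t - s)"
  using assms(2)
proof (induction t rule: int_ge_induct)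
  case (step t)
  have "p (t + 1) = (fst (p t) + 1, snd (p t)) \<or> p (t + 1) = (fst (p t), snd (p t) - 1)"
    using assms(1) by (simp add: lattice_path_def)
  then show ?case using step by auto
qed simp

lemma boundary_loop_path:
  assumes "boundary_loop x y B" "x \<ge> 1" "y \<ge> 1"
  obtains p where "lattice_path p" "preim x y B = range p"
    "\<And>t m. p (t + m * (x + y)) = (fst (p t) + m * x, snd (p t) - m * y)"
proof -
  obtain p where p: "lattice_path p" "(\<lambda>(u, v). (u + x, v - y)) ` range p = range p" "B = cyl x y ` range p"
    using assms(1) unfolding boundary_loop_def by blast
  have level: "fst (p t) - snd (p t) = fst (p 0) - snd (p 0) + t" for t
    using lattice_path_monotone[OF p(1), of 0 t] lattice_path_monotone[OF p(1), of t 0] by linarith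
  have one: "p (t + (x + y)) = (fst (p t) + x, snd (p t) - y)" for t
  proof -
    have "(fst (p t) + x, snd (p t) - y) \<in> (\<lambda>(u, v). (u + x, v - y)) ` range p"
      by (rule image_eqI[of _ _ "p t"]) (auto simp: case_prod_unfold)
    then obtain s where s: "p s = (fst (p t) + x, snd (p t) - y)" using p(2) by (metis imageE)
    have "s = t + (x + y)" using level[of s] level[of t] s by simp
    then show ?thesis using s by simp
  qed
  have per: "p (t + m * (x + y)) = (fst (p t) + m * x, snd (p t) - m * y)" for t m
  proof (induction m rule: int_induct[where k = 0])
    case (step1 m)
    have "p (t + (m + 1) * (x + y)) = p ((t + m * (x + y)) + (x + y))" by (simp add: algebra_simps)
    then show ?case unfolding one step1(2) by (simp add: algebra_simps)
  next
    case (step2 m)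
    have "p (t + m * (x + y)) = p ((t + (m - 1) * (x + y)) + (x + y))" by (simp add: algebra_simps)
    then show ?case unfolding one step2(2) by (simp add: algebra_simps prod_eq_iff)
  qed simp
  have "preim x y B = range p"
  proof (intro set_eqI iffI)
    fix q assume "q \<in> preim x y B"
    then obtain t where "cyl x y (p t) = cyl x y q" unfolding preim_def p(3) by auto
    then obtain m where "fst q = fst (p t) + m * x" "snd q = snd (p t) - m * y"
      unfolding cyl_eq_iff by blast
    then have "q = p (t + m * (x + y))" by (simp add: per prod_eq_iff)
    then show "q \<in> range p" by blast
  next
    fix q assume "q \<in> range p" then show "q \<in> preim x y B" unfolding preim_def p(3) by blast
  qed
  then show ?thesis using that p(1) per by blast
qed

text \<open>\<open>g j\<close> is the column in which the path makes its unique down step from height \<open>j\<close> to height \<open>j - 1\<close>. The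
points before the step are weakly above and to the left, those after it weakly below and to the right.\<close>

lemma boundary_loop_rows:
  assumes "boundary_loop x y B" and x: "x \<ge> 1" and y: "y \<ge> 1"
  obtains g where "g \<in> quasi_periodic y x" "\<And>j. g j \<le> g (j - 1)" "\<And>j. (g j, j) \<in> preim x y B"
    "\<And>i j. (\<exists>p\<in>preim x y B. weakly_sw p (i - 1, j - 1)) \<longleftrightarrow> g j < i"
    "\<And>i j. (\<exists>q\<in>preim x y B. weakly_sw (i, j) q) \<longleftrightarrow> i \<le> g j"
proof -
  obtain p where path: "lattice_path p" and pre: "preim x y B = range p"
    and per: "\<And>t m. p (t + m * (x + y)) = (fst (p t) + m * x, snd (p t) - m * y)"
    using boundary_loop_path[OF assms] by metis
  have "\<exists>t. snd (p t) = j \<and> p (t + 1) = (fst (p t), j - 1)" for j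
  proof -
    have unbounded: "snd (p (m * (x + y))) = snd (p 0) - m * y" for m using per[of 0 m] by simp
    define m where "m = \<bar>snd (p 0)\<bar> + \<bar>j\<bar> + 1"
    have m_gt: "\<bar>snd (p 0)\<bar> + \<bar>j\<bar> < m" by (simp add: m_def)
    have "m * 1 \<le> m * y" unfolding m_def using y by (intro mult_left_mono) auto
    then have my: "m \<le> m * y" by simp
    have "snd (p (- m * (x + y))) = snd (p 0) + m * y" using unbounded[of "- m"] by simp
    then have hi: "snd (p (- m * (x + y))) \<ge> j" using my m_gt by linarith
    have lo: "snd (p (m * (x + y))) < j" using unbounded[of m] my m_gt by linarith
    have "\<exists>t. snd (p t) \<ge> j \<and> snd (p (t + 1)) < j"
    proof (rule ccontr)
      assume none: "\<not> ?thesis"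
      have "snd (p t) \<ge> j" if "t \<ge> - m * (x + y)" for t
        using that
      proof (induction t rule: int_ge_induct)
        case base then show ?case by (rule hi)
      next
        case (step t) then show ?case using none by (meson not_less)
      qed
      moreover have "m * (x + y) \<ge> - m * (x + y)"
        unfolding m_def using x y by (intro mult_right_mono) auto
      ultimately show False using lo by (meson not_less)
    qed
    then obtain t where t: "snd (p t) \<ge> j" "snd (p (t + 1)) < j" by blast
    have "p (t + 1) = (fst (p t) + 1, snd (p t)) \<or> p (t + 1) = (fst (p t), snd (p t) - 1)"
      using path by (simp add: lattice_path_def)
    then show ?thesis using t by (intro exI[of _ t]) auto
  qed
  then obtain d where d: "\<And>j. snd (p (d j)) = j" "\<And>j. p (d j + 1) = (fst (p (d j)), j - 1)" by metis
  define g where "g j = fst (p (d j))" for j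
  have right: "g j \<le> fst (p t)" if "snd (p t) \<le> j - 1" for t j
  proof -
    have "d j \<le> t" using lattice_path_monotone[OF path, of t "d j"] that d(1)[of j] by linarith
    then show ?thesis unfolding g_def using lattice_path_monotone[OF path, of "d j" t] by simp
  qed
  have left: "fst (p t) \<le> g j" if "j \<le> snd (p t)" for t j
  proof (cases "t \<le> d j")
    case True then show ?thesis unfolding g_def using lattice_path_monotone[OF path, of t "d j"] by simp
  next
    case False
    then have "snd (p t) \<le> snd (p (d j + 1))" using lattice_path_monotone[OF path, of "d j + 1" t] by simp
    then show ?thesis using that d(2)[of j] by simp
  qed
  have top: "p (d j) = (g j, j)" and bottom: "p (d j + 1) = (g j, j - 1)" for j
    using d by (simp_all add: g_def prod_eq_iff)
  have "g \<in> quasi_periodic y x"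
    unfolding quasi_periodic_def
  proof (clarify)
    fix j
    have "p (d j + (-1) * (x + y)) = (g j - x, j + y)" unfolding per top by simp
    then have "g j - x \<le> g (j + y)" using left[of "j + y" "d j + (-1) * (x + y)"] by simp
    moreover have "p (d j + 1 + (-1) * (x + y)) = (g j - x, j + y - 1)" unfolding per bottom by simp
    then have "g (j + y) \<le> g j - x" using right[of "d j + 1 + (-1) * (x + y)" "j + y"] by simp
    ultimately show "g (j + y) = g j - x" by simp
  qed
  moreover have "g j \<le> g (j - 1)" for j using left[of "j - 1" "d j + 1"] bottom[of j] by simp
  moreover have "(g j, j) \<in> preim x y B" for j unfolding pre top[symmetric] by simp
  moreover have "(\<exists>p\<in>preim x y B. weakly_sw p (i - 1, j - 1)) \<longleftrightarrow> g j < i" for i j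
  proof
    assume "\<exists>p\<in>preim x y B. weakly_sw p (i - 1, j - 1)"
    then obtain t where "fst (p t) \<le> i - 1" "snd (p t) \<le> j - 1" unfolding pre weakly_sw_def by auto
    then show "g j < i" using right[of t j] by simp
  next
    assume "g j < i"
    then have "weakly_sw (p (d j + 1)) (i - 1, j - 1)" unfolding bottom weakly_sw_def by simp
    then show "\<exists>p\<in>preim x y B. weakly_sw p (i - 1, j - 1)" unfolding pre by blast
  qed
  moreover have "(\<exists>q\<in>preim x y B. weakly_sw (i, j) q) \<longleftrightarrow> i \<le> g j" for i j
  proof
    assume "\<exists>q\<in>preim x y B. weakly_sw (i, j) q"
    then obtain t where "i \<le> fst (p t)" "j \<le> snd (p t)" unfolding pre weakly_sw_def by auto
    then show "i \<le> g j" using left[of j t] by simp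
  next
    assume "i \<le> g j"
    then have "weakly_sw (i, j) (p (d j))" unfolding top weakly_sw_def by simp
    then show "\<exists>q\<in>preim x y B. weakly_sw (i, j) q" unfolding pre by blast
  qed
  ultimately show ?thesis using that[of g] by simp
qed

text \<open>A diagram given by the ends of its rows: row \<open>j\<close> of the preimage in the plane consists of the boxes in
columns \<open>\<mu> j + 1, \<dots>, \<kappa> j\<close>.\<close>

definition row_shape :: "int \<Rightarrow> int \<Rightarrow> (int \<Rightarrow> int) \<Rightarrow> (int \<Rightarrow> int) \<Rightarrow> orbit set \<Rightarrow> bool" where
  "row_shape x y \<mu> \<kappa> D \<longleftrightarrow> x \<ge> 1 \<and> y \<ge> 1 \<and> \<mu> \<in> quasi_periodic y x \<and> \<kappa> \<in> quasi_periodic y x \<and>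
     (\<forall>j. \<mu> j \<le> \<mu> (j - 1)) \<and> (\<forall>j. \<kappa> j \<le> \<kappa> (j - 1)) \<and> (\<forall>j. \<mu> j \<le> \<kappa> j) \<and>
     D = cyl x y ` {(i, j). \<mu> j < i \<and> i \<le> \<kappa> j}"

lemma row_shape_mem_iff:
  assumes "row_shape x y \<mu> \<kappa> D"
  shows "cyl x y (i, j) \<in> D \<longleftrightarrow> \<mu> j < i \<and> i \<le> \<kappa> j"
proof
  assume "cyl x y (i, j) \<in> D"
  then obtain i' j' where "cyl x y (i', j') = cyl x y (i, j)" and in': "\<mu> j' < i'" "i' \<le> \<kappa> j'"
    using assms by (auto simp: row_shape_def)
  then obtain t where t: "i = i' + t * x" "j = j' + (- t) * y" by (auto simp: cyl_eq_iff)
  have "\<mu> j = \<mu> j' + t * x" "\<kappa> j = \<kappa> j' + t * x"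
    unfolding t(2) using assms quasi_periodic_shift[of _ y x j' "- t"] by (simp_all add: row_shape_def)
  then show "\<mu> j < i \<and> i \<le> \<kappa> j" using in' t(1) by simp
next
  assume "\<mu> j < i \<and> i \<le> \<kappa> j"
  then show "cyl x y (i, j) \<in> D" using assms by (auto simp: row_shape_def)
qed

lemma cylindric_diagram_row_shape:
  assumes "cylindric_diagram x y D" "x \<ge> 1" "y \<ge> 1"
  obtains \<mu> \<kappa> where "row_shape x y \<mu> \<kappa> D"
proof -
  obtain BI BO where B: "boundary_loop x y BI" "boundary_loop x y BO" "loop_le x y BI BO"
    "D = boxes_between x y BI BO"
    using assms(1) unfolding cylindric_diagram_def by blast
  obtain \<mu> where \<mu>: "\<mu> \<in> quasi_periodic y x" "\<And>j. \<mu> j \<le> \<mu> (j - 1)" "\<And>j. (\<mu> j, j) \<in> preim x y BI"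
    "\<And>i j. (\<exists>p\<in>preim x y BI. weakly_sw p (i - 1, j - 1)) \<longleftrightarrow> \<mu> j < i"
    using boundary_loop_rows[OF B(1) assms(2,3)] by metis
  obtain \<kappa> where \<kappa>: "\<kappa> \<in> quasi_periodic y x" "\<And>j. \<kappa> j \<le> \<kappa> (j - 1)"
    "\<And>i j. (\<exists>q\<in>preim x y BO. weakly_sw (i, j) q) \<longleftrightarrow> i \<le> \<kappa> j"
    using boundary_loop_rows[OF B(2) assms(2,3)] by metis
  have "\<mu> j \<le> \<kappa> j" for j
    using \<mu>(3)[of j] B(3) \<kappa>(3)[of "\<mu> j" j] unfolding loop_le_def by blast
  then have "row_shape x y \<mu> \<kappa> D"
    using \<mu> \<kappa> assms(2,3) unfolding row_shape_def B(4) boxes_between_def by simp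
  then show ?thesis by (rule that)
qed

lemma row_shape_stretch:
  assumes D: "row_shape x y \<mu> \<kappa> D" and k: "k \<ge> 1"
  shows "row_shape (int k * x) y (\<lambda>j. int k * \<mu> j) (\<lambda>j. int k * \<kappa> j) (stretch k x y D)"
proof -
  have x: "x \<ge> 1" and y: "y \<ge> 1" using D by (simp_all add: row_shape_def)
  have "int k * x \<ge> 1" using mult_mono[of 1 "int k" 1 x] x k by simp
  moreover have "stretch k x y D = cyl (int k * x) y ` {(i, j). int k * \<mu> j < i \<and> i \<le> int k * \<kappa> j}"
  proof -
    have "(\<exists>i. (i, j) \<in> preim x y D \<and> int k * (i - 1) < i' \<and> i' \<le> int k * i)
      \<longleftrightarrow> int k * \<mu> j < i' \<and> i' \<le> int k * \<kappa> j" for i' j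
    proof
      assume "\<exists>i. (i, j) \<in> preim x y D \<and> int k * (i - 1) < i' \<and> i' \<le> int k * i"
      then obtain i where i: "\<mu> j < i" "i \<le> \<kappa> j" "int k * (i - 1) < i'" "i' \<le> int k * i"
        using row_shape_mem_iff[OF D] by (auto simp: preim_def)
      have "int k * \<mu> j \<le> int k * (i - 1)" "int k * i \<le> int k * \<kappa> j"
        using i(1,2) by (simp_all add: mult_left_mono)
      then show "int k * \<mu> j < i' \<and> i' \<le> int k * \<kappa> j" using i by linarith
    next
      assume i': "int k * \<mu> j < i' \<and> i' \<le> int k * \<kappa> j"
      define i where "i = (i' - 1) div int k + 1"
      have "i' - 1 = int k * (i - 1) + (i' - 1) mod int k" by (simp add: i_def)
      moreover have "0 \<le> (i' - 1) mod int k" "(i' - 1) mod int k < int k" using k by simp_all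
      ultimately have i: "int k * (i - 1) < i'" "i' \<le> int k * i" by (auto simp: algebra_simps)
      have "int k * \<mu> j < int k * i" "int k * (i - 1) < int k * \<kappa> j" using i i' by linarith+
      then have "\<mu> j < i" "i \<le> \<kappa> j" using k by simp_all
      then show "\<exists>i. (i, j) \<in> preim x y D \<and> int k * (i - 1) < i' \<and> i' \<le> int k * i"
        using i row_shape_mem_iff[OF D] by (auto simp: preim_def)
    qed
    note columns = this
    show ?thesis
    proof (intro set_eqI iffI)
      fix b assume "b \<in> stretch k x y D"
      then obtain i' i j where "b = cyl (int k * x) y (i', j)" "(i, j) \<in> preim x y D"
        "int k * (i - 1) < i'" "i' \<le> int k * i" unfolding stretch_def by blast
      moreover from this have "int k * \<mu> j < i' \<and> i' \<le> int k * \<kappa> j" using columns by blast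
      ultimately show "b \<in> cyl (int k * x) y ` {(i, j). int k * \<mu> j < i \<and> i \<le> int k * \<kappa> j}"
        by (intro image_eqI[of _ _ "(i', j)"]) simp_all
    next
      fix b assume "b \<in> cyl (int k * x) y ` {(i, j). int k * \<mu> j < i \<and> i \<le> int k * \<kappa> j}"
      then obtain i' j where b: "b = cyl (int k * x) y (i', j)" "int k * \<mu> j < i' \<and> i' \<le> int k * \<kappa> j" by auto
      then obtain i where "(i, j) \<in> preim x y D" "int k * (i - 1) < i'" "i' \<le> int k * i"
        using columns by blast
      then show "b \<in> stretch k x y D" unfolding stretch_def b(1) by blast
    qed
  qed
  ultimately show ?thesis using D
    by (simp add: row_shape_def quasi_periodic_def mult_left_mono right_diff_distrib)
qed

section \<open>Cutting a tableau along the first column\<close>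

lemma cyl_bij_rows:
  assumes D: "row_shape x y \<mu> \<kappa> D"
  shows "bij_betw (\<lambda>(j, i). cyl x y (i, j)) (SIGMA j:{0..<y}. {\<mu> j<..\<kappa> j}) D"
proof (rule bij_betw_imageI)
  have y: "y \<ge> 1" using D by (simp add: row_shape_def)
  show "inj_on (\<lambda>(j, i). cyl x y (i, j)) (SIGMA j:{0..<y}. {\<mu> j<..\<kappa> j})"
  proof (rule inj_onI, clarify)
    fix j i j' i' assume "j \<in> {0..<y}" "j' \<in> {0..<y}" "cyl x y (i, j) = cyl x y (i', j')"
    then obtain t where t: "i' = i + t * x" "j' = j - t * y" "j \<in> {0..<y}" "j' \<in> {0..<y}"
      by (auto simp: cyl_eq_iff)
    have "j' mod y = j mod y" unfolding t(2) by (metis mod_mult_self2 mult.commute mult_minus_right diff_conv_add_uminus)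
    then have "j' = j" using t(3,4) by simp
    then have "t = 0" using t(2) y by simp
    then show "j = j' \<and> i = i'" using t by simp
  qed
  show "(\<lambda>(j, i). cyl x y (i, j)) ` (SIGMA j:{0..<y}. {\<mu> j<..\<kappa> j}) = D"
  proof (intro set_eqI iffI)
    fix b assume "b \<in> (\<lambda>(j, i). cyl x y (i, j)) ` (SIGMA j:{0..<y}. {\<mu> j<..\<kappa> j})"
    then show "b \<in> D" using row_shape_mem_iff[OF D] by auto
  next
    fix b assume b: "b \<in> D"
    then obtain i j where ij: "b = cyl x y (i, j)" using D unfolding row_shape_def by auto
    define j' where "j' = j mod y"
    define i' where "i' = i + (j div y) * x"
    have "j' = j - (j div y) * y" unfolding j'_def using mod_div_mult_eq[of j y] by linarith
    then have eq: "b = cyl x y (i', j')" unfolding ij i'_def using cyl_shift[of x y i "j div y" j] by simp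
    then have "\<mu> j' < i' \<and> i' \<le> \<kappa> j'" using b row_shape_mem_iff[OF D] by simp
    moreover have "j' \<in> {0..<y}" unfolding j'_def using y by simp
    ultimately show "b \<in> (\<lambda>(j, i). cyl x y (i, j)) ` (SIGMA j:{0..<y}. {\<mu> j<..\<kappa> j})"
      unfolding eq by (intro image_eqI[of _ _ "(j', i')"]) simp_all
  qed
qed

lemma row_shape_finite: "row_shape x y \<mu> \<kappa> D \<Longrightarrow> finite D"
  using bij_betw_finite[OF cyl_bij_rows] by auto

text \<open>The last property transports neighbours, so that conditions on adjacent boxes need checking in
columns \<open>1, \<dots>, x\<close> only.\<close>

lemma cyl_first_column_rep:
  assumes "x \<ge> 1"
  obtains i' j' where "cyl x y (i', j') = cyl x y (i, j)" "1 \<le> i'" "i' \<le> x"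
    "\<And>u v. cyl x y (i' + u, j' + v) = cyl x y (i + u, j + v)"
proof -
  define t where "t = (i - 1) div x"
  have "i - t * x = (i - 1) mod x + 1" unfolding t_def using mod_div_mult_eq[of "i - 1" x] by linarith
  moreover have "0 \<le> (i - 1) mod x" "(i - 1) mod x < x" using assms by simp_all
  ultimately have "1 \<le> i - t * x" "i - t * x \<le> x" by linarith+
  moreover have "cyl x y (i - t * x + u, j + t * y + v) = cyl x y (i + u, j + v)" for u v
    using cyl_shift[of x y "i + u" "- t" "j + v"] by (simp add: algebra_simps)
  ultimately show ?thesis using that[of "i - t * x" "j + t * y"]
    by (metis add.right_neutral)
qed

lemma cyl_bij_unfolding:
  assumes "x \<ge> 1" and D: "D \<subseteq> range (cyl x y)"
  shows "bij_betw (cyl x y) (unfolding_of x y D) D"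
proof (rule bij_betw_imageI)
  show "inj_on (cyl x y) (unfolding_of x y D)"
  proof (rule inj_onI, clarify)
    fix i j i' j' assume "(i, j) \<in> unfolding_of x y D" "(i', j') \<in> unfolding_of x y D"
      "cyl x y (i, j) = cyl x y (i', j')"
    then obtain t where t: "i' = i + t * x" "j' = j - t * y" "1 \<le> i" "i \<le> x" "1 \<le> i'" "i' \<le> x"
      by (auto simp: cyl_eq_iff unfolding_of_def)
    have "t * x < 1 * x" "(-1) * x < t * x" using t by linarith+
    then have "t < 1" "-1 < t" using assms(1) by (simp_all only: mult_less_cancel_right)
    then have "t = 0" by simp
    then show "i = i' \<and> j = j'" using t by simp
  qed
  show "cyl x y ` unfolding_of x y D = D"
  proof (intro set_eqI iffI)
    fix b assume "b \<in> cyl x y ` unfolding_of x y D"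
    then show "b \<in> D" by (auto simp: unfolding_of_def preim_def)
  next
    fix b assume b: "b \<in> D"
    then obtain i j where ij: "b = cyl x y (i, j)" using D by auto
    obtain i' j' where i': "cyl x y (i', j') = cyl x y (i, j)" "1 \<le> i'" "i' \<le> x"
      using cyl_first_column_rep[OF assms(1)] by metis
    then have "(i', j') \<in> unfolding_of x y D" using b ij by (simp add: unfolding_of_def preim_def)
    then show "b \<in> cyl x y ` unfolding_of x y D" using i'(1) ij by (metis imageI)
  qed
qed

lemma cssyts_iff_first_columns:
  assumes "x \<ge> 1"
  shows "T \<in> cssyts x y D \<longleftrightarrow> T \<in> D \<rightarrow>\<^sub>E {1..} \<and> (\<forall>i j. 1 \<le> i \<and> i \<le> x \<and> cyl x y (i, j) \<in> D \<longrightarrow>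
     (cyl x y (i + 1, j) \<in> D \<longrightarrow> T (cyl x y (i, j)) \<le> T (cyl x y (i + 1, j))) \<and>
     (cyl x y (i, j + 1) \<in> D \<longrightarrow> T (cyl x y (i, j)) < T (cyl x y (i, j + 1))))"
    (is "_ \<longleftrightarrow> _ \<and> (\<forall>i j. 1 \<le> i \<and> i \<le> x \<and> _ i j \<longrightarrow> ?P i j)")
proof -
  have "?P i j" if "cyl x y (i, j) \<in> D"
    and all: "\<forall>i j. 1 \<le> i \<and> i \<le> x \<and> cyl x y (i, j) \<in> D \<longrightarrow> ?P i j" for i j
  proof -
    obtain i' j' where i': "cyl x y (i', j') = cyl x y (i, j)" "1 \<le> i'" "i' \<le> x"
      "\<And>u v. cyl x y (i' + u, j' + v) = cyl x y (i + u, j + v)"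
      using cyl_first_column_rep[OF assms] by metis
    have "cyl x y (i', j') \<in> D" using that(1) i'(1) by simp
    then have "?P i' j'" using all i'(2,3) by blast
    then show ?thesis using i'(1) i'(4)[of 1 0] i'(4)[of 0 1] by simp
  qed
  then show ?thesis unfolding cssyts_def by blast
qed

lemma cssyt_row_mono:
  assumes D: "row_shape x y \<mu> \<kappa> D" and T: "T \<in> cssyts x y D"
    and "i \<le> i'" "cyl x y (i, j) \<in> D" "cyl x y (i', j) \<in> D"
  shows "T (cyl x y (i, j)) \<le> T (cyl x y (i', j))"
  using assms(3,5)
proof (induction i' rule: int_ge_induct)
  case (step l)
  have "cyl x y (l, j) \<in> D"
    using step(1,3) assms(4) unfolding row_shape_mem_iff[OF D] by simp
  then show ?case using step T unfolding cssyts_def by (auto intro: order_trans)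
qed simp

lemma row_shape_antimono:
  assumes "row_shape x y \<mu> \<kappa> D" "j \<le> j'"
  shows "\<mu> j' \<le> \<mu> j" "\<kappa> j' \<le> \<kappa> j"
proof -
  have one: "\<mu> (l + 1) \<le> \<mu> l" "\<kappa> (l + 1) \<le> \<kappa> l" for l
  proof -
    have dec: "\<forall>j. \<mu> j \<le> \<mu> (j - 1)" "\<forall>j. \<kappa> j \<le> \<kappa> (j - 1)"
      using assms(1) by (simp_all add: row_shape_def)
    show "\<mu> (l + 1) \<le> \<mu> l" using spec[OF dec(1), of "l + 1"] by simp
    show "\<kappa> (l + 1) \<le> \<kappa> l" using spec[OF dec(2), of "l + 1"] by simp
  qed
  have "\<mu> j' \<le> \<mu> j \<and> \<kappa> j' \<le> \<kappa> j"
    using assms(2)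
  proof (induction j' rule: int_ge_induct)
    case (step l) then show ?case using one[of l] by linarith
  qed simp
  then show "\<mu> j' \<le> \<mu> j" "\<kappa> j' \<le> \<kappa> j" by simp_all
qed

lemma cssyt_col_strict:
  assumes D: "row_shape x y \<mu> \<kappa> D" and T: "T \<in> cssyts x y D"
    and "j < j'" "cyl x y (i, j) \<in> D" "cyl x y (i, j') \<in> D"
  shows "T (cyl x y (i, j)) < T (cyl x y (i, j'))"
  using assms(3,5)
proof (induction j' rule: int_gr_induct)
  case base then show ?case using assms(4) T unfolding cssyts_def by blast
next
  case (step l)
  have "cyl x y (i, l) \<in> D"
    using step(1,3) assms(4) row_shape_antimono[OF D, of l "l + 1"] row_shape_antimono[OF D, of j l]
    unfolding row_shape_mem_iff[OF D] by simp
  then have "T (cyl x y (i, j)) < T (cyl x y (i, l))" "T (cyl x y (i, l)) < T (cyl x y (i, l + 1))"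
    using step T unfolding cssyts_def by blast+
  then show ?case by simp
qed

text \<open>The columns \<open>1, \<dots>, x\<close> contain each box of the cylinder once.\<close>

lemma card_entries_split:
  assumes "x \<ge> 1" and D: "D \<subseteq> range (cyl x y)" and fin: "finite D"
  shows "card {b \<in> D. T b = a} = card {r \<in> first_col x y D. T (cyl x y (1, r)) = a}
    + card {p \<in> theta x y D. T (cyl x y p) = a}"
proof -
  let ?A = "{p \<in> unfolding_of x y D. T (cyl x y p) = a}"
  have bij: "bij_betw (cyl x y) (unfolding_of x y D) D" by (rule cyl_bij_unfolding[OF assms(1) D])
  have finU: "finite (unfolding_of x y D)" using bij_betw_finite[OF bij] fin by simp
  have "{b \<in> D. T b = a} = {b \<in> cyl x y ` unfolding_of x y D. T b = a}"
    using bij_betw_imp_surj_on[OF bij] by simp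
  then have "cyl x y ` ?A = {b \<in> D. T b = a}" by auto
  moreover have "inj_on (cyl x y) ?A" using bij_betw_imp_inj_on[OF bij] by (rule inj_on_subset) auto
  ultimately have "card {b \<in> D. T b = a} = card ?A" using card_image[of "cyl x y" ?A] by simp
  also have "?A = Pair 1 ` {r \<in> first_col x y D. T (cyl x y (1, r)) = a} \<union> {p \<in> theta x y D. T (cyl x y p) = a}"
  proof (rule set_eqI)
    fix p :: "int \<times> int"
    obtain i r where p: "p = (i, r)" by (cases p)
    show "p \<in> ?A \<longleftrightarrow> p \<in> Pair 1 ` {r \<in> first_col x y D. T (cyl x y (1, r)) = a} \<union> {p \<in> theta x y D. T (cyl x y p) = a}"
      unfolding p using assms(1) by (cases "i = 1") (simp_all add: unfolding_of_def theta_def first_col_def image_iff)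
  qed
  also have "card \<dots> = card (Pair (1::int) ` {r \<in> first_col x y D. T (cyl x y (1, r)) = a})
      + card {p \<in> theta x y D. T (cyl x y p) = a}"
  proof (rule card_Un_disjoint)
    show "finite (Pair (1::int) ` {r \<in> first_col x y D. T (cyl x y (1, r)) = a})"
      by (rule finite_subset[OF _ finU]) (use assms(1) in \<open>auto simp: unfolding_of_def first_col_def\<close>)
    show "finite {p \<in> theta x y D. T (cyl x y p) = a}"
      by (rule finite_subset[OF _ finU]) (auto simp: theta_def)
  qed (auto simp: theta_def)
  also have "card (Pair (1::int) ` {r \<in> first_col x y D. T (cyl x y (1, r)) = a})
      = card {r \<in> first_col x y D. T (cyl x y (1, r)) = a}"
    by (rule card_image) (simp add: inj_on_def)
  finally show ?thesis .
qed

lemma card_first_col_indicator: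
  assumes "c \<in> first_col_fillings x y D n"
  shows "int (card {r \<in> first_col x y D. c r = a}) = indicator_vec x y D c a"
proof (cases "a \<in> c ` first_col x y D")
  case True
  then obtain r where r: "r \<in> first_col x y D" "c r = a" by auto
  have "inj_on c (first_col x y D)"
    using assms unfolding first_col_fillings_def by (auto intro: strict_mono_on_imp_inj_on)
  then have "{r \<in> first_col x y D. c r = a} = {r}" using r by (auto simp: inj_on_def)
  then show ?thesis using True by (simp add: indicator_vec_def)
next
  case False
  then have empty: "{r \<in> first_col x y D. c r = a} = {}" by auto
  show ?thesis unfolding empty using False by (simp add: indicator_vec_def)
qed

text \<open>Restricting a tableau to the first column and to the other columns is a bijection. The only conditions
that relate the two parts are those between columns \<open>1\<close> and \<open>2\<close> and between columns \<open>x\<close> and \<open>x + 1\<close>, where column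
\<open>x + 1\<close> is column \<open>1\<close> shifted by \<open>y\<close> rows. As rows are intervals, these bound the first and the last box of a
row of \<open>\<theta>\<close>, and by monotonicity all its boxes: this is what the flags say. If \<open>x = 1\<close>, both neighbouring columns are
the first column itself, and the condition is part of the definition of its fillings.\<close>

theorem cyl_schur_coeff_first_column:
  assumes D: "row_shape x y \<mu> \<kappa> D"
  shows "cyl_schur_coeff x y D n \<beta> =
      (\<Sum>c \<in> first_col_fillings x y D n.
         flagged_kostka n (theta x y D) (\<lambda>i. int (\<beta> i) - indicator_vec x y D c i)
           (flag_a x y D c) (flag_b x y D n c))"
proof -
  let ?fc = "first_col x y D" and ?\<theta> = "theta x y D" and ?UF = "unfolding_of x y D"
  have x: "x \<ge> 1" and y: "y \<ge> 1" and Dr: "D \<subseteq> range (cyl x y)" using D by (auto simp: row_shape_def)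
  have fin: "finite D" by (rule row_shape_finite[OF D])
  have bij: "bij_betw (cyl x y) ?UF D" by (rule cyl_bij_unfolding[OF x Dr])
  have finU: "finite ?UF" using bij_betw_finite[OF bij] fin by simp
  have UF: "p \<in> ?UF \<longleftrightarrow> 1 \<le> fst p \<and> fst p \<le> x \<and> cyl x y p \<in> D" for p
    by (cases p) (auto simp: unfolding_of_def preim_def)
  have fc: "r \<in> ?fc \<longleftrightarrow> cyl x y (1, r) \<in> D" for r by (simp add: first_col_def preim_def)
  have \<theta>: "p \<in> ?\<theta> \<longleftrightarrow> 2 \<le> fst p \<and> fst p \<le> x \<and> cyl x y p \<in> D" for p
    by (cases p) (auto simp: theta_def UF)
  have wrap: "cyl x y (x + 1, r) = cyl x y (1, r + y)" for r
    using cyl_shift[of x y 1 1 "r + y"] by (simp add: add.commute)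
  have fin_fc: "finite ?fc"
  proof (rule finite_imageD)
    show "finite (Pair 1 ` ?fc :: (int \<times> int) set)"
      by (rule finite_subset[OF _ finU]) (use x in \<open>auto simp: UF fc\<close>)
  qed (simp add: inj_on_def)
  have fin_\<theta>: "finite ?\<theta>" by (rule finite_subset[OF _ finU]) (auto simp: theta_def)
  define TT where "TT = {T \<in> cssyts x y D. has_content n D T (\<lambda>i. int (\<beta> i))}"
  define CC where "CC = first_col_fillings x y D n"
  define UU where "UU c = {U \<in> ssyts ?\<theta>. has_content n ?\<theta> U (\<lambda>i. int (\<beta> i) - indicator_vec x y D c i)
    \<and> (\<forall>(i, r) \<in> ?\<theta>. U (i, r) \<in> {flag_a x y D c r..flag_b x y D n c r})}" for c
  have fin_CC: "finite CC"
  proof (rule finite_subset)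
    show "CC \<subseteq> ?fc \<rightarrow>\<^sub>E {1..n}" by (auto simp: CC_def first_col_fillings_def)
  qed (auto intro: finite_PiE fin_fc)
  have fin_UU: "finite (UU c)" for c
  proof (rule finite_subset)
    show "UU c \<subseteq> ?\<theta> \<rightarrow>\<^sub>E {1..n}"
    proof
      fix U assume "U \<in> UU c"
      then have "U \<in> ?\<theta> \<rightarrow>\<^sub>E {1..}" "\<forall>p\<in>?\<theta>. U p \<in> {1..n}"
        unfolding UU_def ssyts_def has_content_def by blast+
      then show "U \<in> ?\<theta> \<rightarrow>\<^sub>E {1..n}" unfolding PiE_iff by blast
    qed
  qed (auto intro: finite_PiE fin_\<theta>)
  define f where "f T = (restrict (\<lambda>r. T (cyl x y (1, r))) ?fc, restrict (\<lambda>p. T (cyl x y p)) ?\<theta>)"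
    for T :: "orbit \<Rightarrow> nat"
  define g where "g cU = restrict (\<lambda>b. let p = the_inv_into ?UF (cyl x y) b in
    if fst p = 1 then fst cU (snd p) else snd cU p) D"
    for cU :: "(int \<Rightarrow> nat) \<times> (int \<times> int \<Rightarrow> nat)"
  have g_cyl: "g (c, U) (cyl x y p) = (if fst p = 1 then c (snd p) else U p)"
    if "p \<in> ?UF" for c U p
  proof -
    have "the_inv_into ?UF (cyl x y) (cyl x y p) = p"
      by (rule the_inv_into_f_f[OF bij_betw_imp_inj_on[OF bij] that])
    then show ?thesis using that UF[of p] by (simp add: g_def)
  qed
  have g_fc: "g (c, U) (cyl x y (1, r)) = c r" if "r \<in> ?fc" for c U r
    using g_cyl[of "(1, r)" c U] that x by (simp add: UF fc)
  have g_\<theta>: "g (c, U) (cyl x y p) = U p" if "p \<in> ?\<theta>" for c U p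
    using g_cyl[of p c U] that by (auto simp: UF \<theta>)
  have "bij_betw f TT (SIGMA c:CC. UU c)"
  proof (rule bij_betw_byWitness[where f' = g])
    show "\<forall>T\<in>TT. g (f T) = T"
    proof
      fix T assume T: "T \<in> TT"
      show "g (f T) = T"
      proof
        fix b show "g (f T) b = T b"
        proof (cases "b \<in> D")
          case True
          then obtain p where p: "p \<in> ?UF" "b = cyl x y p" using bij_betw_imp_surj_on[OF bij] by blast
          obtain i r where ir: "p = (i, r)" by (cases p)
          show ?thesis
          proof (cases "i = 1")
            case True then show ?thesis using g_cyl[OF p(1)] p by (simp add: f_def UF fc ir)
          next
            case False
            then have "p \<in> ?\<theta>" using p(1) by (simp add: UF \<theta> ir)
            then show ?thesis using g_cyl[OF p(1)] p False by (simp add: f_def ir)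
          qed
        next
          case False
          then have "T b = undefined" using T by (auto simp: TT_def cssyts_def)
          then show ?thesis using False by (simp add: g_def f_def)
        qed
      qed
    qed
    show "\<forall>q\<in>(SIGMA c:CC. UU c). f (g q) = q"
    proof
      fix q assume "q \<in> (SIGMA c:CC. UU c)"
      then obtain c U where q: "q = (c, U)" "c \<in> CC" "U \<in> UU c" by auto
      have "c \<in> extensional ?fc" "U \<in> extensional ?\<theta>"
        using q by (auto simp: CC_def first_col_fillings_def UU_def ssyts_def PiE_def)
      then have "restrict (\<lambda>r. g (c, U) (cyl x y (1, r))) ?fc = c"
        "restrict (\<lambda>p. g (c, U) (cyl x y p)) ?\<theta> = U"
        by (auto simp: fun_eq_iff restrict_def extensional_def g_fc g_\<theta>)
      then show "f (g q) = q" by (simp add: f_def q(1))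
    qed
    show "f ` TT \<subseteq> (SIGMA c:CC. UU c)"
    proof
      fix q assume "q \<in> f ` TT"
      then obtain T where T: "T \<in> cssyts x y D" "has_content n D T (\<lambda>i. int (\<beta> i))" and q: "q = f T"
        by (auto simp: TT_def)
      define c where "c = restrict (\<lambda>r. T (cyl x y (1, r))) ?fc"
      define U where "U = restrict (\<lambda>p. T (cyl x y p)) ?\<theta>"
      note row = cssyt_row_mono[OF D T(1)] and col = cssyt_col_strict[OF D T(1)]
      have val: "T b \<in> {1..n}" if "b \<in> D" for b using T(2) that by (simp add: has_content_def)
      have c: "c \<in> CC"
        unfolding CC_def first_col_fillings_def
      proof (intro CollectI conjI impI allI)
        show "c \<in> ?fc \<rightarrow>\<^sub>E {1..n}" using val by (auto simp: c_def fc)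
        show "strict_mono_on ?fc c"
          by (rule strict_mono_onI) (simp add: c_def fc col)
        fix r assume x1: "x = 1" and r: "r \<in> ?fc \<and> r + y \<in> ?fc"
        have "cyl x y (1 + 1, r) = cyl x y (1, r + y)" using wrap[of r] x1 by simp
        then show "c r \<le> c (r + y)" using r row[of 1 "1 + 1" r] by (simp add: c_def fc)
      qed
      have card_c: "card {r \<in> ?fc. T (cyl x y (1, r)) = a} = card {r \<in> ?fc. c r = a}" for a
        by (rule arg_cong[where f = card]) (auto simp: c_def)
      have card_U: "card {p \<in> ?\<theta>. T (cyl x y p) = a} = card {p \<in> ?\<theta>. U p = a}" for a
        by (rule arg_cong[where f = card]) (auto simp: U_def)
      have "U \<in> UU c"
        unfolding UU_def
      proof (intro CollectI conjI ballI)
        show "U \<in> ssyts ?\<theta>" unfolding ssyts_def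
        proof (intro CollectI conjI allI impI)
          show "U \<in> ?\<theta> \<rightarrow>\<^sub>E {1..}" using val by (auto simp: U_def \<theta>)
          show "U (i, r) \<le> U (i', r)" if "(i, r) \<in> ?\<theta> \<and> (i', r) \<in> ?\<theta> \<and> i < i'" for i i' r
            using that row[of i i' r] by (simp add: U_def \<theta>)
          show "U (i, r) < U (i, r')" if "(i, r) \<in> ?\<theta> \<and> (i, r') \<in> ?\<theta> \<and> r < r'" for i r r'
            using that col[of r r' i] by (simp add: U_def \<theta>)
        qed
        show "has_content n ?\<theta> U (\<lambda>i. int (\<beta> i) - indicator_vec x y D c i)"
          unfolding has_content_def
        proof (intro conjI ballI)
          fix p assume "p \<in> ?\<theta>" then show "U p \<in> {1..n}" using val by (simp add: U_def \<theta>)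
        next
          fix a assume "a \<in> {1..n}"
          then have "int (card {b \<in> D. T b = a}) = int (\<beta> a)" using T(2) by (simp add: has_content_def)
          then show "int (card {p \<in> ?\<theta>. U p = a}) = int (\<beta> a) - indicator_vec x y D c a"
            using card_entries_split[OF x Dr fin, of T a] card_first_col_indicator[OF c[unfolded CC_def], of a]
            by (simp add: card_c card_U)
        qed
        fix p assume p: "p \<in> ?\<theta>"
        obtain i r where ir: "p = (i, r)" by (cases p)
        have i: "2 \<le> i" "i \<le> x" "cyl x y (i, r) \<in> D" using p by (simp_all add: \<theta> ir)
        have "flag_a x y D c r \<le> U (i, r)"
          using row[of 1 i r] i val[OF i(3)] p by (simp add: flag_a_def c_def U_def fc ir)
        moreover have "U (i, r) \<le> flag_b x y D n c r"
          using row[of i "x + 1" r] i val[OF i(3)] p by (simp add: flag_b_def c_def U_def fc ir wrap)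
        ultimately show "case p of (i, r) \<Rightarrow> U (i, r) \<in> {flag_a x y D c r..flag_b x y D n c r}"
          by (simp add: ir)
      qed
      then show "q \<in> (SIGMA c:CC. UU c)" using c by (simp add: q f_def c_def U_def)
    qed
    show "g ` (SIGMA c:CC. UU c) \<subseteq> TT"
    proof
      fix T assume "T \<in> g ` (SIGMA c:CC. UU c)"
      then obtain c U where T: "T = g (c, U)" and c: "c \<in> CC" and U: "U \<in> UU c" by auto
      have T_fc: "T (cyl x y (1, r)) = c r" if "r \<in> ?fc" for r using g_fc[OF that] T by simp
      have T_\<theta>: "T (cyl x y p) = U p" if "p \<in> ?\<theta>" for p using g_\<theta>[OF that] T by simp
      have c_val: "c r \<in> {1..n}" if "r \<in> ?fc" for r
        using c that by (auto simp: CC_def first_col_fillings_def)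
      have U_val: "U p \<in> {1..n}" if "p \<in> ?\<theta>" for p
        using U that by (auto simp: UU_def has_content_def)
      have U_row: "U (i, r) \<le> U (i', r)" if "(i, r) \<in> ?\<theta>" "(i', r) \<in> ?\<theta>" "i < i'" for i i' r
        using U that by (auto simp: UU_def ssyts_def)
      have U_col: "U (i, r) < U (i, r')" if "(i, r) \<in> ?\<theta>" "(i, r') \<in> ?\<theta>" "r < r'" for i r r'
        using U that by (auto simp: UU_def ssyts_def)
      have flags: "flag_a x y D c r \<le> U (i, r)" "U (i, r) \<le> flag_b x y D n c r" if "(i, r) \<in> ?\<theta>" for i r
        using U that by (auto simp: UU_def)
      have val: "T b \<in> {1..n}" if b: "b \<in> D" for b
      proof -
        obtain p where p: "p \<in> ?UF" "b = cyl x y p" using bij_betw_imp_surj_on[OF bij] b by blast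
        obtain i r where ir: "p = (i, r)" by (cases p)
        show ?thesis
        proof (cases "i = 1")
          case True
          then have "r \<in> ?fc" using p(1) by (simp add: UF fc ir)
          then show ?thesis using T_fc[of r] c_val[of r] p(2) True by (simp add: ir)
        next
          case False
          then have "p \<in> ?\<theta>" using p(1) by (simp add: UF \<theta> ir)
          then show ?thesis using T_\<theta> U_val p(2) by simp
        qed
      qed
      have "T \<in> cssyts x y D"
        unfolding cssyts_iff_first_columns[OF x]
      proof (intro conjI allI impI)
        show "T \<in> D \<rightarrow>\<^sub>E {1..}"
        proof (rule PiE_I)
          fix b assume "b \<in> D" then show "T b \<in> {1..}" using val by fastforce
        next
          fix b assume "b \<notin> D" then show "T b = undefined" by (simp add: T g_def)
        qed
        fix i r
        assume "1 \<le> i \<and> i \<le> x \<and> cyl x y (i, r) \<in> D"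
        then have i: "1 \<le> i" "i \<le> x" "cyl x y (i, r) \<in> D" by simp_all
        show "T (cyl x y (i, r)) \<le> T (cyl x y (i + 1, r))" if next_in: "cyl x y (i + 1, r) \<in> D"
        proof -
          \<comment> \<open>Lower flag, row of \<open>\<theta>\<close>, condition on the first column alone, upper flag.\<close>
          consider "i = 1" "i + 1 \<le> x" | "i \<ge> 2" "i + 1 \<le> x" | "i = x" "x = 1" | "i = x" "x \<ge> 2"
            using i by linarith
          then show ?thesis
          proof cases
            case 1
            then have "(i + 1, r) \<in> ?\<theta>" "r \<in> ?fc" using next_in i by (simp_all add: \<theta> fc)
            then show ?thesis using flags(1)[of "i + 1" r] 1 by (simp add: T_fc T_\<theta> flag_a_def)
          next
            case 2
            then have "(i, r) \<in> ?\<theta>" "(i + 1, r) \<in> ?\<theta>" using next_in i by (simp_all add: \<theta>)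
            then show ?thesis using U_row[of i r "i + 1"] by (simp add: T_\<theta>)
          next
            case 3
            then have i1: "i = 1" by simp
            have r: "r \<in> ?fc" using i(3) unfolding i1 fc .
            have ry: "r + y \<in> ?fc" using next_in unfolding 3(1) wrap fc .
            have "c r \<le> c (r + y)" using c r ry 3(2) by (simp add: CC_def first_col_fillings_def)
            moreover have "T (cyl x y (i, r)) = c r" unfolding i1 by (rule T_fc[OF r])
            moreover have "T (cyl x y (i + 1, r)) = c (r + y)" unfolding 3(1) wrap by (rule T_fc[OF ry])
            ultimately show ?thesis by simp
          next
            case 4
            then have r: "(i, r) \<in> ?\<theta>" "r + y \<in> ?fc" using next_in i wrap[of r] by (simp_all add: fc \<theta>)
            then show ?thesis using flags(2)[of i r] 4 wrap[of r] by (simp add: T_fc T_\<theta> flag_b_def)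
          qed
        qed
        show "T (cyl x y (i, r)) < T (cyl x y (i, r + 1))" if next_in: "cyl x y (i, r + 1) \<in> D"
        proof (cases "i = 1")
          case True
          then have r: "r \<in> ?fc" "r + 1 \<in> ?fc" using next_in i by (simp_all add: fc)
          have "c r < c (r + 1)"
            using c r by (auto simp: CC_def first_col_fillings_def intro: strict_mono_onD)
          then show ?thesis using r True by (simp add: T_fc)
        next
          case False
          then have "(i, r) \<in> ?\<theta>" "(i, r + 1) \<in> ?\<theta>" using next_in i by (simp_all add: \<theta>)
          then show ?thesis using U_col[of i r "r + 1"] by (simp add: T_\<theta>)
        qed
      qed
      moreover have "has_content n D T (\<lambda>i. int (\<beta> i))"
        unfolding has_content_def
      proof (intro conjI ballI)
        fix b assume "b \<in> D" then show "T b \<in> {1..n}" by (rule val)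
      next
        fix a assume a: "a \<in> {1..n}"
        have "{r \<in> ?fc. T (cyl x y (1, r)) = a} = {r \<in> ?fc. c r = a}" using T_fc by auto
        moreover have "{p \<in> ?\<theta>. T (cyl x y p) = a} = {p \<in> ?\<theta>. U p = a}" using T_\<theta> by auto
        moreover have "int (card {p \<in> ?\<theta>. U p = a}) = int (\<beta> a) - indicator_vec x y D c a"
          using U a by (simp add: UU_def has_content_def)
        ultimately show "int (card {b \<in> D. T b = a}) = int (\<beta> a)"
          using card_entries_split[OF x Dr fin, of T a] card_first_col_indicator[OF c[unfolded CC_def], of a]
          by simp
      qed
      ultimately show "T \<in> TT" by (simp add: TT_def)
    qed
  qed
  then have "card TT = card (SIGMA c:CC. UU c)" by (rule bij_betw_same_card)
  also have "\<dots> = (\<Sum>c\<in>CC. card (UU c))" by (rule card_SigmaI) (auto intro: fin_CC fin_UU)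
  finally show ?thesis
    by (simp add: cyl_schur_coeff_def TT_def CC_def UU_def flagged_kostka_def)
qed

section \<open>Tableaux as walks\<close>

lemma interval_prefix_eq:
  fixes a b :: int
  assumes "A \<subseteq> {a<..b}" and "\<And>c c'. c \<in> A \<Longrightarrow> a < c' \<Longrightarrow> c' \<le> c \<Longrightarrow> c' \<in> A"
  shows "A = {a<..a + int (card A)}"
proof (cases "A = {}")
  case False
  have fin: "finite A" by (rule finite_subset[OF assms(1)]) simp
  have "A = {a<..Max A}"
  proof (intro set_eqI iffI)
    fix c assume "c \<in> A" then show "c \<in> {a<..Max A}" using assms(1) Max_ge[OF fin, of c] by auto
  next
    fix c assume "c \<in> {a<..Max A}"
    then show "c \<in> A" using assms(2)[OF Max_in[OF fin False], of c] by simp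
  qed
  moreover have "a < Max A" using Max_in[OF fin False] assms(1) by auto
  ultimately show ?thesis by (metis card_greaterThanAtMost_int diff_add_cancel add.commute int_nat_eq less_imp_le diff_ge_0_iff_ge)
qed simp

lemma row_shape_repE:
  assumes "row_shape x y \<mu> \<kappa> D" "b \<in> D"
  obtains i j where "b = cyl x y (i, j)"
  using assms by (auto simp: row_shape_def)

text \<open>The column in which the entries \<open>\<le> l\<close> of row \<open>j\<close> end, provided that the row is weakly increasing.\<close>

definition row_end :: "int \<Rightarrow> int \<Rightarrow> (int \<Rightarrow> int) \<Rightarrow> (int \<Rightarrow> int) \<Rightarrow> (orbit \<Rightarrow> nat) \<Rightarrow> nat \<Rightarrow> int \<Rightarrow> int" where
  "row_end x y \<mu> \<kappa> T l j = \<mu> j + int (card {i. \<mu> j < i \<and> i \<le> \<kappa> j \<and> T (cyl x y (i, j)) \<le> l})"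

lemma row_end_set:
  assumes D: "row_shape x y \<mu> \<kappa> D" and T: "T \<in> cssyts x y D"
  shows "{i. \<mu> j < i \<and> i \<le> \<kappa> j \<and> T (cyl x y (i, j)) \<le> l} = {\<mu> j<..row_end x y \<mu> \<kappa> T l j}"
  unfolding row_end_def
proof (rule interval_prefix_eq[of _ _ "\<kappa> j"])
  fix c c' assume c: "c \<in> {i. \<mu> j < i \<and> i \<le> \<kappa> j \<and> T (cyl x y (i, j)) \<le> l}" and c': "\<mu> j < c'" "c' \<le> c"
  then have "T (cyl x y (c', j)) \<le> T (cyl x y (c, j))"
    by (intro cssyt_row_mono[OF D T]) (auto simp: row_shape_mem_iff[OF D])
  then show "c' \<in> {i. \<mu> j < i \<and> i \<le> \<kappa> j \<and> T (cyl x y (i, j)) \<le> l}" using c c' by auto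
qed auto

lemma row_end_iff:
  assumes D: "row_shape x y \<mu> \<kappa> D" and T: "T \<in> cssyts x y D" and "cyl x y (i, j) \<in> D"
  shows "T (cyl x y (i, j)) \<le> l \<longleftrightarrow> i \<le> row_end x y \<mu> \<kappa> T l j"
proof -
  have i: "\<mu> j < i" "i \<le> \<kappa> j" using assms(3) row_shape_mem_iff[OF D] by auto
  have "i \<in> {i. \<mu> j < i \<and> i \<le> \<kappa> j \<and> T (cyl x y (i, j)) \<le> l} \<longleftrightarrow> i \<in> {\<mu> j<..row_end x y \<mu> \<kappa> T l j}"
    by (simp only: row_end_set[OF D T])
  then show ?thesis using i by simp
qed

lemma row_end_bounds:
  assumes D: "row_shape x y \<mu> \<kappa> D"
  shows "\<mu> j \<le> row_end x y \<mu> \<kappa> T l j" "row_end x y \<mu> \<kappa> T l j \<le> \<kappa> j"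
proof -
  have "card {i. \<mu> j < i \<and> i \<le> \<kappa> j \<and> T (cyl x y (i, j)) \<le> l} \<le> card {\<mu> j<..\<kappa> j}"
    by (intro card_mono) auto
  moreover have "\<mu> j \<le> \<kappa> j" using D by (simp add: row_shape_def)
  ultimately show "\<mu> j \<le> row_end x y \<mu> \<kappa> T l j" "row_end x y \<mu> \<kappa> T l j \<le> \<kappa> j"
    by (simp_all add: row_end_def)
qed

lemma row_end_shift:
  assumes D: "row_shape x y \<mu> \<kappa> D"
  shows "row_end x y \<mu> \<kappa> T l (j + y) = row_end x y \<mu> \<kappa> T l j - x"
proof -
  have shift: "\<mu> (j + y) = \<mu> j - x" "\<kappa> (j + y) = \<kappa> j - x"
    using D by (simp_all add: row_shape_def quasi_periodic_def)
  have wrap: "cyl x y (i, j + y) = cyl x y (i + x, j)" for i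
    using cyl_shift[of x y i 1 "j + y"] by simp
  have "bij_betw (\<lambda>i. i + x) {i. \<mu> (j + y) < i \<and> i \<le> \<kappa> (j + y) \<and> T (cyl x y (i, j + y)) \<le> l}
      {i. \<mu> j < i \<and> i \<le> \<kappa> j \<and> T (cyl x y (i, j)) \<le> l}"
    by (rule bij_betw_byWitness[where f' = "\<lambda>i. i - x"]) (auto simp: shift wrap)
  then have "card {i. \<mu> (j + y) < i \<and> i \<le> \<kappa> (j + y) \<and> T (cyl x y (i, j + y)) \<le> l}
      = card {i. \<mu> j < i \<and> i \<le> \<kappa> j \<and> T (cyl x y (i, j)) \<le> l}" by (rule bij_betw_same_card)
  then show ?thesis by (simp add: row_end_def shift)
qed

lemma card_entries_by_rows:
  assumes D: "row_shape x y \<mu> \<kappa> D"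
    and le: "\<And>i j. cyl x y (i, j) \<in> D \<Longrightarrow> T (cyl x y (i, j)) \<le> l \<longleftrightarrow> i \<le> e j"
    and le': "\<And>i j. cyl x y (i, j) \<in> D \<Longrightarrow> T (cyl x y (i, j)) \<le> Suc l \<longleftrightarrow> i \<le> e' j"
    and bounds: "\<And>j. \<mu> j \<le> e j" "\<And>j. e j \<le> e' j" "\<And>j. e' j \<le> \<kappa> j"
  shows "int (card {b \<in> D. T b = Suc l}) = (\<Sum>j\<in>{0..<y}. e' j - e j)"
proof -
  let ?\<phi> = "\<lambda>(j, i). cyl x y (i, j)" and ?S = "SIGMA j:{0..<y}. {e j<..e' j}"
  have sub: "?S \<subseteq> (SIGMA j:{0..<y}. {\<mu> j<..\<kappa> j})"
  proof clarsimp
    fix j i assume "e j < i" "i \<le> e' j"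
    then show "\<mu> j < i \<and> i \<le> \<kappa> j" using bounds(1)[of j] bounds(3)[of j] by linarith
  qed
  have bij: "bij_betw ?\<phi> (SIGMA j:{0..<y}. {\<mu> j<..\<kappa> j}) D" by (rule cyl_bij_rows[OF D])
  have mem: "T (cyl x y (i, j)) = Suc l \<longleftrightarrow> e j < i \<and> i \<le> e' j" if "cyl x y (i, j) \<in> D" for i j
    using le[OF that] le'[OF that] by linarith
  have "{b \<in> D. T b = Suc l} = ?\<phi> ` ?S"
  proof (intro set_eqI iffI)
    fix b assume b: "b \<in> {b \<in> D. T b = Suc l}"
    then have "b \<in> ?\<phi> ` (SIGMA j:{0..<y}. {\<mu> j<..\<kappa> j})" using bij_betw_imp_surj_on[OF bij] by simp
    then obtain j i where ji: "j \<in> {0..<y}" "b = cyl x y (i, j)" by auto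
    then have "e j < i \<and> i \<le> e' j" using mem[of i j] b by simp
    then show "b \<in> ?\<phi> ` ?S" using ji by (intro image_eqI[of _ _ "(j, i)"]) simp_all
  next
    fix b assume "b \<in> ?\<phi> ` ?S"
    then obtain j i where ji: "(j, i) \<in> ?S" "b = cyl x y (i, j)" by auto
    then have "(j, i) \<in> (SIGMA j:{0..<y}. {\<mu> j<..\<kappa> j})" using sub by blast
    then have "b \<in> D" using row_shape_mem_iff[OF D, of i j] ji(2) by simp
    then show "b \<in> {b \<in> D. T b = Suc l}" using mem[of i j] ji by simp
  qed
  moreover have "inj_on ?\<phi> ?S" using bij_betw_imp_inj_on[OF bij] sub by (rule inj_on_subset)
  ultimately have "card {b \<in> D. T b = Suc l} = card ?S" by (simp add: card_image)
  also have "\<dots> = (\<Sum>j\<in>{0..<y}. card {e j<..e' j})" by (rule card_SigmaI) auto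
  finally show ?thesis using bounds(2) by simp
qed

lemma free_walk_mono:
  assumes "\<And>i. i < n \<Longrightarrow> G (Suc i) \<in> free_step y L (\<beta> i) (G i)" "l \<le> m" "m \<le> n"
  shows "G l j \<le> G m j"
  using assms(2,3)
proof (induction m rule: dec_induct)
  case (step m)
  then show ?case using assms(1)[of m] by (auto simp: free_step_def intro: order_trans)
qed simp

text \<open>A tableau is determined by its row ends \<open>e l j\<close>, and the tableau conditions become
\<open>e l j \<le> e (l + 1) j \<le> e l (j - 1)\<close>: rows are weakly increasing because there are row ends at all, columns are strict iff no
entry \<open>l + 1\<close> lies above an entry \<open>l + 1\<close>. Subtracting \<open>j\<close> turns the right inequality into the condition of
a strict step and the period \<open>x\<close> into \<open>x + y\<close>.\<close>

theorem cyl_schur_coeff_eq_card_walks: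
  assumes D: "row_shape x y \<mu> \<kappa> D"
  shows "cyl_schur_coeff x y D n \<beta> = card {G \<in> walks (\<lambda>l. strict_step y (x + y) (int (\<beta> (Suc l)))) n (\<lambda>j. \<mu> j - j).
    G n = (\<lambda>j. \<kappa> j - j)}"
proof -
  define TT where "TT = {T \<in> cssyts x y D. has_content n D T (\<lambda>i. int (\<beta> i))}"
  define W where "W = {G \<in> walks (\<lambda>l. strict_step y (x + y) (int (\<beta> (Suc l)))) n (\<lambda>j. \<mu> j - j).
    G n = (\<lambda>j. \<kappa> j - j)}"
  define f where "f T = (\<lambda>l j. if l \<le> n then row_end x y \<mu> \<kappa> T l j - j else 0)" for T
  define h where "h G p = (LEAST l. l \<le> n \<and> fst p \<le> G l (snd p) + snd p)" for G :: "nat \<Rightarrow> int \<Rightarrow> int" and p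
  define g where "g G = restrict (\<lambda>b. h G (SOME p. cyl x y p = b)) D" for G
  have y: "y \<ge> 1" using D by (simp add: row_shape_def)
  have mono\<mu>: "\<mu> j \<le> \<mu> (j - 1)" and mono\<kappa>: "\<kappa> j \<le> \<kappa> (j - 1)" for j using D by (simp_all add: row_shape_def)
  have W_step: "G (Suc l) \<in> strict_step y (x + y) (int (\<beta> (Suc l))) (G l)" if "G \<in> W" "l < n" for G l
    using that by (simp add: W_def walks_def)
  have W_ends: "G 0 = (\<lambda>j. \<mu> j - j)" "G n = (\<lambda>j. \<kappa> j - j)" if "G \<in> W" for G
    using that by (simp_all add: W_def walks_def)
  have W_qp: "G l \<in> quasi_periodic y (x + y)" if "G \<in> W" "l \<le> n" for G l
  proof (cases l)
    case 0
    then show ?thesis using W_ends(1)[OF that(1)] D by (simp add: row_shape_def quasi_periodic_def)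
  next
    case (Suc m)
    then show ?thesis using W_step[OF that(1), of m] that(2) by (simp add: strict_step_def free_step_def)
  qed
  have W_mono: "G l j \<le> G m j" if "G \<in> W" "l \<le> m" "m \<le> n" for G l m j
    using that W_step[OF that(1)]
    by (intro free_walk_mono[of n G y "x + y" "\<lambda>l. int (\<beta> (Suc l))"]) (auto simp: strict_step_def)
  have h_cyl: "g G (cyl x y (i, j)) = h G (i, j)" if G: "G \<in> W" and "cyl x y (i, j) \<in> D" for G i j
  proof -
    define q where "q = (SOME p. cyl x y p = cyl x y (i, j))"
    have "cyl x y q = cyl x y (i, j)" unfolding q_def by (rule someI[of _ "(i, j)"]) simp
    then obtain t where t: "i = fst q + t * x" "j = snd q + (- t) * y" by (auto simp: cyl_eq_iff)
    have same: "fst q \<le> G l (snd q) + snd q \<longleftrightarrow> i \<le> G l j + j" if "l \<le> n" for l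
    proof -
      have "G l j = G l (snd q) + t * (x + y)"
        unfolding t(2) using quasi_periodic_shift[OF W_qp[OF G that], of "snd q" "- t"] by simp
      then have "G l j + j = G l (snd q) + snd q + t * x"
        using t(2) unfolding distrib_left by linarith
      then show ?thesis using t(1) by linarith
    qed
    have "h G q = h G (i, j)"
      unfolding h_def fst_conv snd_conv
      by (rule arg_cong[where f = Least], rule ext, rule conj_cong[OF refl], rule same)
    then show ?thesis using that(2) by (simp add: g_def q_def)
  qed
  have h_le: "h G (i, j) \<le> l \<longleftrightarrow> i \<le> G l j + j" if G: "G \<in> W" and ij: "cyl x y (i, j) \<in> D" and l: "l \<le> n" for G i j l
  proof
    assume "i \<le> G l j + j"
    then show "h G (i, j) \<le> l" unfolding h_def using l by (intro Least_le) simp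
  next
    have "i \<le> G n j + j" using W_ends(2)[OF G] ij row_shape_mem_iff[OF D] by simp
    then have "h G (i, j) \<le> n \<and> i \<le> G (h G (i, j)) j + j"
      unfolding h_def fst_conv snd_conv
      by (rule LeastI[of "\<lambda>l. l \<le> n \<and> i \<le> G l j + j" n, OF conjI[OF order_refl]])
    moreover assume "h G (i, j) \<le> l"
    ultimately show "i \<le> G l j + j" using W_mono[OF G _ l, of "h G (i, j)" j] by simp
  qed
  have "bij_betw f TT W"
  proof (rule bij_betw_byWitness[where f' = g])
    have fT: "f T \<in> W" if "T \<in> TT" for T
    proof -
      have T: "T \<in> cssyts x y D" and content: "has_content n D T (\<lambda>i. int (\<beta> i))" using that by (auto simp: TT_def)
      let ?e = "row_end x y \<mu> \<kappa> T"
      have val: "T b \<in> {1..n}" if "b \<in> D" for b using content that by (simp add: has_content_def)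
      have e0: "?e 0 j = \<mu> j" for j
      proof -
        have "\<not> (\<mu> j < i \<and> i \<le> \<kappa> j \<and> T (cyl x y (i, j)) \<le> 0)" for i
          using val[of "cyl x y (i, j)"] row_shape_mem_iff[OF D, of i j] by auto
        then have "{i. \<mu> j < i \<and> i \<le> \<kappa> j \<and> T (cyl x y (i, j)) \<le> 0} = {}" by simp
        then show ?thesis unfolding row_end_def by (simp only: card.empty)
      qed
      have en: "?e n j = \<kappa> j" for j
      proof -
        have "\<mu> j < i \<and> i \<le> \<kappa> j \<and> T (cyl x y (i, j)) \<le> n \<longleftrightarrow> \<mu> j < i \<and> i \<le> \<kappa> j" for i
          using val[of "cyl x y (i, j)"] row_shape_mem_iff[OF D, of i j] by auto
        then have "{i. \<mu> j < i \<and> i \<le> \<kappa> j \<and> T (cyl x y (i, j)) \<le> n} = {\<mu> j<..\<kappa> j}"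
          by (simp add: greaterThanAtMost_def greaterThan_def atMost_def Collect_conj_eq)
        moreover have "\<mu> j \<le> \<kappa> j" using D by (simp add: row_shape_def)
        ultimately show ?thesis unfolding row_end_def by simp
      qed
      have e_mono: "?e l j \<le> ?e (Suc l) j" for l j
      proof -
        have "card {i. \<mu> j < i \<and> i \<le> \<kappa> j \<and> T (cyl x y (i, j)) \<le> l}
            \<le> card {i. \<mu> j < i \<and> i \<le> \<kappa> j \<and> T (cyl x y (i, j)) \<le> Suc l}"
          by (rule card_mono) (auto intro: finite_subset[of _ "{\<mu> j<..\<kappa> j}"])
        then show ?thesis by (simp add: row_end_def)
      qed
      \<comment> \<open>An entry \<open>l + 1\<close> in row \<open>j\<close> beyond the end in row \<open>j - 1\<close> would lie above an entry that is at least as large.\<close>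
      have e_strip: "?e (Suc l) j \<le> ?e l (j - 1)" for l j
      proof (rule ccontr)
        assume not_le: "\<not> ?thesis"
        define c where "c = ?e (Suc l) j"
        have c: "\<mu> (j - 1) < c" "c \<le> \<kappa> j"
          using not_le row_end_bounds(1)[OF D, of "j - 1" T l] row_end_bounds(2)[OF D, of T "Suc l" j]
          unfolding c_def by linarith+
        have in1: "cyl x y (c, j) \<in> D" using c mono\<mu>[of j] by (simp add: row_shape_mem_iff[OF D])
        have in2: "cyl x y (c, j - 1) \<in> D" using c mono\<kappa>[of j] by (simp add: row_shape_mem_iff[OF D])
        have "T (cyl x y (c, j)) \<le> Suc l" using row_end_iff[OF D T in1, of "Suc l"] by (simp add: c_def)
        moreover have "T (cyl x y (c, j - 1)) < T (cyl x y (c, j))"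
          by (rule cssyt_col_strict[OF D T _ in2 in1]) simp
        ultimately have "T (cyl x y (c, j - 1)) \<le> l" by simp
        then have "c \<le> ?e l (j - 1)" using row_end_iff[OF D T in2] by simp
        then show False using not_le by (simp add: c_def)
      qed
      have "f T (Suc l) \<in> strict_step y (x + y) (int (\<beta> (Suc l))) (f T l)" if l: "l < n" for l
      proof -
        have "int (card {b \<in> D. T b = Suc l}) = (\<Sum>j\<in>{0..<y}. ?e (Suc l) j - ?e l j)"
          using row_end_iff[OF D T] row_end_bounds[OF D, where T = T] e_mono by (intro card_entries_by_rows[OF D]) auto
        moreover have "int (card {b \<in> D. T b = Suc l}) = int (\<beta> (Suc l))"
          using content l by (simp add: has_content_def)
        moreover have "f T (Suc l) \<in> quasi_periodic y (x + y)"
          using l by (simp add: f_def quasi_periodic_def row_end_shift[OF D])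
        moreover have "f T (Suc l) j < f T l (j - 1)" for j using l e_strip[of l j] by (simp add: f_def)
        ultimately show ?thesis using l e_mono by (simp add: strict_step_def free_step_def f_def)
      qed
      then show ?thesis by (simp add: W_def walks_def f_def e0 en fun_eq_iff)
    qed
    then show "f ` TT \<subseteq> W" by blast
    have gG: "g G \<in> TT" if G: "G \<in> W" for G
    proof -
      have val: "h G (i, j) \<in> {1..n}" if ij: "cyl x y (i, j) \<in> D" for i j
      proof -
        have "\<not> i \<le> G 0 j + j" "i \<le> G n j + j"
          using ij W_ends[OF G] row_shape_mem_iff[OF D] by simp_all
        then show ?thesis using h_le[OF G ij, of 0] h_le[OF G ij, of n] by simp
      qed
      have valb: "g G b \<in> {1..n}" if bD: "b \<in> D" for b
      proof -
        obtain i j where "b = cyl x y (i, j)" by (rule row_shape_repE[OF D bD])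
        then show ?thesis using val bD h_cyl[OF G] by simp
      qed
      have "g G \<in> cssyts x y D"
        unfolding cssyts_def
      proof (intro CollectI conjI allI impI)
        show "g G \<in> D \<rightarrow>\<^sub>E {1..}"
        proof (rule PiE_I)
          fix b assume "b \<in> D" then show "g G b \<in> {1..}" using valb by fastforce
        next
          fix b assume "b \<notin> D" then show "g G b = undefined" by (simp add: g_def)
        qed
        fix i j assume ij: "cyl x y (i, j) \<in> D"
        show "g G (cyl x y (i, j)) \<le> g G (cyl x y (i + 1, j))" if nxt: "cyl x y (i + 1, j) \<in> D"
        proof -
          have n: "h G (i + 1, j) \<le> n" using val[OF nxt] by simp
          then have "i + 1 \<le> G (h G (i + 1, j)) j + j" using h_le[OF G nxt n] by simp
          then show ?thesis using h_le[OF G ij n] by (simp add: h_cyl[OF G] ij nxt)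
        qed
        show "g G (cyl x y (i, j)) < g G (cyl x y (i, j + 1))" if nxt: "cyl x y (i, j + 1) \<in> D"
        proof -
          obtain l where l: "h G (i, j + 1) = Suc l" "l < n" using val[OF nxt] by (cases "h G (i, j + 1)") auto
          then have "i \<le> G (Suc l) (j + 1) + (j + 1)" using h_le[OF G nxt, of "Suc l"] by simp
          moreover have "G (Suc l) (j + 1) < G l ((j + 1) - 1)"
            using W_step[OF G l(2)] unfolding strict_step_def by blast
          ultimately have "h G (i, j) \<le> l" using h_le[OF G ij, of l] l(2) by simp
          then show ?thesis using l(1) by (simp add: h_cyl[OF G] ij nxt)
        qed
      qed
      moreover have "has_content n D (g G) (\<lambda>i. int (\<beta> i))"
        unfolding has_content_def
      proof (intro conjI ballI)
        fix b assume "b \<in> D" then show "g G b \<in> {1..n}" by (rule valb)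
      next
        fix a assume "a \<in> {1..n}"
        then obtain l where a: "a = Suc l" "l < n" by (cases a) auto
        have "int (card {b \<in> D. g G b = Suc l}) = (\<Sum>j\<in>{0..<y}. (G (Suc l) j + j) - (G l j + j))"
        proof (rule card_entries_by_rows[OF D])
          show "\<mu> j \<le> G l j + j" for j using W_mono[OF G, of 0 l j] W_ends(1)[OF G] a(2) by simp
          show "G (Suc l) j + j \<le> \<kappa> j" for j using W_mono[OF G, of "Suc l" n j] W_ends(2)[OF G] a(2) by simp
          show "G l j + j \<le> G (Suc l) j + j" for j using W_mono[OF G, of l "Suc l" j] a(2) by simp
        qed (use h_le[OF G] h_cyl[OF G] a(2) in auto)
        also have "\<dots> = int (\<beta> (Suc l))"
          using W_step[OF G a(2)] by (simp add: strict_step_def free_step_def)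
        finally show "int (card {b \<in> D. g G b = a}) = int (\<beta> a)" by (simp add: a(1))
      qed
      ultimately show ?thesis by (simp add: TT_def)
    qed
    then show "g ` W \<subseteq> TT" by blast
    show "\<forall>T\<in>TT. g (f T) = T"
    proof
      fix T assume TT: "T \<in> TT"
      then have T: "T \<in> cssyts x y D" and val: "\<And>b. b \<in> D \<Longrightarrow> T b \<in> {1..n}"
        by (auto simp: TT_def has_content_def)
      show "g (f T) = T"
      proof
        fix b show "g (f T) b = T b"
        proof (cases "b \<in> D")
          case True
          then obtain i j where b: "b = cyl x y (i, j)" using D unfolding row_shape_def by auto
          have ij: "cyl x y (i, j) \<in> D" using True b by simp
          have "h (f T) (i, j) \<le> l \<longleftrightarrow> T b \<le> l" if "l \<le> n" for l
            using h_le[OF fT[OF TT] ij that] row_end_iff[OF D T ij, of l] that b by (simp add: f_def)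
          note h_iff = this
          have Tn: "T b \<le> n" using val[OF True] by simp
          have "h (f T) (i, j) \<le> T b" using h_iff[OF Tn] by simp
          moreover have "T b \<le> h (f T) (i, j)" using h_iff[of "h (f T) (i, j)"] calculation Tn by simp
          ultimately have "h (f T) (i, j) = T b" by simp
          then show ?thesis using h_cyl[OF fT[OF TT] ij] b by simp
        next
          case False
          then have "T b = undefined" using T by (auto simp: cssyts_def)
          then show ?thesis using False by (simp add: g_def)
        qed
      qed
    qed
    show "\<forall>G\<in>W. f (g G) = G"
    proof
      fix G assume G: "G \<in> W"
      show "f (g G) = G"
      proof (intro ext)
        fix l j show "f (g G) l j = G l j"
        proof (cases "l \<le> n")
          case True
          have ends: "\<mu> j \<le> G l j + j" "G l j + j \<le> \<kappa> j"
            using W_mono[OF G, of 0 l j] W_mono[OF G, of l n j] W_ends[OF G] True by simp_all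
          have "{i. \<mu> j < i \<and> i \<le> \<kappa> j \<and> g G (cyl x y (i, j)) \<le> l} = {\<mu> j<..G l j + j}"
          proof (rule set_eqI)
            fix i
            show "i \<in> {i. \<mu> j < i \<and> i \<le> \<kappa> j \<and> g G (cyl x y (i, j)) \<le> l} \<longleftrightarrow> i \<in> {\<mu> j<..G l j + j}"
            proof (cases "cyl x y (i, j) \<in> D")
              case ij: True
              then show ?thesis using h_le[OF G ij True] h_cyl[OF G ij] row_shape_mem_iff[OF D, of i j] by simp
            next
              case False
              then show ?thesis using ends row_shape_mem_iff[OF D, of i j] by auto
            qed
          qed
          then show ?thesis using True ends by (simp add: f_def row_end_def)
        next
          case False then show ?thesis using G by (simp add: f_def W_def walks_def)
        qed
      qed
    qed
  qed
  then show ?thesis unfolding cyl_schur_coeff_def TT_def W_def by (rule bij_betw_same_card)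
qed

section \<open>Polynomiality of stretched coefficients\<close>

text \<open>On each residue class two polynomials agree at infinitely many integers and are therefore equal, also at
the small arguments.\<close>

lemma quasi_poly_eventually_poly_imp_poly:
  assumes "quasi_poly g" and ev: "\<And>k. k \<ge> k0 \<Longrightarrow> g (int k) = poly p (of_nat k)"
  shows "g t = poly p (of_int t)"
proof -
  obtain M q where M: "M > 0" "\<And>t. g t = poly (q (t mod M)) (of_int t)"
    using assms(1) unfolding quasi_poly_def by blast
  define r where "r = t mod M"
  define s0 where "s0 = nat (\<bar>t\<bar> + int k0)"
  have "poly (q r - p) (of_int (t + int s * M)) = 0" if s: "s \<ge> s0" for s
  proof -
    have "int s * 1 \<le> int s * M" using M(1) by (intro mult_left_mono) auto
    then have ge: "t + int s * M \<ge> int k0" using s unfolding s0_def by linarith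
    then have "g (t + int s * M) = poly p (of_int (t + int s * M))"
      using ev[of "nat (t + int s * M)"] by simp
    moreover have "g (t + int s * M) = poly (q r) (of_int (t + int s * M))"
      unfolding M(2) r_def by simp
    ultimately show ?thesis by simp
  qed
  then have "(\<lambda>s. rat_of_int (t + int s * M)) ` {s0..} \<subseteq> {z. poly (q r - p) z = 0}" by blast
  moreover have "inj_on (\<lambda>s. rat_of_int (t + int s * M)) {s0..}"
    using M(1) by (auto simp: inj_on_def)
  then have "infinite ((\<lambda>s. rat_of_int (t + int s * M)) ` {s0..})"
    using infinite_Ici[of s0] by (simp add: finite_image_iff)
  ultimately have "infinite {z. poly (q r - p) z = 0}" using finite_subset by blast
  then have "q r - p = 0" using poly_roots_finite by blast
  then show ?thesis unfolding M(2) r_def[symmetric] by simp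
qed

text \<open>The row ends in one period, for all levels \<open>0, \<dots>, n\<close>, are the coordinates of a lattice point in the dilate by
\<open>k\<close> of a fixed rational polytope: all interlacing inequalities and step sizes are homogeneous once \<open>k\<close> is a
coordinate of its own. Its vertices need not be integral, so this argument alone yields only a
quasi-polynomial.\<close>

theorem card_strict_walks_quasi_poly:
  fixes \<mu> \<kappa> :: "int \<Rightarrow> int" and \<beta> :: "nat \<Rightarrow> int"
  assumes y: "y \<ge> 1" and n: "n \<ge> 1"
    and \<mu>: "\<mu> \<in> quasi_periodic y x" and \<kappa>: "\<kappa> \<in> quasi_periodic y x"
  shows "\<exists>g. quasi_poly g \<and> (\<forall>k::nat. k \<ge> 1 \<longrightarrow> of_nat (card
    {G \<in> walks (\<lambda>i. strict_step y (int k * x + y) (int k * \<beta> i)) n (\<lambda>j. int k * \<mu> j - j).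
       G n = (\<lambda>j. int k * \<kappa> j - j)}) = g (int k))"
proof -
  define Y where "Y = nat y"
  have Y: "int Y = y" "Y > 0" using y by (simp_all add: Y_def)
  \<comment> \<open>Coordinate \<open>0\<close> is the dilation factor, hence the offset \<open>1\<close>.\<close>
  define v where "v l j = 1 + l * Y + nat j" for l :: nat and j :: int
  define d where "d = Suc n * Y"
  define lev where "lev i = (i - 1) div Y" for i :: nat
  define row where "row i = int ((i - 1) mod Y)" for i :: nat
  have v_inv: "lev (v l j) = l" "row (v l j) = j" "v l j \<in> {1..d}" if "l \<le> n" "j \<in> {0..<y}" for l j
  proof -
    have j: "nat j < Y" using that(2) Y by auto
    have vm: "v l j - 1 = l * Y + nat j" by (simp add: v_def)
    show "lev (v l j) = l" unfolding lev_def vm using j by simp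
    show "row (v l j) = j" unfolding row_def vm using j that(2) by simp
    have "l * Y + nat j < Suc l * Y" using j by simp
    also have "\<dots> \<le> Suc n * Y" using that(1) by (intro mult_right_mono) auto
    finally show "v l j \<in> {1..d}" by (simp add: v_def d_def)
  qed
  have v_surj: "v (lev i) (row i) = i" "lev i \<le> n" "row i \<in> {0..<y}" if "i \<in> {1..d}" for i
  proof -
    show "v (lev i) (row i) = i" using that div_mult_mod_eq[of "i - 1" Y] by (simp add: v_def lev_def row_def)
    have "i - 1 < Suc n * Y" using that Y(2) by (auto simp: d_def)
    then have "(i - 1) div Y < Suc n" by (rule less_mult_imp_div_less)
    then show "lev i \<le> n" by (simp add: lev_def)
    show "row i \<in> {0..<y}" unfolding row_def Y(1)[symmetric] using Y(2) by simp
  qed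
  define lo where "lo i = (if lev i = n then \<kappa> (row i) else \<mu> (row i))" for i
  define hi where "hi i = (if lev i = 0 then \<mu> (row i) else \<kappa> (row i))" for i
  \<comment> \<open>The row end of row \<open>j - 1\<close>; row \<open>-1\<close> is row \<open>y - 1\<close> moved by one period, of width \<open>k * x\<close>.\<close>
  define pred where "pred l j w = (if j = 0 then w (v l (y - 1)) + x * w 0 else w (v l (j - 1)))"
    for l j and w :: "nat \<Rightarrow> int"
  define Ls where "Ls = (\<lambda>(l, j) w. w (v (Suc l) j) - w (v l j)) ` ({..<n} \<times> {0..<y})
    \<union> (\<lambda>(l, j) w. pred l j w - w (v (Suc l) j)) ` ({..<n} \<times> {0..<y})
    \<union> (\<lambda>l w. (\<Sum>j\<in>{0..<y}. w (v (Suc l) j) - w (v l j)) - \<beta> l * w 0) ` {..<n}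
    \<union> (\<lambda>l w. \<beta> l * w 0 - (\<Sum>j\<in>{0..<y}. w (v (Suc l) j) - w (v l j))) ` {..<n}"
  have proj: "(\<lambda>w. w (v l j)) \<in> int_forms (Suc d)" if "l \<le> n" "j \<in> {0..<y}" for l j
    using int_forms_proj[of "v l j" "Suc d" 1] v_inv(3)[OF that] by simp
  have proj0: "(\<lambda>w. c * w 0) \<in> int_forms (Suc d)" for c by (rule int_forms_proj) simp
  have pred_form: "(\<lambda>w. pred l j w) \<in> int_forms (Suc d)" if "l \<le> n" "j \<in> {0..<y}" for l j
  proof (cases "j = 0")
    case True
    have "(\<lambda>w. w (v l (y - 1)) + x * w 0) \<in> int_forms (Suc d)"
      using that y by (intro int_forms_add proj proj0) auto
    then show ?thesis using True by (simp add: pred_def)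
  next
    case False
    have "(\<lambda>w. w (v l (j - 1))) \<in> int_forms (Suc d)" using that False by (intro proj) auto
    then show ?thesis using False by (simp add: pred_def)
  qed
  have "finite Ls" by (simp add: Ls_def)
  moreover have "Ls \<subseteq> int_forms (Suc d)"
    unfolding Ls_def by (auto intro!: int_forms_diff int_forms_sum proj proj0 pred_form)
  ultimately obtain g where g: "quasi_poly g"
    "\<And>k. k > 0 \<Longrightarrow> of_nat (card {w \<in> ray_box lo hi d k. \<forall>L\<in>Ls. 0 \<le> L w}) = g k"
    using card_ray_box_quasi_poly[of Ls d lo hi] by auto
  have Ls_iff: "(\<forall>L\<in>Ls. 0 \<le> L w) \<longleftrightarrow> (\<forall>l<n. (\<forall>j\<in>{0..<y}. w (v l j) \<le> w (v (Suc l) j))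
    \<and> (\<forall>j\<in>{0..<y}. w (v (Suc l) j) \<le> pred l j w)
    \<and> (\<Sum>j\<in>{0..<y}. w (v (Suc l) j) - w (v l j)) = \<beta> l * w 0)" for w
    unfolding Ls_def by (auto simp: ball_Un intro: antisym)
  have "card {G \<in> walks (\<lambda>i. strict_step y (int k * x + y) (int k * \<beta> i)) n (\<lambda>j. int k * \<mu> j - j).
       G n = (\<lambda>j. int k * \<kappa> j - j)} = card {w \<in> ray_box lo hi d (int k). \<forall>L\<in>Ls. 0 \<le> L w}"
    (is "card ?W = card ?R") if k: "k \<ge> 1" for k :: nat
  proof -
    define L where "L = int k * x + y"
    have P_qp: "(\<lambda>j. int k * \<mu> j - j) \<in> quasi_periodic y L" "(\<lambda>j. int k * \<kappa> j - j) \<in> quasi_periodic y L"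
      using \<mu> \<kappa> by (simp_all add: quasi_periodic_def L_def right_diff_distrib)
    define f where "f G = (\<lambda>i. if i = 0 then int k else if i \<le> d then G (lev i) (row i) + row i else 0)"
      for G :: "nat \<Rightarrow> int \<Rightarrow> int"
    define h where "h w = (\<lambda>l j. if l \<le> n then w (v l (j mod y)) - (j div y) * (int k * x) - j else 0)"
      for w :: "nat \<Rightarrow> int"
    have f_v: "f G (v l j) = G l j + j" if "l \<le> n" "j \<in> {0..<y}" for G l j
    proof -
      have "v l j \<noteq> 0" "v l j \<le> d" using v_inv(3)[OF that] by auto
      then show ?thesis using v_inv(1,2)[OF that] by (simp add: f_def)
    qed
    have f_0: "f G 0 = int k" for G by (simp add: f_def)
    have h_v: "h w l j = w (v l j) - j" if "l \<le> n" "j \<in> {0..<y}" for w l j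
      using that by (simp add: h_def)
    have h_qp: "h w l \<in> quasi_periodic y L" if "l \<le> n" for w l
      using that y by (simp add: h_def quasi_periodic_def L_def algebra_simps)
    have W_step: "G (Suc l) \<in> strict_step y L (int k * \<beta> l) (G l)" if "G \<in> ?W" "l < n" for G l
      using that by (simp add: walks_def L_def)
    have W_ends: "G 0 = (\<lambda>j. int k * \<mu> j - j)" "G n = (\<lambda>j. int k * \<kappa> j - j)" if "G \<in> ?W" for G
      using that by (simp_all add: walks_def)
    have W_qp: "G l \<in> quasi_periodic y L" if "G \<in> ?W" "l \<le> n" for G l
    proof (cases l)
      case 0 then show ?thesis using W_ends(1)[OF that(1)] P_qp(1) by simp
    next
      case (Suc m)
      then show ?thesis using W_step[OF that(1), of m] that(2) by (simp add: strict_step_def free_step_def)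
    qed
    have W_mono: "G l j \<le> G m j" if "G \<in> ?W" "l \<le> m" "m \<le> n" for G l m j
      using that W_step[OF that(1)]
      by (intro free_walk_mono[of n G y L "\<lambda>l. int k * \<beta> l"]) (auto simp: strict_step_def)
    have pred_f: "pred l j (f G) = G l (j - 1) + (j - 1)" if G: "G \<in> ?W" and "l \<le> n" "j \<in> {0..<y}" for G l j
    proof (cases "j = 0")
      case True
      have "G l (- 1) = G l (y - 1) + L"
        using quasi_periodic_shift[OF W_qp[OF G that(2)], of "-1" 1] by simp
      then show ?thesis using True f_v[OF that(2), of "y - 1" G] y
        by (simp add: pred_def f_0 L_def algebra_simps)
    next
      case False
      then show ?thesis using f_v[OF that(2), of "j - 1" G] that(3) by (simp add: pred_def)
    qed
    have pred_h: "pred l j w = h w l (j - 1) + (j - 1)" if "w 0 = int k" "l \<le> n" "j \<in> {0..<y}" for w l j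
    proof (cases "j = 0")
      case True
      have "h w l (- 1) = h w l (y - 1) + L"
        using quasi_periodic_shift[OF h_qp[OF that(2)], of w "-1" 1] by simp
      then show ?thesis using True h_v[OF that(2), of "y - 1" w] y that(1)
        by (simp add: pred_def L_def algebra_simps)
    next
      case False
      then show ?thesis using h_v[OF that(2), of "j - 1" w] that(3) by (simp add: pred_def)
    qed
    have "bij_betw f ?W ?R"
    proof (rule bij_betw_byWitness[where f' = h])
      show "\<forall>G\<in>?W. h (f G) = G"
      proof
        fix G assume G: "G \<in> ?W"
        have "h (f G) l = G l" for l
        proof (cases "l \<le> n")
          case True
          show ?thesis
          proof (rule quasi_periodic_eqI[OF h_qp[OF True] W_qp[OF G True]])
            fix j assume "j \<in> {0..<y}"
            then show "h (f G) l j = G l j" using h_v[OF True] f_v[OF True] by simp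
          qed (use y in simp)
        next
          case False then show ?thesis using G by (simp add: h_def walks_def fun_eq_iff)
        qed
        then show "h (f G) = G" by (rule ext)
      qed
      show "\<forall>w\<in>?R. f (h w) = w"
      proof
        fix w assume "w \<in> ?R"
        then have w: "w 0 = int k" "\<And>i. i > d \<Longrightarrow> w i = 0" by (auto simp: ray_box_def)
        show "f (h w) = w"
        proof
          fix i
          consider "i = 0" | "i \<in> {1..d}" | "i > d" by fastforce
          then show "f (h w) i = w i"
          proof cases
            case 2
            then have "f (h w) i = h w (lev i) (row i) + row i" by (simp add: f_def)
            also have "\<dots> = w (v (lev i) (row i))" using h_v v_surj(2,3)[OF 2] by simp
            finally show ?thesis using v_surj(1)[OF 2] by simp
          qed (simp_all add: f_def w)
        qed
      qed
      show "f ` ?W \<subseteq> ?R"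
      proof
        fix w assume "w \<in> f ` ?W"
        then obtain G where G: "G \<in> ?W" and w: "w = f G" by blast
        have "lo i * int k \<le> f G i \<and> f G i \<le> hi i * int k" if i: "i \<in> {1..d}" for i
        proof -
          note vs = v_surj[OF i]
          have "f G i = G (lev i) (row i) + row i" using f_v[OF vs(2,3), of G] vs(1) by simp
          moreover have "int k * \<mu> (row i) - row i \<le> G (lev i) (row i)"
            using W_mono[OF G, of 0 "lev i" "row i"] W_ends(1)[OF G] vs(2) by simp
          moreover have "G (lev i) (row i) \<le> int k * \<kappa> (row i) - row i"
            using W_mono[OF G, of "lev i" n "row i"] W_ends(2)[OF G] vs(2) by simp
          moreover have "lev i = 0 \<Longrightarrow> G (lev i) (row i) = int k * \<mu> (row i) - row i"
            using W_ends(1)[OF G] by simp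
          moreover have "lev i = n \<Longrightarrow> G (lev i) (row i) = int k * \<kappa> (row i) - row i"
            using W_ends(2)[OF G] by simp
          ultimately show ?thesis using n by (simp add: lo_def hi_def mult.commute)
        qed
        then have "f G \<in> ray_box lo hi d (int k)" by (simp add: ray_box_def) (simp add: f_def)
        moreover have "\<forall>L\<in>Ls. 0 \<le> L (f G)"
          unfolding Ls_iff
        proof (intro allI impI conjI ballI)
          fix l assume l: "l < n"
          then have ln: "l \<le> n" "Suc l \<le> n" by simp_all
          note step = W_step[OF G l]
          fix j assume j: "j \<in> {0..<y}"
          show "f G (v l j) \<le> f G (v (Suc l) j)"
            using step by (simp add: f_v[OF ln(1) j] f_v[OF ln(2) j] strict_step_def free_step_def)
          have "G (Suc l) j < G l (j - 1)" using step unfolding strict_step_def by blast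
          then show "f G (v (Suc l) j) \<le> pred l j (f G)"
            by (simp add: f_v[OF ln(2) j] pred_f[OF G ln(1) j])
        next
          fix l assume l: "l < n"
          then have ln: "l \<le> n" "Suc l \<le> n" by simp_all
          have "(\<Sum>j\<in>{0..<y}. f G (v (Suc l) j) - f G (v l j)) = (\<Sum>j\<in>{0..<y}. G (Suc l) j - G l j)"
            by (intro sum.cong refl) (simp add: f_v[OF ln(1)] f_v[OF ln(2)])
          also have "\<dots> = int k * \<beta> l" using W_step[OF G l] by (simp add: strict_step_def free_step_def)
          finally show "(\<Sum>j\<in>{0..<y}. f G (v (Suc l) j) - f G (v l j)) = \<beta> l * f G 0" by (simp add: f_def)
        qed
        ultimately show "w \<in> ?R" by (simp add: w)
      qed
      show "h ` ?R \<subseteq> ?W"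
      proof
        fix G assume "G \<in> h ` ?R"
        then obtain w where w: "w \<in> ?R" and G: "G = h w" by blast
        have w0: "w 0 = int k" using w by (simp add: ray_box_def)
        have box: "lo i * int k \<le> w i \<and> w i \<le> hi i * int k" if "i \<in> {1..d}" for i
          using w that by (simp add: ray_box_def)
        have ineq: "\<And>l. l < n \<Longrightarrow> (\<forall>j\<in>{0..<y}. w (v l j) \<le> w (v (Suc l) j))"
          "\<And>l. l < n \<Longrightarrow> (\<forall>j\<in>{0..<y}. w (v (Suc l) j) \<le> pred l j w)"
          "\<And>l. l < n \<Longrightarrow> (\<Sum>j\<in>{0..<y}. w (v (Suc l) j) - w (v l j)) = \<beta> l * w 0"
          using w Ls_iff[of w] by simp_all
        have h0: "h w 0 = (\<lambda>j. int k * \<mu> j - j)"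
        proof (rule quasi_periodic_eqI[OF h_qp P_qp(1)])
          fix j assume j: "j \<in> {0..<y}"
          have "w (v 0 j) = int k * \<mu> j"
            using box[of "v 0 j"] v_inv[of 0 j] j n by (simp add: lo_def hi_def mult.commute)
          then show "h w 0 j = int k * \<mu> j - j" using h_v[of 0 j w] j by simp
        qed (use y in simp_all)
        have hn: "h w n = (\<lambda>j. int k * \<kappa> j - j)"
        proof (rule quasi_periodic_eqI[OF h_qp P_qp(2)])
          fix j assume j: "j \<in> {0..<y}"
          have "w (v n j) = int k * \<kappa> j"
            using box[of "v n j"] v_inv[of n j] j n by (simp add: lo_def hi_def mult.commute)
          then show "h w n j = int k * \<kappa> j - j" using h_v[of n j w] j by simp
        qed (use y in simp_all)
        have "h w (Suc l) \<in> strict_step y L (int k * \<beta> l) (h w l)" if l: "l < n" for l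
        proof -
          have ln: "l \<le> n" "Suc l \<le> n" using l by simp_all
          have "h w l j \<le> h w (Suc l) j" for j
          proof -
            have "j mod y \<in> {0..<y}" using y by simp
            then have "h w l (j mod y) \<le> h w (Suc l) (j mod y)"
              using ineq(1)[OF l] by (simp add: h_v[OF ln(1)] h_v[OF ln(2)])
            then show ?thesis using quasi_periodic_mod[OF h_qp[OF ln(1)], of w j]
              quasi_periodic_mod[OF h_qp[OF ln(2)], of w j] by simp
          qed
          moreover have "h w (Suc l) j < h w l (j - 1)" for j
          proof -
            have no: "overtaking y (h w l) (h w (Suc l)) = {}"
            proof (rule equals0I)
              fix i assume "i \<in> overtaking y (h w l) (h w (Suc l))"
              then have i: "i \<in> {0..<y}" "h w l (i - 1) \<le> h w (Suc l) i" by (simp_all add: overtaking_def)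
              have "h w (Suc l) i = w (v (Suc l) i) - i" by (rule h_v[OF ln(2) i(1)])
              also have "\<dots> \<le> pred l i w - i" using ineq(2)[OF l] i(1) by simp
              also have "\<dots> = h w l (i - 1) - 1" using pred_h[where w = w and l = l and j = i, OF w0 ln(1) i(1)] by simp
              finally show False using i(2) by simp
            qed
            have "y > 0" using y by simp
            from free_step_overtaking_iff[OF h_qp[OF ln(1)] h_qp[OF ln(2)] this, of w j w] no
            show ?thesis by simp
          qed
          moreover have "(\<Sum>j\<in>{0..<y}. h w (Suc l) j - h w l j) = int k * \<beta> l"
          proof -
            have "(\<Sum>j\<in>{0..<y}. h w (Suc l) j - h w l j) = (\<Sum>j\<in>{0..<y}. w (v (Suc l) j) - w (v l j))"
              by (intro sum.cong refl) (simp add: h_v[OF ln(1)] h_v[OF ln(2)])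
            then show ?thesis using ineq(3)[OF l] w0 by simp
          qed
          ultimately show ?thesis using h_qp[OF ln(2)] by (simp add: strict_step_def free_step_def)
        qed
        moreover have "h w l = (\<lambda>_. 0)" if "l > n" for l using that by (simp add: h_def fun_eq_iff)
        ultimately show "G \<in> ?W" using h0 hn by (simp add: G walks_def L_def)
      qed
    qed
    then show ?thesis by (rule bij_betw_same_card)
  qed
  then have "\<forall>k::nat. k \<ge> 1 \<longrightarrow> of_nat (card
    {G \<in> walks (\<lambda>i. strict_step y (int k * x + y) (int k * \<beta> i)) n (\<lambda>j. int k * \<mu> j - j).
       G n = (\<lambda>j. int k * \<kappa> j - j)}) = g (int k)"
    using g(2) by simp
  with g(1) show ?thesis by blast
qed

text \<open>A strict step moves every particle to at most one place before the old position of the particle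
ahead of it, and these gaps add up to \<open>L - y\<close>.\<close>

lemma strict_step_empty:
  assumes P: "P \<in> quasi_periodic y L" and y: "y \<ge> 1" and b: "b > L - y"
  shows "strict_step y L b P = {}"
proof (rule ccontr)
  assume "strict_step y L b P \<noteq> {}"
  then obtain Q where Q: "\<And>j. Q j < P (j - 1)" "(\<Sum>j\<in>{0..<y}. Q j - P j) = b"
    by (auto simp: strict_step_def free_step_def)
  have "(\<Sum>j\<in>{0..<y}. Q j) \<le> (\<Sum>j\<in>{0..<y}. P (j - 1) - 1)"
    using Q(1) by (intro sum_mono) (simp add: int_one_le_iff_zero_less zle_diff1_eq)
  also have "\<dots> = (\<Sum>j\<in>{0..<y}. P j) + L - y"
    using sum_pred_quasi_periodic[OF P] y by (simp add: sum_subtractf)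
  finally show False using Q(2) b by (simp add: sum_subtractf)
qed

theorem corollary41:
  fixes x y :: int and n :: nat and \<beta> :: "nat \<Rightarrow> nat" and D :: "orbit set"
  assumes "x \<ge> 1" and "y \<ge> 1" and "n \<ge> 1" and "cylindric_diagram x y D"
  shows "cyl_schur_coeff x y D n \<beta> =
      (\<Sum>c \<in> first_col_fillings x y D n.
         flagged_kostka n (theta x y D) (\<lambda>i. int (\<beta> i) - indicator_vec x y D c i)
           (flag_a x y D c) (flag_b x y D n c))
    \<and> (\<exists>p :: rat poly. \<forall>k :: nat. k \<ge> 1 \<longrightarrow>
         of_nat (cyl_schur_coeff (int k * x) y (stretch k x y D) n (\<lambda>i. k * \<beta> i)) = poly p (of_nat k))"
proof
  obtain \<mu> \<kappa> where D: "row_shape x y \<mu> \<kappa> D"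
    using cylindric_diagram_row_shape[OF assms(4,1,2)] by blast
  then show "cyl_schur_coeff x y D n \<beta> =
      (\<Sum>c \<in> first_col_fillings x y D n.
         flagged_kostka n (theta x y D) (\<lambda>i. int (\<beta> i) - indicator_vec x y D c i)
           (flag_a x y D c) (flag_b x y D n c))"
    by (rule cyl_schur_coeff_first_column)
  define b where "b i = int (\<beta> (Suc i))" for i
  define W where "W k = {G \<in> walks (\<lambda>i. strict_step y (int k * x + y) (int k * b i)) n (\<lambda>j. int k * \<mu> j - j).
       G n = (\<lambda>j. int k * \<kappa> j - j)}" for k
  have count: "cyl_schur_coeff (int k * x) y (stretch k x y D) n (\<lambda>i. k * \<beta> i) = card (W k)"
    if "k \<ge> 1" for k
    using cyl_schur_coeff_eq_card_walks[OF row_shape_stretch[OF D that], of n "\<lambda>i. k * \<beta> i"]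
    by (simp add: W_def b_def)
  have \<mu>: "\<mu> \<in> quasi_periodic y x" and \<kappa>: "\<kappa> \<in> quasi_periodic y x"
    and dec: "\<And>j. \<mu> j \<le> \<mu> (j - 1)" "\<And>j. \<kappa> j \<le> \<kappa> (j - 1)"
    using D by (simp_all add: row_shape_def)
  \<comment> \<open>If some \<open>b i > x\<close>, the signed formula is not available, but then \<open>W k\<close> is empty.\<close>
  have "\<exists>p :: rat poly. \<forall>k \<ge> 1. of_nat (card (W k)) = poly p (of_nat k)"
  proof (cases "\<forall>i<n. b i \<le> x")
    case True
    obtain g where g: "quasi_poly g" "\<And>k::nat. k \<ge> 1 \<Longrightarrow> of_nat (card (W k)) = g (int k)"
      using card_strict_walks_quasi_poly[OF assms(2,3) \<mu> \<kappa>, of b] unfolding W_def by blast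
    have "eventually_poly (\<lambda>k. of_nat (card (W k)))"
      unfolding W_def using True
      by (intro eventually_poly_card_strict_walks assms(1,2) \<mu> \<kappa> dec) (simp add: b_def)
    then obtain p k0 where p: "\<And>k. k \<ge> k0 \<Longrightarrow> of_nat (card (W k)) = poly p (of_nat k :: rat)"
      by (rule eventually_polyE) blast
    have "g (int k) = poly p (of_nat k)" if "k \<ge> max 1 k0" for k
      using g(2)[of k] p[of k] that by simp
    then have "g t = poly p (of_int t)" for t
      by (rule quasi_poly_eventually_poly_imp_poly[OF g(1)])
    then show ?thesis using g(2) by (intro exI[of _ p]) simp
  next
    case False
    then obtain i where i: "i < n" "b i > x" by auto
    have "W k = {}" if k: "k \<ge> 1" for k
    proof (rule ccontr)
      assume "W k \<noteq> {}"
      then obtain G where G: "G \<in> walks (\<lambda>i. strict_step y (int k * x + y) (int k * b i)) n (\<lambda>j. int k * \<mu> j - j)"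
        by (auto simp: W_def)
      have qp: "(\<lambda>j. int k * \<mu> j - j) \<in> quasi_periodic y (int k * x + y)"
        using \<mu> by (simp add: quasi_periodic_def right_diff_distrib)
      have "int k * \<mu> j - j < int k * \<mu> (j - 1) - (j - 1)" for j
        using mult_left_mono[OF dec(1)[of j], of "int k"] by simp
      then have "G i \<in> quasi_periodic y (int k * x + y)"
        using strict_walk_state[OF G qp, of i] i(1) by simp
      moreover have "int k * b i > int k * x + y - y" using i(2) k by simp
      ultimately have "strict_step y (int k * x + y) (int k * b i) (G i) = {}"
        by (intro strict_step_empty assms(2))
      moreover have "G (Suc i) \<in> strict_step y (int k * x + y) (int k * b i) (G i)"
        using G i(1) by (simp add: walks_def)
      ultimately show False by blast
    qed
    then show ?thesis by (intro exI[of _ 0]) simp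
  qed
  then show "\<exists>p :: rat poly. \<forall>k :: nat. k \<ge> 1 \<longrightarrow>
      of_nat (cyl_schur_coeff (int k * x) y (stretch k x y D) n (\<lambda>i. k * \<beta> i)) = poly p (of_nat k)"
    using count by simp
qed

end
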